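(* Let $s:C\times C\to\mathbb{R}$ be a kernel satisfying the Kernel Assumption and let $\mu=\mu_s$ be the probability measure on $\mathbb R$ associated to $s$ (both defined in the context). Then the Stieltjes transform $S(\lambda)=\int\frac{\mu(dx)}{\lambda-x}$ is an algebraic function of $\lambda$, i.e., there exists some not-identically-vanishing polynomial $F(X,Y)$ in two variables with complex coefficients such that $F(\lambda,S(\lambda))=0$ for all complex numbers $\lambda$ not in the support of $\mu$.
   Context: **Color space.** $C=[0,1]\times S^1$, where $S^1$ is the unit circle in $\mathbb{C}$; $P$ is the product of the uniform probability measures on $[0,1]$ and $S^1$. The spaces $L^p(C)$ and $L^p(C\times C)$ are taken with respect to $P$ and $P\times P$. **Kernel Assumption** on $s:C\times C\to\mathbb R$: (I) $s$ is nonnegative and symmetric: $s(c,c')=s(c',c)\ge 0$. (II) $s$ has a Fourier expansion $s(c,c')=\sum_{i,j\in\mathbb Z}s_{ij}(x,y)\xi^i\eta^j$ for $c=(x,\xi)$, $c'=(y,\eta)$, where all but finitely many of the coefficients $s_{ij}:[0,1]\times[0,1]\to\mathbb C$ vanish identically. (III) There is a finite partition $\mathcal I$ of $[0,1]$ into subintervals of positive length such that every $s_{ij}$ is constant on every set $I\times J$ with $I,J\in\mathcal I$. (IV) $\|s\|_{L^1(C\times C)}>0$. **The measure $\mu_s$.** For each positive integer $N$ let $C^{(N)}=\{c^{(N)}_1,\dots,c^{(N)}_{N^2}\}\subset C$ be the set of pairs $(x,\xi)$ with $x\in[0,1)\cap\frac1N\mathbb Z$ and $\xi^N=1$, and $C^{(\infty)}=\bigcup_N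 C^{(N)}$. Let $\{\tilde Y_e\}$, indexed by the subsets $e\subset C^{(\infty)}$ with $|e|\in\{1,2\}$, be an i.i.d. family of standard normal random variables. Let $\tilde X^{(N)}$ be the $N^2\times N^2$ real symmetric random matrix with entries $\tilde X^{(N)}_{ij}=2^{\delta_{ij}/2}\sqrt{s(c_i^{(N)},c_j^{(N)})}\,\tilde Y_{\{c_i^{(N)},c_j^{(N)}\}}$, and let $\tilde L^{(N)}$ be the empirical distribution of the eigenvalues of $\tilde X^{(N)}/N$. It is known that $\tilde L^{(N)}$ tends weakly in probability as $N\to\infty$ to a (deterministic) limit with bounded support; this limit is denoted $\mu_s$. *)

theory Defs
  imports
    "HOL-Probability.Probability"
    "Jordan_Normal_Form.Char_Poly"
begin

type_synonym color = "real \<times> complex"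

definition color_space :: "color set" where
  "color_space = {0..1} \<times> sphere 0 1"

text \<open>The measure below lives on all of \<^typ>\<open>color\<close> and is concentrated on \<^const>\<open>color_space\<close>.
  The uniform probability on the circle is the law of a uniformly distributed angle.\<close>

definition circle_measure :: "complex measure" where
  "circle_measure = distr (uniform_measure lborel {0..2 * pi}) borel cis"

definition color_measure :: "color measure" where
  "color_measure = uniform_measure lborel {0..1} \<Otimes>\<^sub>M circle_measure"

text \<open>Kernels are total functions; only their values on \<^const>\<open>color_space\<close> ever matter.\<close>

definition kernel_L1_norm :: "(color \<Rightarrow> color \<Rightarrow> real) \<Rightarrow> real" where
  "kernel_L1_norm s =
    (LINT p : color_space \<times> color_space | (color_measure \<Otimes>\<^sub>M color_measure). \<bar>s (fst p) (snd p)\<bar>)"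

definition fourier_support :: "(int \<Rightarrow> int \<Rightarrow> real \<Rightarrow> real \<Rightarrow> complex) \<Rightarrow> (int \<times> int) set" where
  "fourier_support \<sigma> = {(i, j). \<exists>x\<in>{0..1}. \<exists>y\<in>{0..1}. \<sigma> i j x y \<noteq> 0}"

definition interval_partition :: "real set set \<Rightarrow> bool" where
  "interval_partition \<I> \<longleftrightarrow> finite \<I> \<and> partition_on {0..1} \<I> \<and>
    (\<forall>I\<in>\<I>. is_interval I \<and> measure lborel I > 0)"

definition kernel_assumption :: "(color \<Rightarrow> color \<Rightarrow> real) \<Rightarrow> bool" where
  "kernel_assumption s \<longleftrightarrow>
    (\<forall>c\<in>color_space. \<forall>c'\<in>color_space. s c c' = s c' c \<and> s c c' \<ge> 0) \<and>
    (\<exists>\<sigma> :: int \<Rightarrow> int \<Rightarrow> real \<Rightarrow> real \<Rightarrow> complex.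
      finite (fourier_support \<sigma>) \<and>
      (\<forall>x y \<xi> \<eta>. (x, \<xi>) \<in> color_space \<longrightarrow> (y, \<eta>) \<in> color_space \<longrightarrow>
        complex_of_real (s (x, \<xi>) (y, \<eta>)) =
          (\<Sum>(i, j)\<in>fourier_support \<sigma>. \<sigma> i j x y * \<xi> powi i * \<eta> powi j)) \<and>
      (\<exists>\<I>. interval_partition \<I> \<and>
        (\<forall>i j. \<forall>I\<in>\<I>. \<forall>J\<in>\<I>. (\<lambda>(x, y). \<sigma> i j x y) constant_on I \<times> J))) \<and>
    kernel_L1_norm s > 0"

definition color_grid :: "nat \<Rightarrow> color set" where
  "color_grid N = {(x, \<xi>). x \<in> {0..<1} \<and> (\<exists>k::int. x = of_int k / real N) \<and> \<xi> ^ N = 1}"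

definition color_grid_union :: "color set" where
  "color_grid_union = (\<Union>N\<in>{1..}. color_grid N)"

text \<open>\<open>c N 0, \<dots>, c N (N\<^sup>2 - 1)\<close> lists the elements of \<open>color_grid N\<close> without repetition,
  in an arbitrary order.\<close>

definition grid_enumeration :: "(nat \<Rightarrow> nat \<Rightarrow> color) \<Rightarrow> bool" where
  "grid_enumeration c \<longleftrightarrow> (\<forall>N\<ge>1. bij_betw (c N) {..<N\<^sup>2} (color_grid N))"

definition iid_std_normal_family :: "'w measure \<Rightarrow> (color set \<Rightarrow> 'w \<Rightarrow> real) \<Rightarrow> bool" where
  "iid_std_normal_family M Y \<longleftrightarrow>
    (let E = {e. e \<subseteq> color_grid_union \<and> card e \<in> {1, 2}} in
      prob_space M \<and>
      prob_space.indep_vars M (\<lambda>_. borel) Y E \<and>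
      (\<forall>e\<in>E. distributed M lborel (Y e) std_normal_density))"

definition color_matrix ::
  "(color \<Rightarrow> color \<Rightarrow> real) \<Rightarrow> (nat \<Rightarrow> nat \<Rightarrow> color) \<Rightarrow> (color set \<Rightarrow> 'w \<Rightarrow> real) \<Rightarrow> nat \<Rightarrow> 'w \<Rightarrow> real mat"
  where
  "color_matrix s c Y N \<omega> = mat (N\<^sup>2) (N\<^sup>2) (\<lambda>(i, j).
     2 powr (of_bool (i = j) / 2) * sqrt (s (c N i) (c N j)) * Y {c N i, c N j} \<omega>)"

text \<open>Eigenvalues are counted with algebraic multiplicity. For a real symmetric matrix the
  characteristic polynomial splits over the reals, so that no eigenvalue is lost.
  (For the matrix of dimension 0 the value is irrelevant.)\<close>

definition empirical_eigenvalue_distribution :: "real mat \<Rightarrow> real measure" where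
  "empirical_eigenvalue_distribution A =
    distr (measure_pmf (pmf_of_multiset (proots (char_poly A)))) borel (\<lambda>x. x)"

text \<open>Weak convergence in probability of random measures \<open>L N \<omega>\<close> to a deterministic measure:
  integrals of bounded continuous functions converge in probability.\<close>

definition tendsto_weakly_in_probability ::
  "'w measure \<Rightarrow> (nat \<Rightarrow> 'w \<Rightarrow> real measure) \<Rightarrow> real measure \<Rightarrow> bool" where
  "tendsto_weakly_in_probability M L \<mu> \<longleftrightarrow>
    (\<forall>f :: real \<Rightarrow> real. continuous_on UNIV f \<longrightarrow> bounded (range f) \<longrightarrow>
      (\<forall>\<epsilon>>0. (\<lambda>N. measure M {\<omega> \<in> space M. \<bar>(LINT x|L N \<omega>. f x) - (LINT x|\<mu>. f x)\<bar> > \<epsilon>})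
        \<longlonglongrightarrow> 0))"

text \<open>The measure \<open>\<mu>\<^sub>s\<close> as a relation: such a limit is unique, and it depends neither on the
  enumeration \<open>c\<close> nor on the realisation \<open>M, Y\<close> of the Gaussian family. Its existence and
  the boundedness of its support are known results, not part of the definition.\<close>

definition is_kernel_measure ::
  "'w measure \<Rightarrow> (color set \<Rightarrow> 'w \<Rightarrow> real) \<Rightarrow> (nat \<Rightarrow> nat \<Rightarrow> color) \<Rightarrow>
    (color \<Rightarrow> color \<Rightarrow> real) \<Rightarrow> real measure \<Rightarrow> bool" where
  "is_kernel_measure M Y c s \<mu> \<longleftrightarrow>
    real_distribution \<mu> \<and>
    tendsto_weakly_in_probability M
      (\<lambda>N \<omega>. empirical_eigenvalue_distribution ((1 / real N) \<cdot>\<^sub>m color_matrix s c Y N \<omega>)) \<mu>"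

definition measure_support :: "real measure \<Rightarrow> real set" where
  "measure_support \<mu> = {x. \<forall>U. open U \<longrightarrow> x \<in> U \<longrightarrow> emeasure \<mu> U > 0}"

definition stieltjes :: "real measure \<Rightarrow> complex \<Rightarrow> complex" where
  "stieltjes \<mu> z = (LINT x|\<mu>. 1 / (z - complex_of_real x))"

text \<open>\<^typ>\<open>complex poly poly\<close> represents polynomials in \<open>X, Y\<close> as polynomials in \<open>Y\<close>
  (outer variable) over the polynomials in \<open>X\<close>.\<close>

definition eval_XY :: "complex poly poly \<Rightarrow> complex \<Rightarrow> complex \<Rightarrow> complex" where
  "eval_XY F x y = poly (poly F [:y:]) x"

end

theory Submission
  imports Defs "HOL-Real_Asymp.Real_Asymp" "HOL-Complex_Analysis.Conformal_Mappings"
begin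

text \<open>By Gaussian integration by parts, the expected products of diagonal entries of the resolvent
  satisfy, up to \<open>O(1/n)\<close>, a hierarchy which is contractive for large \<open>|Im z|\<close> and which is solved by
  the products \<open>\<Psi>(c\<^sub>1) \<dots> \<Psi>(c\<^sub>k)\<close> if \<open>\<Psi>\<close> solves the Dyson equation
  \<open>z \<Psi>(c) = 1 + \<Psi>(c) \<integral> s(c, c') \<Psi>(c') dc'\<close>. Hence \<open>S(z) = \<integral> \<Psi>\<close>.
  On each interval of the partition, \<open>\<Psi> = 1 / (z - A(\<xi>))\<close> for a Laurent polynomial \<open>A\<close> whose
  coefficients are linear in finitely many Fourier coefficients of \<open>\<Psi>\<close>. Inverting the block tridiagonal
  Toeplitz operator with symbol \<open>z - A\<close> by means of its transfer matrices turns the Dyson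
  equation into a finite polynomial system \<open>z x = Q(x)\<close>.
  If every equation is perturbed by \<open>t x\<^sub>i\<^sup>D\<close> with \<open>D > deg Q\<close>, all monomials in the solution lie in
  the finite-dimensional span over \<open>\<complex>(z, t)\<close> of those with exponents below \<open>D\<close>, so that the solution is
  algebraic; after division by a power of \<open>t\<close> the equation survives the limit \<open>t \<rightarrow> 0\<close>.
  Analytic continuation extends it from large \<open>|Im z|\<close> to the complement of the support.\<close>

section \<open>Algebraicity of solutions of polynomial systems\<close>

text \<open>A square polynomial system may have infinitely many solutions, and then elimination
  yields no equation for a single one. The perturbation removes this obstacle: it gives every
  equation a pure top power, and the bounded solution for large \<open>z\<close> depends
  continuously on \<open>t\<close>. No uniqueness is proved for the polynomial system. Algebraicity
  supplies some solution in the unit polydisc, and every solution there is shown to produce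
  \<open>S(z)\<close>. Infinite objects are avoided. The partial sum \<open>Psi K\<close> of a
  Fourier series solves the Dyson equation up to an error of order \<open>2^-K\<close>. Averages
  over \<open>N\<close>-th roots of unity are exact for Laurent polynomials of degree below
  \<open>N\<close>, so the integral over the circle becomes a finite sum; only the proportion of
  grid points in each interval carries a discretization error. The equation for \<open>k\<close>
  resolvent entries involves \<open>k + 1\<close> of them. The hierarchy is closed by a supremum
  over products of all lengths. Only expectations are estimated, and convergence in probability
  suffices because the Cauchy kernel is bounded off the real line.\<close>

definition monom_at :: "'i set \<Rightarrow> ('i \<Rightarrow> nat) \<Rightarrow> ('i \<Rightarrow> complex) \<Rightarrow> complex" where
  "monom_at I \<alpha> x = (\<Prod>i\<in>I. x i ^ \<alpha> i)"

text \<open>Polynomials appear as functions with a degree bound, since only values and degrees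
  matter here. Sums are a closure rule, so that statements about monomials extend by
  induction.\<close>

inductive poly_fun :: "'i set \<Rightarrow> nat \<Rightarrow> (('i \<Rightarrow> complex) \<Rightarrow> complex) \<Rightarrow> bool"
  for I r where
  monom: "sum \<alpha> I \<le> r \<Longrightarrow> poly_fun I r (\<lambda>x. c * monom_at I \<alpha> x)"
| add: "poly_fun I r f \<Longrightarrow> poly_fun I r g \<Longrightarrow> poly_fun I r (\<lambda>x. f x + g x)"

lemma poly_fun_const: "poly_fun I r (\<lambda>x. c)"
  using poly_fun.monom[of "\<lambda>_. 0" I r c] by (simp add: monom_at_def)

lemma monom_at_add: "monom_at I (\<lambda>i. \<alpha> i + \<beta> i) x = monom_at I \<alpha> x * monom_at I \<beta> x"
  by (simp add: monom_at_def power_add prod.distrib)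

lemma monom_at_single:
  assumes "finite I" "i \<in> I"
  shows "monom_at I (\<lambda>j. if j = i then k else 0) x = x i ^ k"
proof -
  have "monom_at I (\<lambda>j. if j = i then k else 0) x = (\<Prod>j\<in>I. if j = i then x i ^ k else 1)"
    unfolding monom_at_def by (intro prod.cong) auto
  then show ?thesis using assms by simp
qed

lemma poly_fun_var:
  assumes "finite I" "i \<in> I" "1 \<le> r"
  shows "poly_fun I r (\<lambda>x. x i)"
  using poly_fun.monom[of "\<lambda>j. if j = i then 1 else 0" I r 1] assms
  by (simp add: monom_at_single)

lemma poly_fun_mono: "poly_fun I r f \<Longrightarrow> r \<le> r' \<Longrightarrow> poly_fun I r' f"
  by (induction rule: poly_fun.induct) (auto intro: poly_fun.intros)

lemma poly_fun_monom_mult: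
  assumes "poly_fun I r f"
  shows "poly_fun I (sum \<alpha> I + r) (\<lambda>x. c * monom_at I \<alpha> x * f x)"
  using assms
proof (induction rule: poly_fun.induct)
  case (monom \<beta> d)
  then have "poly_fun I (sum \<alpha> I + r) (\<lambda>x. (c * d) * monom_at I (\<lambda>i. \<alpha> i + \<beta> i) x)"
    by (intro poly_fun.monom) (simp add: sum.distrib)
  then show ?case by (simp add: monom_at_add mult_ac)
next
  case (add f g)
  then show ?case using poly_fun.add by (fastforce simp: ring_distribs)
qed

lemma poly_fun_mult:
  assumes "poly_fun I r f" "poly_fun I r' g" "r + r' \<le> R"
  shows "poly_fun I R (\<lambda>x. f x * g x)"
proof -
  have "poly_fun I (r + r') (\<lambda>x. f x * g x)"
    using assms(1)
  proof (induction rule: poly_fun.induct)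
    case (monom \<alpha> c)
    then show ?case using poly_fun_mono[OF poly_fun_monom_mult[OF assms(2), of \<alpha> c]] by simp
  next
    case (add f g)
    then show ?case using poly_fun.add by (fastforce simp: ring_distribs)
  qed
  then show ?thesis using assms(3) poly_fun_mono by blast
qed

lemma poly_fun_sum:
  assumes "\<And>a. a \<in> A \<Longrightarrow> poly_fun I r (f a)"
  shows "poly_fun I r (\<lambda>x. \<Sum>a\<in>A. f a x)"
  using assms
proof (induction A rule: infinite_finite_induct)
  case (insert a A)
  then show ?case using poly_fun.add[of I r "f a"] by simp
qed (auto simp: poly_fun_const)

lemma poly_fun_cmult: "poly_fun I r f \<Longrightarrow> poly_fun I r (\<lambda>x. c * f x)"
  using poly_fun_mult[OF poly_fun_const[of I 0 c], of r f r] by simp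

lemma poly_fun_power: "poly_fun I r f \<Longrightarrow> poly_fun I (k * r) (\<lambda>x. f x ^ k)"
proof (induction k)
  case (Suc k)
  then show ?case using poly_fun_mult[of I r f "k * r" "\<lambda>x. f x ^ k" "Suc k * r"] by simp
qed (simp add: poly_fun_const)

text \<open>Products of numbers of norm at most 1 are compared factor by factor. One constant serves
  as bound and as Lipschitz constant in the maximum norm on the unit polydisc; division by a large
  \<open>z\<close> then makes the system a contraction.\<close>

lemma poly_fun_bounded_lipschitz:
  assumes "poly_fun I r f" "finite I"
  shows "\<exists>B\<ge>0. \<forall>x y \<epsilon>. \<epsilon> \<ge> 0 \<longrightarrow> (\<forall>i\<in>I. norm (x i) \<le> 1 \<and> norm (y i) \<le> 1 \<and> norm (x i - y i) \<le> \<epsilon>) \<longrightarrow>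
    norm (f x) \<le> B \<and> norm (f x - f y) \<le> B * \<epsilon>"
  using assms(1)
proof (induction rule: poly_fun.induct)
  case (monom \<alpha> c)
  let ?B = "norm c * (1 + of_nat (sum \<alpha> I))"
  have "norm (c * monom_at I \<alpha> x) \<le> ?B \<and>
      norm (c * monom_at I \<alpha> x - c * monom_at I \<alpha> y) \<le> ?B * \<epsilon>"
    if \<epsilon>: "\<epsilon> \<ge> 0" and xy: "\<forall>i\<in>I. norm (x i) \<le> 1 \<and> norm (y i) \<le> 1 \<and> norm (x i - y i) \<le> \<epsilon>"
    for x y :: "_ \<Rightarrow> complex" and \<epsilon>
  proof
    have "norm (monom_at I \<alpha> x) \<le> 1"
      unfolding monom_at_def prod_norm[symmetric] norm_power using xy
      by (intro prod_le_1) (auto simp: power_le_one norm_power)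
    then have "norm (c * monom_at I \<alpha> x) \<le> norm c * 1"
      unfolding norm_mult by (intro mult_left_mono) auto
    also have "\<dots> \<le> ?B" by (intro mult_left_mono) (auto simp del: of_nat_sum)
    finally show "norm (c * monom_at I \<alpha> x) \<le> ?B" .
    have "norm (monom_at I \<alpha> x - monom_at I \<alpha> y) \<le> (\<Sum>i\<in>I. norm (x i ^ \<alpha> i - y i ^ \<alpha> i))"
      unfolding monom_at_def using xy
      by (intro norm_prod_diff) (auto simp: norm_power power_le_one)
    also have "\<dots> \<le> (\<Sum>i\<in>I. of_nat (\<alpha> i) * \<epsilon>)"
    proof (intro sum_mono)
      fix i assume "i \<in> I"
      then have "norm (x i ^ \<alpha> i - y i ^ \<alpha> i) \<le> of_nat (\<alpha> i) * norm (x i - y i)"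
        using xy by (intro norm_power_diff) auto
      also have "\<dots> \<le> of_nat (\<alpha> i) * \<epsilon>" using xy \<open>i \<in> I\<close> by (intro mult_left_mono) auto
      finally show "norm (x i ^ \<alpha> i - y i ^ \<alpha> i) \<le> of_nat (\<alpha> i) * \<epsilon>" .
    qed
    also have "\<dots> \<le> (1 + of_nat (sum \<alpha> I)) * \<epsilon>"
      using \<epsilon> by (simp add: sum_distrib_right distrib_right)
    finally show "norm (c * monom_at I \<alpha> x - c * monom_at I \<alpha> y) \<le> ?B * \<epsilon>"
      unfolding right_diff_distrib[symmetric] norm_mult mult.assoc by (intro mult_left_mono) auto
  qed
  moreover have "?B \<ge> 0" by (intro mult_nonneg_nonneg add_nonneg_nonneg of_nat_0_le_iff) auto
  ultimately show ?case by blast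
next
  case (add f g)
  let ?close = "\<lambda>x y \<epsilon>. \<forall>i\<in>I. norm (x i) \<le> 1 \<and> norm (y i) \<le> 1 \<and> norm (x i - y i :: complex) \<le> \<epsilon>"
  from add.IH(1) obtain B where B: "B \<ge> 0" "\<And>x y \<epsilon>. \<epsilon> \<ge> 0 \<Longrightarrow>
    ?close x y \<epsilon> \<Longrightarrow>
    norm (f x) \<le> B \<and> norm (f x - f y) \<le> B * \<epsilon>" by blast
  from add.IH(2) obtain C where C: "C \<ge> 0" "\<And>x y \<epsilon>. \<epsilon> \<ge> 0 \<Longrightarrow>
    ?close x y \<epsilon> \<Longrightarrow>
    norm (g x) \<le> C \<and> norm (g x - g y) \<le> C * \<epsilon>" by blast
  have "norm (f x + g x) \<le> B + C \<and> norm (f x + g x - (f y + g y)) \<le> (B + C) * \<epsilon>"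
    if "\<epsilon> \<ge> 0" "?close x y \<epsilon>" for x y \<epsilon>
  proof
    show "norm (f x + g x) \<le> B + C"
      using B(2)[OF that] C(2)[OF that] by (meson add_mono norm_triangle_le)
    have "norm ((f x - f y) + (g x - g y)) \<le> B * \<epsilon> + C * \<epsilon>"
      using B(2)[OF that] C(2)[OF that] by (meson add_mono norm_triangle_le)
    then show "norm (f x + g x - (f y + g y)) \<le> (B + C) * \<epsilon>"
      by (simp add: algebra_simps)
  qed
  then show ?case using B(1) C(1) by (intro exI[of _ "B + C"]) auto
qed

section \<open>Fraction-free elimination over polynomial rings\<close>

lemma exists_linear_dependence:
  fixes v :: "'k \<Rightarrow> 'a \<Rightarrow> 'r::idom"
  assumes "finite A" "finite B" "card A < card B"
  shows "\<exists>f. (\<exists>k\<in>B. f k \<noteq> 0) \<and> (\<forall>a\<in>A. (\<Sum>k\<in>B. f k * v k a) = 0)"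
  using assms
proof (induction A arbitrary: v B rule: finite_induct)
  case empty
  then have "B \<noteq> {}" by auto
  then show ?case by (intro exI[of _ "\<lambda>_. 1"]) auto
next
  case (insert a A)
  show ?case
  proof (cases "\<forall>k\<in>B. v k a = 0")
    case True
    then show ?thesis using insert.IH[of B v] insert.prems insert.hyps by auto
  next
    case False
    then obtain k0 where k0: "k0 \<in> B" "v k0 a \<noteq> 0" by auto
    define p where "p = v k0 a"
    let ?B = "B - {k0}"
    have "card A < card ?B" using insert.prems insert.hyps k0 by simp
    \<comment> \<open>Gaussian elimination without division: cross-multiplication with the pivot
      \<open>p\<close> removes the coordinate \<open>a\<close> and stays inside the integral
      domain.\<close>
    from insert.IH[OF _ this, of "\<lambda>k b. p * v k b - v k a * v k0 b"] insert.prems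
    obtain f where f: "\<exists>k\<in>?B. f k \<noteq> 0"
      "\<And>b. b \<in> A \<Longrightarrow> (\<Sum>k\<in>?B. f k * (p * v k b - v k a * v k0 b)) = 0" by auto
    \<comment> \<open>Turns a relation among the reduced vectors into one among the original
      vectors. The factor \<open>p\<close> keeps a nonzero coefficient nonzero.\<close>
    define g where "g k = (if k = k0 then - (\<Sum>k\<in>?B. f k * v k a) else p * f k)" for k
    have g: "(\<Sum>k\<in>B. g k * v k b) = (\<Sum>k\<in>?B. f k * (p * v k b - v k a * v k0 b))" for b
    proof -
      have "(\<Sum>k\<in>B. g k * v k b) = g k0 * v k0 b + (\<Sum>k\<in>?B. g k * v k b)"
        using k0 insert.prems by (simp add: sum.remove)
      also have "(\<Sum>k\<in>?B. g k * v k b) = (\<Sum>k\<in>?B. p * f k * v k b)"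
        by (intro sum.cong) (auto simp: g_def)
      also have "g k0 * v k0 b = - (\<Sum>k\<in>?B. f k * v k a * v k0 b)"
        by (simp add: g_def sum_distrib_right)
      finally show ?thesis
        by (simp add: sum_subtractf right_diff_distrib mult_ac)
    qed
    have "(\<Sum>k\<in>B. g k * v k b) = 0" if "b \<in> insert a A" for b
      using that f(2) unfolding g by (auto simp: p_def mult.commute)
    moreover have "\<exists>k\<in>B. g k \<noteq> 0" using f(1) k0 by (auto simp: g_def p_def)
    ultimately show ?thesis by blast
  qed
qed

text \<open>Removes the largest common power of the variable, which is \<open>t\<close> in the
  application; otherwise the relation could become trivial at \<open>t = 0\<close>. The nonzero
  \<open>f k0\<close> only serves to bound the number of divisions by its degree.\<close>

lemma divide_out_variable:
  fixes f :: "'k \<Rightarrow> 'a::idom poly"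
  assumes "k0 \<in> B" "f k0 \<noteq> 0"
  shows "\<exists>r g. (\<forall>k\<in>B. f k = [:0, 1:] ^ r * g k) \<and> (\<exists>k\<in>B. coeff (g k) 0 \<noteq> 0)"
  using assms(2)
proof (induction "degree (f k0)" arbitrary: f rule: less_induct)
  case less
  show ?case
  proof (cases "\<exists>k\<in>B. coeff (f k) 0 \<noteq> 0")
    case True
    then show ?thesis by (intro exI[of _ 0] exI[of _ f]) auto
  next
    case False
    define h where "h k = (THE q. f k = pCons 0 q)" for k
    have h: "f k = pCons 0 (h k)" if "k \<in> B" for k
    proof -
      obtain a q where q: "f k = pCons a q" by (cases "f k")
      then have "f k = pCons 0 q" using False that by auto
      then show ?thesis unfolding h_def by simp
    qed
    have "h k0 \<noteq> 0" using h[OF assms(1)] less.prems by auto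
    moreover from this have "degree (h k0) < degree (f k0)" using h[OF assms(1)] by simp
    ultimately obtain r g where g: "\<forall>k\<in>B. h k = [:0, 1:] ^ r * g k" "\<exists>k\<in>B. coeff (g k) 0 \<noteq> 0"
      using less.hyps[of h] by blast
    have "f k = [:0, 1:] ^ Suc r * g k" if "k \<in> B" for k
      using h[OF that] g(1) that by simp
    then show ?thesis using g(2) by blast
  qed
qed

text \<open>Coefficients in \<open>z\<close> and \<open>t\<close> share the type of the final
  equation: here the outer variable is \<open>t\<close> and the inner one \<open>z\<close>, whereas
  the outer variable of the final \<open>F\<close> takes the value of \<open>l x\<close>.\<close>

lemma eval_XY_simps [simp]:
  "eval_XY 0 z t = 0" "eval_XY 1 z t = 1"
  "eval_XY (p + q) z t = eval_XY p z t + eval_XY q z t"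
  "eval_XY (p * q) z t = eval_XY p z t * eval_XY q z t"
  "eval_XY (p ^ k) z t = eval_XY p z t ^ k"
  "eval_XY (sum h A) z t = (\<Sum>a\<in>A. eval_XY (h a) z t)"
  "eval_XY [:0, 1:] z t = t" "eval_XY [:[:0, 1:]:] z t = z" "eval_XY [:[:c:]:] z t = c"
  by (simp_all add: eval_XY_def poly_sum)

lemma eval_XY_monom [simp]: "eval_XY (monom p k) z t = poly p z * t ^ k"
  by (simp add: eval_XY_def poly_monom)

lemma eval_XY_0_right: "eval_XY p z 0 = poly (coeff p 0) z"
  by (simp add: eval_XY_def poly_0_coeff_0)

lemma eval_XY_map_poly: "eval_XY p z t = poly (map_poly (\<lambda>q. poly q z) p) t"
  unfolding eval_XY_def by (induction p) (simp_all add: map_poly_pCons)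

section \<open>Reduction of monomials modulo the perturbed system\<close>

definition exponent_box :: "'i set \<Rightarrow> nat \<Rightarrow> ('i \<Rightarrow> nat) set" where
  "exponent_box I D = PiE I (\<lambda>_. {..<D})"

lemma finite_exponent_box: "finite I \<Longrightarrow> finite (exponent_box I D)"
  by (simp add: exponent_box_def finite_PiE)

definition perturbed_solutions ::
  "'i set \<Rightarrow> ('i \<Rightarrow> ('i \<Rightarrow> complex) \<Rightarrow> complex) \<Rightarrow> nat \<Rightarrow> (complex \<times> complex \<times> ('i \<Rightarrow> complex)) set"
  where "perturbed_solutions I Q D = {(z, t, x). \<forall>i\<in>I. z * x i = Q i x + t * x i ^ D}"

abbreviation box_sum ::
  "'i set \<Rightarrow> nat \<Rightarrow> (('i \<Rightarrow> nat) \<Rightarrow> complex poly poly) \<Rightarrow> complex \<Rightarrow> complex \<Rightarrow> ('i \<Rightarrow> complex) \<Rightarrow> complex"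
  where "box_sum I D c z t x \<equiv> \<Sum>\<alpha>\<in>exponent_box I D. eval_XY (c \<alpha>) z t * monom_at I \<alpha> x"

text \<open>After inversion of \<open>t\<close>, the function \<open>h\<close> lies in a module with
  finitely many generators over the polynomials in \<open>z\<close> and \<open>t\<close>. The power
  of \<open>t\<close> is the price of the rewriting, as each use of
  \<open>t * x i ^ D = z * x i - Q i x\<close> divides by \<open>t\<close>. The coefficients must
  not depend on the point of \<open>Z\<close>.\<close>

definition box_reducible :: "'i set \<Rightarrow> nat \<Rightarrow> (complex \<times> complex \<times> ('i \<Rightarrow> complex)) set \<Rightarrow>
    (complex \<Rightarrow> complex \<Rightarrow> ('i \<Rightarrow> complex) \<Rightarrow> complex) \<Rightarrow> bool" where
  "box_reducible I D Z h \<longleftrightarrow> (\<exists>N c. \<forall>(z, t, x)\<in>Z.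
     t ^ N * h z t x = box_sum I D c z t x)"

lemma box_reducible_add:
  assumes "box_reducible I D Z f" "box_reducible I D Z g"
  shows "box_reducible I D Z (\<lambda>z t x. f z t x + g z t x)"
proof -
  from assms(1) obtain N c where c: "\<And>z t x. (z, t, x) \<in> Z \<Longrightarrow>
     t ^ N * f z t x = box_sum I D c z t x"
    unfolding box_reducible_def by fast
  from assms(2) obtain L d where d: "\<And>z t x. (z, t, x) \<in> Z \<Longrightarrow>
     t ^ L * g z t x = box_sum I D d z t x"
    unfolding box_reducible_def by fast
  have "t ^ (N + L) * (f z t x + g z t x) = (\<Sum>\<alpha>\<in>exponent_box I D.
      eval_XY ([:0, 1:] ^ L * c \<alpha> + [:0, 1:] ^ N * d \<alpha>) z t * monom_at I \<alpha> x)"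
    if "(z, t, x) \<in> Z" for z t x
  proof -
    have "t ^ (N + L) * (f z t x + g z t x) = t ^ L * (t ^ N * f z t x) + t ^ N * (t ^ L * g z t x)"
      by (simp add: power_add algebra_simps)
    then show ?thesis unfolding c[OF that] d[OF that]
      by (simp add: sum_distrib_left sum.distrib algebra_simps)
  qed
  then show ?thesis unfolding box_reducible_def by fast
qed

lemma box_reducible_scale:
  assumes "box_reducible I D Z f"
  shows "box_reducible I D Z (\<lambda>z t x. eval_XY q z t * f z t x)"
proof -
  from assms(1) obtain N c where c: "\<And>z t x. (z, t, x) \<in> Z \<Longrightarrow>
     t ^ N * f z t x = box_sum I D c z t x"
    unfolding box_reducible_def by fast
  have "t ^ N * (eval_XY q z t * f z t x) = (\<Sum>\<alpha>\<in>exponent_box I D.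
      eval_XY (q * c \<alpha>) z t * monom_at I \<alpha> x)" if "(z, t, x) \<in> Z" for z t x
    using arg_cong[OF c[OF that], of "\<lambda>u. eval_XY q z t * u"]
    by (simp add: sum_distrib_left mult_ac)
  then show ?thesis unfolding box_reducible_def by fast
qed

lemma box_reducible_divide:
  assumes "box_reducible I D Z f" "\<And>z t x. (z, t, x) \<in> Z \<Longrightarrow> t * h z t x = f z t x"
  shows "box_reducible I D Z h"
proof -
  from assms(1) obtain N c where c: "\<And>z t x. (z, t, x) \<in> Z \<Longrightarrow>
     t ^ N * f z t x = box_sum I D c z t x"
    unfolding box_reducible_def by fast
  have "t ^ Suc N * h z t x = box_sum I D c z t x"
    if "(z, t, x) \<in> Z" for z t x
    using c[OF that] unfolding assms(2)[OF that, symmetric] by (simp add: mult_ac)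
  then show ?thesis unfolding box_reducible_def by fast
qed

lemma box_reducible_small:
  assumes "finite I" "\<forall>i\<in>I. \<alpha> i < D"
  shows "box_reducible I D Z (\<lambda>z t x. monom_at I \<alpha> x)"
proof -
  \<comment> \<open>Members of \<open>exponent_box\<close> are extensional, so the exponent is cut
    off outside \<open>I\<close>; the monomial does not see the difference.\<close>
  have b: "restrict \<alpha> I \<in> exponent_box I D" using assms by (auto simp: exponent_box_def)
  have "t ^ 0 * monom_at I \<alpha> x =
     (\<Sum>\<beta>\<in>exponent_box I D. eval_XY (if \<beta> = restrict \<alpha> I then 1 else 0) z t * monom_at I \<beta> x)"
    for z t x
  proof -
    have "(\<Sum>\<beta>\<in>exponent_box I D. eval_XY (if \<beta> = restrict \<alpha> I then 1 else 0) z t * monom_at I \<beta> x) =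
      (\<Sum>\<beta>\<in>exponent_box I D. if \<beta> = restrict \<alpha> I then monom_at I \<beta> x else 0)"
      by (intro sum.cong) auto
    also have "\<dots> = monom_at I (restrict \<alpha> I) x" using b finite_exponent_box[OF assms(1)] by simp
    also have "\<dots> = monom_at I \<alpha> x" by (simp add: monom_at_def cong: prod.cong)
    finally show ?thesis by simp
  qed
  then show ?thesis unfolding box_reducible_def
    by (intro exI[of _ 0] exI[of _ "\<lambda>\<beta>. if \<beta> = restrict \<alpha> I then 1 else 0"]) blast
qed

text \<open>As the perturbation has higher degree than the system, \<open>t * x i ^ D\<close> can always be replaced
  by an expression of lower degree.\<close>

lemma poly_fun_box_reducible:
  assumes "finite I" "\<And>i. i \<in> I \<Longrightarrow> poly_fun I q (Q i)" "q < D" "1 < D" "poly_fun I r f"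
  shows "box_reducible I D (perturbed_solutions I Q D) (\<lambda>z t x. f x)"
  using assms(5)
proof (induction r arbitrary: f rule: less_induct)
  case (less r)
  let ?Z = "perturbed_solutions I Q D"
  show ?case using less.prems
  proof (induction rule: poly_fun.induct)
    case (add f g)
    then show ?case using box_reducible_add by fast
  next
    case (monom \<alpha> c)
    have "box_reducible I D ?Z (\<lambda>z t x. monom_at I \<alpha> x)"
    proof (cases "\<forall>i\<in>I. \<alpha> i < D")
      case True
      then show ?thesis using box_reducible_small assms(1) by blast
    next
      case False
      then obtain i where i: "i \<in> I" "\<alpha> i \<ge> D" by force
      define \<beta> where "\<beta> j = (if j = i then \<alpha> j - D else \<alpha> j)" for j
      have \<alpha>: "\<alpha> = (\<lambda>j. \<beta> j + (if j = i then D else 0))" using i by (auto simp: \<beta>_def fun_eq_iff)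
      have m: "monom_at I \<alpha> x = monom_at I \<beta> x * x i ^ D" for x
        by (subst \<alpha>, subst monom_at_add) (simp add: monom_at_single assms(1) i)
      have s: "sum \<alpha> I = sum \<beta> I + D"
        by (subst \<alpha>) (simp add: sum.distrib assms(1) i)
      \<comment> \<open>The two replacement terms have degrees \<open>sum \<beta> I + 1\<close> and
        \<open>sum \<beta> I + q\<close>, both below \<open>sum \<beta> I + D\<close>; this is where
        \<open>1 < D\<close> and \<open>q < D\<close> enter.\<close>
      have 1: "box_reducible I D ?Z (\<lambda>z t x. 1 * monom_at I \<beta> x * x i)"
      proof (rule less.IH)
        show "poly_fun I (sum \<beta> I + 1) (\<lambda>x. 1 * monom_at I \<beta> x * x i)"
          by (intro poly_fun_monom_mult poly_fun_var assms i) auto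
        show "sum \<beta> I + 1 < r" using s monom assms by linarith
      qed
      have 2: "box_reducible I D ?Z (\<lambda>z t x. (-1) * monom_at I \<beta> x * Q i x)"
      proof (rule less.IH)
        show "poly_fun I (sum \<beta> I + q) (\<lambda>x. (-1) * monom_at I \<beta> x * Q i x)"
          by (intro poly_fun_monom_mult assms i)
        show "sum \<beta> I + q < r" using s monom assms by linarith
      qed
      show ?thesis
      proof (rule box_reducible_divide)
        show "box_reducible I D ?Z (\<lambda>z t x. eval_XY [:[:0, 1:]:] z t * (1 * monom_at I \<beta> x * x i)
            + (-1) * monom_at I \<beta> x * Q i x)"
          by (intro box_reducible_add box_reducible_scale 1 2)
        fix z t x assume "(z, t, x) \<in> ?Z"
        then have "z * x i = Q i x + t * x i ^ D" using i by (auto simp: perturbed_solutions_def)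
        then have "t * x i ^ D = z * x i - Q i x" by simp
        then have "monom_at I \<beta> x * (t * x i ^ D) = monom_at I \<beta> x * (z * x i - Q i x)" by simp
        then show "t * monom_at I \<alpha> x = eval_XY [:[:0, 1:]:] z t * (1 * monom_at I \<beta> x * x i)
            + (-1) * monom_at I \<beta> x * Q i x"
          unfolding m by (simp add: algebra_simps)
      qed
    qed
    then show ?case using box_reducible_scale[of I D ?Z "\<lambda>z t x. monom_at I \<alpha> x" "[:[:c:]:]"] by simp
  qed
qed

text \<open>If the box has \<open>m\<close> monomials, the powers of \<open>l\<close> with exponents
  \<open>0\<close> to \<open>m\<close> are \<open>m + 1\<close> vectors of length \<open>m\<close>,
  hence dependent over the polynomials in \<open>z\<close> and \<open>t\<close>. That some
  coefficient survives at \<open>t = 0\<close> is claimed for the sake of the later limit.\<close>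

lemma perturbed_solutions_algebraic:
  assumes "finite I" "\<And>i. i \<in> I \<Longrightarrow> poly_fun I q (Q i)" "q < D" "1 < D" "poly_fun I r l"
  shows "\<exists>m. \<exists>g :: nat \<Rightarrow> complex poly poly. (\<exists>k\<le>m. coeff (g k) 0 \<noteq> 0) \<and>
    (\<forall>(z, t, x)\<in>perturbed_solutions I Q D. t \<noteq> 0 \<longrightarrow> (\<Sum>k\<le>m. eval_XY (g k) z t * l x ^ k) = 0)"
proof -
  let ?Z = "perturbed_solutions I Q D" and ?A = "exponent_box I D"
  have "\<forall>k. \<exists>N c. \<forall>(z, t, x)\<in>?Z.
     t ^ N * l x ^ k = box_sum I D c z t x"
  proof
    fix k
    show "\<exists>N c. \<forall>(z, t, x)\<in>?Z.
        t ^ N * l x ^ k = box_sum I D c z t x"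
      using poly_fun_box_reducible[where Q = Q, OF assms(1-4) poly_fun_power[OF assms(5)], of k]
      unfolding box_reducible_def by simp
  qed
  from choice[OF this] obtain N where "\<forall>k. \<exists>c. \<forall>(z, t, x)\<in>?Z.
     t ^ N k * l x ^ k = box_sum I D c z t x" by blast
  from choice[OF this] obtain c where c: "\<And>k z t x. (z, t, x) \<in> ?Z \<Longrightarrow>
     t ^ N k * l x ^ k = box_sum I D (c k) z t x"
    by blast
  define m where "m = card ?A"
  \<comment> \<open>The expansions of the powers of \<open>l\<close> come with different powers of
    \<open>t\<close>; this brings all of them to the common exponent
    \<open>sum N {..m}\<close>.\<close>
  define v where "v k \<alpha> = [:0, 1:] ^ (sum N {..m} - N k) * c k \<alpha>" for k \<alpha>
  have v: "t ^ sum N {..m} * l x ^ k = (\<Sum>\<alpha>\<in>?A. eval_XY (v k \<alpha>) z t * monom_at I \<alpha> x)"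
    if "(z, t, x) \<in> ?Z" "k \<le> m" for z t x k
  proof -
    have "N k \<le> sum N {..m}" using that by (intro member_le_sum) auto
    then have "t ^ sum N {..m} * l x ^ k = t ^ (sum N {..m} - N k) * (t ^ N k * l x ^ k)"
      by (simp flip: power_add mult.assoc)
    then show ?thesis unfolding c[OF that(1)] v_def by (simp add: sum_distrib_left mult.assoc)
  qed
  obtain f where f: "\<exists>k\<in>{..m}. f k \<noteq> 0" "\<And>\<alpha>. \<alpha> \<in> ?A \<Longrightarrow> (\<Sum>k\<le>m. f k * v k \<alpha>) = 0"
    using exists_linear_dependence[of ?A "{..m}" v] finite_exponent_box[OF assms(1)]
    by (auto simp: m_def)
  from f(1) obtain k0 where "k0 \<in> {..m}" "f k0 \<noteq> 0" by auto
  from divide_out_variable[where f = f, OF this] obtain e g where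
    g: "\<And>k. k \<le> m \<Longrightarrow> f k = [:0, 1:] ^ e * g k" "\<exists>k\<le>m. coeff (g k) 0 \<noteq> 0" by auto
  have "(\<Sum>k\<le>m. eval_XY (g k) z t * l x ^ k) = 0" if Z: "(z, t, x) \<in> ?Z" and t: "t \<noteq> 0" for z t x
  proof -
    have "t ^ sum N {..m} * (t ^ e * (\<Sum>k\<le>m. eval_XY (g k) z t * l x ^ k)) =
        (\<Sum>k\<le>m. eval_XY (f k) z t * (t ^ sum N {..m} * l x ^ k))"
      by (simp add: g(1) sum_distrib_left mult_ac)
    also have "\<dots> = (\<Sum>k\<le>m. \<Sum>\<alpha>\<in>?A. eval_XY (f k * v k \<alpha>) z t * monom_at I \<alpha> x)"
      by (intro sum.cong) (auto simp: v[OF Z] sum_distrib_left mult.assoc)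
    also have "\<dots> = (\<Sum>\<alpha>\<in>?A. eval_XY (\<Sum>k\<le>m. f k * v k \<alpha>) z t * monom_at I \<alpha> x)"
      by (subst sum.swap) (simp add: sum_distrib_right)
    also have "\<dots> = 0" using f(2) by simp
    finally show ?thesis using t by simp
  qed
  then show ?thesis using g(2) by blast
qed

section \<open>Bounded solutions for large \<open>z\<close> and the limit \<open>t\<close> to
  0\<close>

lemma contraction_fixed_point:
  fixes \<Phi> :: "'i \<Rightarrow> ('i \<Rightarrow> complex) \<Rightarrow> complex"
  assumes I: "finite I"
    and self: "\<And>x i. \<forall>i\<in>I. norm (x i) \<le> 1 \<Longrightarrow> i \<in> I \<Longrightarrow> norm (\<Phi> i x) \<le> 1"
    and lip: "\<And>x y \<epsilon> i. \<epsilon> \<ge> 0 \<Longrightarrow>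
      \<forall>i\<in>I. norm (x i) \<le> 1 \<and> norm (y i) \<le> 1 \<and> norm (x i - y i) \<le> \<epsilon> \<Longrightarrow> i \<in> I \<Longrightarrow>
      norm (\<Phi> i x - \<Phi> i y) \<le> \<epsilon> / 2"
  shows "\<exists>x. \<forall>i\<in>I. norm (x i) \<le> 1 \<and> x i = \<Phi> i x"
proof -
  \<comment> \<open>Banach iteration from 0, carried out by hand in the maximum norm: only the
    coordinates in \<open>I\<close> are controlled, so the function type itself offers no suitable
    metric.\<close>
  define X where "X n = ((\<lambda>x i. \<Phi> i x) ^^ n) (\<lambda>_. 0)" for n
  have X0: "X 0 = (\<lambda>_. 0)" and XS: "X (Suc n) i = \<Phi> i (X n)" for n i by (simp_all add: X_def)
  have X1: "\<forall>i\<in>I. norm (X n i) \<le> 1" for n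
    by (induction n) (auto simp: X0 XS intro: self)
  have step: "\<forall>i\<in>I. norm (X (Suc n) i - X n i) \<le> (1/2) ^ n" for n
  proof (induction n)
    case 0
    then show ?case using X1[of 1] by (simp add: X0)
  next
    case (Suc n)
    have "norm (\<Phi> i (X (Suc n)) - \<Phi> i (X n)) \<le> (1/2) ^ n / 2" if "i \<in> I" for i
      using that Suc X1 by (intro lip) auto
    then show ?case by (simp add: XS)
  qed
  define x where "x i = lim (\<lambda>n. X n i)" for i
  have lim: "(\<lambda>n. X n i) \<longlonglongrightarrow> x i" if "i \<in> I" for i
  proof -
    have "summable (\<lambda>n. X (Suc n) i - X n i)"
      using step that by (intro summable_comparison_test[OF _ summable_geometric[of "1/2::real"]]) auto
    then have "convergent (\<lambda>n. \<Sum>k<n. (X (Suc k) i - X k i))" by (simp add: summable_iff_convergent)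
    moreover have "(\<Sum>k<n. (X (Suc k) i - X k i)) = X n i" for n
      by (subst sum_lessThan_telescope) (simp add: X0)
    ultimately show ?thesis by (simp add: x_def convergent_LIMSEQ_iff)
  qed
  have x1: "norm (x i) \<le> 1" if "i \<in> I" for i
    using X1 that by (intro tendsto_upperbound[OF tendsto_norm[OF lim[OF that]]]) auto
  have "x i = \<Phi> i x" if i: "i \<in> I" for i
  proof -
    have "norm (x i - \<Phi> i x) \<le> \<epsilon>" if "\<epsilon> > 0" for \<epsilon>
    proof -
      have "eventually (\<lambda>n. \<forall>j\<in>I. norm (X n j - x j) < \<epsilon> / 2) sequentially"
        using lim \<open>\<epsilon> > 0\<close> unfolding tendsto_iff dist_norm
        by (intro eventually_ball_finite I) (meson half_gt_zero)
      then obtain n0 where n0: "\<And>n. n \<ge> n0 \<Longrightarrow> \<forall>j\<in>I. norm (X n j - x j) < \<epsilon> / 2"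
        by (auto simp: eventually_sequentially)
      have "norm (\<Phi> i (X n0) - \<Phi> i x) \<le> (\<epsilon> / 2) / 2"
        using n0[of n0] X1 x1 i \<open>\<epsilon> > 0\<close> by (intro lip) (auto intro: less_imp_le)
      moreover have "norm (X (Suc n0) i - x i) < \<epsilon> / 2" using n0[of "Suc n0"] i by auto
      ultimately have "norm ((x i - X (Suc n0) i) + (\<Phi> i (X n0) - \<Phi> i x)) \<le> \<epsilon>/2 + \<epsilon>/2"
        using \<open>\<epsilon> > 0\<close> by (intro norm_triangle_le) (simp add: norm_minus_commute)
      then show ?thesis by (simp add: XS)
    qed
    then have "norm (x i - \<Phi> i x) \<le> 0" by (meson dense_ge)
    then show ?thesis by simp
  qed
  then show ?thesis using x1 by blast
qed

text \<open>\<open>F\<close> and \<open>R\<close> are fixed before \<open>z\<close>. For each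
  \<open>z\<close> just one bounded solution with this equation is produced; its identification with
  the Stieltjes transform later applies to any bounded solution.\<close>

theorem large_solution_algebraic:
  assumes I: "finite I" and Q: "\<And>i. i \<in> I \<Longrightarrow> poly_fun I q (Q i)" and l: "poly_fun I r l"
  shows "\<exists>F :: complex poly poly. F \<noteq> 0 \<and> (\<exists>R. \<forall>z. norm z \<ge> R \<longrightarrow>
    (\<exists>x. (\<forall>i\<in>I. norm (x i) \<le> 1 \<and> z * x i = Q i x) \<and> eval_XY F z (l x) = 0))"
proof -
  let ?close = "\<lambda>x y \<epsilon>. \<forall>i\<in>I. norm (x i) \<le> 1 \<and> norm (y i) \<le> 1 \<and> norm (x i - y i :: complex) \<le> \<epsilon>"
  \<comment> \<open>Ensures both \<open>q < D\<close> and \<open>1 < D\<close>.\<close>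
  define D where "D = q + 2"
  have "\<exists>m. \<exists>g :: nat \<Rightarrow> complex poly poly. (\<exists>k\<le>m. coeff (g k) 0 \<noteq> 0) \<and>
    (\<forall>(z, t, x)\<in>perturbed_solutions I Q D. t \<noteq> 0 \<longrightarrow> (\<Sum>k\<le>m. eval_XY (g k) z t * l x ^ k) = 0)"
    by (rule perturbed_solutions_algebraic[OF I Q _ _ l]) (auto simp: D_def)
  then obtain m and g :: "nat \<Rightarrow> complex poly poly" where g: "\<exists>k\<le>m. coeff (g k) 0 \<noteq> 0"
    "\<And>z t x. (z, t, x) \<in> perturbed_solutions I Q D \<Longrightarrow> t \<noteq> 0 \<Longrightarrow>
      (\<Sum>k\<le>m. eval_XY (g k) z t * l x ^ k) = 0"
    by blast
  \<comment> \<open>The relation at \<open>t = 0\<close>, read as a polynomial in the value of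
    \<open>l\<close>; it is nonzero because a power of \<open>t\<close> was divided out
    before.\<close>
  define F where "F = (\<Sum>k\<le>m. monom (coeff (g k) 0) k)"
  have "coeff F k = (if k \<le> m then coeff (g k) 0 else 0)" for k
    by (simp add: F_def coeff_sum)
  then have "F \<noteq> 0" using g(1) by (metis coeff_0)
  have "\<forall>i\<in>I. \<exists>B\<ge>0. \<forall>x y \<epsilon>. \<epsilon> \<ge> 0 \<longrightarrow>
    ?close x y \<epsilon> \<longrightarrow>
    norm (Q i x) \<le> B \<and> norm (Q i x - Q i y) \<le> B * \<epsilon>"
    using poly_fun_bounded_lipschitz[OF Q I] by blast
  then obtain B where B: "\<And>i. i \<in> I \<Longrightarrow> B i \<ge> 0" "\<And>i x y \<epsilon>. i \<in> I \<Longrightarrow> \<epsilon> \<ge> 0 \<Longrightarrow>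
    ?close x y \<epsilon> \<Longrightarrow>
    norm (Q i x) \<le> B i \<and> norm (Q i x - Q i y) \<le> B i * \<epsilon>"
    by metis
  define C where "C = sum B I"
  have BC: "B i \<le> C" if "i \<in> I" for i
    unfolding C_def using that B(1) I by (intro member_le_sum) auto
  have C0: "C \<ge> 0" unfolding C_def using B(1) by (intro sum_nonneg) auto
  \<comment> \<open>For \<open>norm t \<le> 1\<close> the right-hand side is bounded by
    \<open>C + 1\<close> and has Lipschitz constant \<open>C + D\<close> on the unit polydisc. The
    choice of \<open>R\<close> gives a self-map, the contraction factor 1/2, and the spare summand
    that stability in \<open>t\<close> consumes below.\<close>
  define R where "R = 2 * (C + real D + 1)"
  define \<Phi> where "\<Phi> z t i x = (Q i x + t * x i ^ D) / z" for z t i and x :: "'a \<Rightarrow> complex"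
  have bound: "norm (Q i x + t * x i ^ D) \<le> C + 1"
    if "norm t \<le> 1" "i \<in> I" "\<forall>i\<in>I. norm (x i) \<le> 1" for t i x
  proof -
    have "norm (Q i x) \<le> C" using B(2)[OF that(2), of 0 x x] BC that by fastforce
    moreover have "norm (t * x i ^ D) \<le> 1"
      using that by (auto simp: norm_mult norm_power intro!: mult_le_one power_le_one)
    ultimately show ?thesis by (meson add_mono norm_triangle_le)
  qed
  have lip: "norm ((Q i x + t * x i ^ D) - (Q i y + u * y i ^ D)) \<le> (C + D) * \<epsilon> + norm (t - u)"
    if "norm t \<le> 1" "i \<in> I" "\<epsilon> \<ge> 0"
      "\<forall>i\<in>I. norm (x i) \<le> 1 \<and> norm (y i) \<le> 1 \<and> norm (x i - y i) \<le> \<epsilon>" for t u i x y \<epsilon>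
  proof -
    have "norm (Q i x - Q i y) \<le> B i * \<epsilon>" using B(2)[OF that(2,3,4)] by simp
    also have "\<dots> \<le> C * \<epsilon>" using BC that by (intro mult_right_mono) auto
    finally have 1: "norm (Q i x - Q i y) \<le> C * \<epsilon>" .
    have "norm (x i ^ D - y i ^ D) \<le> D * norm (x i - y i)"
      using that by (intro norm_power_diff) auto
    also have "\<dots> \<le> D * \<epsilon>" using that by (intro mult_left_mono) auto
    finally have "norm (t * (x i ^ D - y i ^ D)) \<le> 1 * (D * \<epsilon>)"
      unfolding norm_mult using that by (intro mult_mono) auto
    moreover have "norm ((t - u) * y i ^ D) \<le> norm (t - u) * 1"
      unfolding norm_mult norm_power using that by (intro mult_left_mono power_le_one) auto
    ultimately have "norm ((Q i x - Q i y) + (t * (x i ^ D - y i ^ D) + (t - u) * y i ^ D))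
        \<le> C * \<epsilon> + (1 * (D * \<epsilon>) + norm (t - u) * 1)"
      using 1 by (intro norm_triangle_le add_mono) (auto intro: norm_triangle_le)
    then show ?thesis by (simp add: algebra_simps)
  qed
  have sol: "\<exists>x. \<forall>i\<in>I. norm (x i) \<le> 1 \<and> z * x i = Q i x + t * x i ^ D"
    if z: "norm z \<ge> R" and t: "norm t \<le> 1" for z t
  proof -
    have z0: "norm z > 0" using z C0 of_nat_0_le_iff[where ?'a = real, of D] unfolding R_def by argo
    have "\<exists>x. \<forall>i\<in>I. norm (x i) \<le> 1 \<and> x i = \<Phi> z t i x"
    proof (rule contraction_fixed_point[OF I])
      fix x :: "'a \<Rightarrow> complex" and i assume "\<forall>i\<in>I. norm (x i) \<le> 1" "i \<in> I"
      then have "norm (Q i x + t * x i ^ D) \<le> norm z"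
        using bound[OF t, of i x] z C0 unfolding R_def by auto
      then show "norm (\<Phi> z t i x) \<le> 1"
        unfolding \<Phi>_def norm_divide using z0 by simp
    next
      fix x y :: "'a \<Rightarrow> complex" and \<epsilon> i
      assume a: "\<epsilon> \<ge> 0" "\<forall>i\<in>I. norm (x i) \<le> 1 \<and> norm (y i) \<le> 1 \<and> norm (x i - y i) \<le> \<epsilon>" "i \<in> I"
      have "norm ((Q i x + t * x i ^ D) - (Q i y + t * y i ^ D)) \<le> (C + D) * \<epsilon>"
        using lip[OF t a(3,1,2), of t] by simp
      also have "\<dots> \<le> (norm z / 2) * \<epsilon>" using a z unfolding R_def by (intro mult_right_mono) auto
      finally have "norm ((Q i x + t * x i ^ D) - (Q i y + t * y i ^ D)) / norm z \<le> \<epsilon> / 2"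
        using z0 by (simp add: field_simps)
      then show "norm (\<Phi> z t i x - \<Phi> z t i y) \<le> \<epsilon> / 2"
        unfolding \<Phi>_def diff_divide_distrib[symmetric] norm_divide .
    qed
    then show ?thesis using z0 unfolding \<Phi>_def by (metis nonzero_mult_div_cancel_left norm_eq_zero
      order_less_irrefl times_divide_eq_right)
  qed
  have "\<exists>x. (\<forall>i\<in>I. norm (x i) \<le> 1 \<and> z * x i = Q i x) \<and> eval_XY F z (l x) = 0"
    if z: "norm z \<ge> R" for z
  proof -

    obtain X where X: "\<And>t i. norm t \<le> 1 \<Longrightarrow> i \<in> I \<Longrightarrow> norm (X t i) \<le> 1 \<and> z * X t i = Q i (X t) + t * X t i ^ D"
      using sol[OF z] by metis
    \<comment> \<open>The solutions are chosen separately for each \<open>t\<close>, yet they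
      converge. Subtracting the equations at \<open>t\<close> and 0 gives
      \<open>norm z * \<epsilon> \<le> (C + D) * \<epsilon> + norm t\<close> for their maximal
      distance \<open>\<epsilon>\<close>, and \<open>norm z\<close> exceeds \<open>C + D\<close> by
      at least 1.\<close>
    have close: "norm (X t i - X 0 i) \<le> 2 * norm t" if t: "norm t \<le> 1" and i: "i \<in> I" for t i
    proof -
      define \<epsilon> where "\<epsilon> = Max ((\<lambda>i. norm (X t i - X 0 i)) ` I)"
      have \<epsilon>: "norm (X t i - X 0 i) \<le> \<epsilon>" if "i \<in> I" for i
        unfolding \<epsilon>_def using that I by (intro Max_ge) auto
      have "\<epsilon> \<in> (\<lambda>i. norm (X t i - X 0 i)) ` I" unfolding \<epsilon>_def using I i by (intro Max_in) auto
      then obtain j where j: "j \<in> I" "\<epsilon> = norm (X t j - X 0 j)" by auto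
      have "\<epsilon> \<ge> 0" using j by simp
      have "norm z * \<epsilon> = norm (z * X t j - z * X 0 j)"
        by (simp add: j norm_mult flip: right_diff_distrib)
      also have "\<dots> = norm ((Q j (X t) + t * X t j ^ D) - (Q j (X 0) + 0 * X 0 j ^ D))"
        using X[OF t j(1)] X[of 0, OF _ j(1)] by simp
      also have "\<dots> \<le> (C + D) * \<epsilon> + norm (t - 0)"
        using X[OF t] X[of 0] \<epsilon> \<open>\<epsilon> \<ge> 0\<close> by (intro lip t j) auto
      finally have 1: "norm z * \<epsilon> \<le> (C + D) * \<epsilon> + norm t" by simp
      have "(C + D + 1) * \<epsilon> \<le> norm z * \<epsilon>"
        using z C0 \<open>\<epsilon> \<ge> 0\<close> unfolding R_def by (intro mult_right_mono) auto
      then have "\<epsilon> \<le> norm t" using 1 by (simp add: algebra_simps)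
      then show ?thesis using \<epsilon>[OF i] norm_ge_zero[of t] by linarith
    qed
    obtain L where L: "L \<ge> 0" "\<And>x y \<epsilon>. \<epsilon> \<ge> 0 \<Longrightarrow>
      ?close x y \<epsilon> \<Longrightarrow>
      norm (l x - l y) \<le> L * \<epsilon>"
      using poly_fun_bounded_lipschitz[OF l I] by blast
    define \<tau> where "\<tau> n = complex_of_real (inverse (real (Suc n)))" for n
    have \<tau>: "norm (\<tau> n) \<le> 1" "\<tau> n \<noteq> 0" for n
      by (auto simp: \<tau>_def norm_inverse inverse_le_1_iff simp del: of_nat_Suc)
    have \<tau>0: "\<tau> \<longlonglongrightarrow> 0"
      unfolding \<tau>_def using tendsto_of_real[OF LIMSEQ_inverse_real_of_nat, where ?'a = complex] by simp
    have ll: "(\<lambda>n. l (X (\<tau> n))) \<longlonglongrightarrow> l (X 0)"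
    proof (rule LIM_zero_cancel, rule Lim_null_comparison)
      show "eventually (\<lambda>n. norm (l (X (\<tau> n)) - l (X 0)) \<le> L * (2 * norm (\<tau> n))) sequentially"
        using X[OF \<tau>(1)] X[of 0] close[OF \<tau>(1)] by (intro always_eventually allI L(2)) auto
      show "(\<lambda>n. L * (2 * norm (\<tau> n))) \<longlonglongrightarrow> 0"
        using tendsto_mult_right_zero[OF tendsto_mult_right_zero[OF tendsto_norm_zero[OF \<tau>0]]] .
    qed
    have gg: "(\<lambda>n. eval_XY (g k) z (\<tau> n)) \<longlonglongrightarrow> eval_XY (g k) z 0" for k
    proof -
      show ?thesis unfolding eval_XY_map_poly using \<tau>0 by (rule tendsto_poly)
    qed
    have "(\<lambda>n. \<Sum>k\<le>m. eval_XY (g k) z (\<tau> n) * l (X (\<tau> n)) ^ k) \<longlonglongrightarrow> (\<Sum>k\<le>m. eval_XY (g k) z 0 * l (X 0) ^ k)"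
      by (intro tendsto_intros gg ll)
    moreover have "(\<Sum>k\<le>m. eval_XY (g k) z (\<tau> n) * l (X (\<tau> n)) ^ k) = 0" for n
      using X[OF \<tau>(1)] \<tau>(2) by (intro g(2)) (auto simp: perturbed_solutions_def)
    ultimately have "(\<Sum>k\<le>m. eval_XY (g k) z 0 * l (X 0) ^ k) = 0"
      by (simp add: LIMSEQ_const_iff)
    then have "eval_XY F z (l (X 0)) = 0" by (simp add: F_def eval_XY_0_right)
    then show ?thesis using X[of 0] by (intro exI[of _ "X 0"]) auto
  qed
  then show ?thesis using \<open>F \<noteq> 0\<close> by blast
qed

section \<open>Inversion of Laurent polynomials by transfer matrices\<close>

text \<open>Multiplication by a primitive root \<open>\<omega>\<close> permutes the roots and
  multiplies the sum by \<open>\<omega> powi l\<close>, which is not 1 for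
  \<open>0 < \<bar>l\<bar> < N\<close>. The bound on \<open>l\<close> excludes aliasing and
  reappears below as a lower bound on \<open>N\<close>.\<close>

lemma sum_roots_of_unity_powi:
  assumes "N > 0" "\<bar>l\<bar> < int N"
  shows "(\<Sum>\<xi> | \<xi> ^ N = 1. \<xi> powi l) = (if l = 0 then of_nat N else (0::complex))"
proof (cases "l = 0")
  case True
  then show ?thesis using card_roots_unity_eq[of N] assms by simp
next
  case False
  define \<omega> where "\<omega> = cis (2 * pi / N)"
  have "\<omega> ^ N = cis (real N * (2 * pi / N))" unfolding \<omega>_def by (rule Complex.DeMoivre)
  also have "real N * (2 * pi / N) = 2 * pi" using assms by simp
  finally have \<omega>: "\<omega> ^ N = 1" "\<omega> \<noteq> 0" by (simp_all add: \<omega>_def)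
  let ?S = "\<Sum>\<xi> | \<xi> ^ N = 1. \<xi> powi l :: complex"
  have "?S = (\<Sum>\<xi> | \<xi> ^ N = 1. (\<omega> * \<xi>) powi l)"
    by (rule sum.reindex_bij_witness[of _ "\<lambda>\<xi>. \<omega> * \<xi>" "\<lambda>\<xi>. \<xi> / \<omega>"])
      (use \<omega> in \<open>auto simp: power_mult_distrib power_divide\<close>)
  also have "\<dots> = \<omega> powi l * ?S"
    by (simp add: power_int_mult_distrib sum_distrib_left)
  finally have "(1 - \<omega> powi l) * ?S = 0" by (simp add: algebra_simps)
  moreover have "\<omega> powi l \<noteq> 1"
  proof
    assume "\<omega> powi l = 1"
    then have "\<omega> ^ nat \<bar>l\<bar> = 1"
      using False by (auto simp: power_int_def abs_if power_inverse split: if_splits)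
    then have "cis (real (nat \<bar>l\<bar>) * (2 * pi / N)) = 1" by (simp add: \<omega>_def Complex.DeMoivre)
    then have "cos (real (nat \<bar>l\<bar>) * (2 * pi / N)) = 1" by (metis cis.simps(1) one_complex.simps(1))
    then obtain k :: int where "real (nat \<bar>l\<bar>) * (2 * pi / N) = of_int k * 2 * pi"
      by (auto simp: cos_one_2pi_int)
    then have "real (nat \<bar>l\<bar>) = of_int k * real N" using assms(1) by (simp add: field_simps)
    then have *: "\<bar>l\<bar> = k * int N" by (metis abs_ge_zero int_nat_eq of_int_eq_iff of_int_mult of_int_of_nat_eq)
    then have "k > 0" using False assms(1) by (metis abs_le_zero_iff mult_nonpos_nonneg not_le of_nat_0_le_iff)
    then have "1 * int N \<le> k * int N" by (intro mult_right_mono) auto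
    then show False using * assms(2) by simp
  qed
  ultimately show ?thesis using False by simp
qed

text \<open>In the application \<open>J\<close> is the partition, \<open>p I\<close> is the length
  of \<open>I\<close>, and \<open>a k I j I'\<close> is the coefficient of
  \<open>\<xi> powi k * \<eta> powi j\<close> in the kernel on \<open>I \<times> I'\<close>, with
  degrees bounded by \<open>d\<close>.\<close>

locale laurent_system =
  fixes J :: "'j set" and d :: nat and p :: "'j \<Rightarrow> real" and a :: "int \<Rightarrow> 'j \<Rightarrow> int \<Rightarrow> 'j \<Rightarrow> complex"
  assumes finite_J: "finite J" and p_bounds: "\<And>I. I \<in> J \<Longrightarrow> 0 \<le> p I \<and> p I \<le> 1"
begin

abbreviation "D \<equiv> {- int d..int d}"

text \<open>Any block size above \<open>d\<close> makes the operator block tridiagonal. With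
  \<open>2 * d + 1\<close> the index \<open>d\<close> is the centre of a block, and column
  \<open>d\<close> of the central block holds exactly the Fourier indices from \<open>-d\<close> to
  \<open>d\<close> that enter \<open>coef\<close>.\<close>

definition m :: nat where "m = 2 * d + 1"

text \<open>The unknowns \<open>x (2, I, r, u)\<close> stand for the Fourier coefficient of index \<open>r - u\<close> of
  \<open>1 / (z - A x I \<xi>)\<close>. The Toeplitz operator with symbol \<open>z - A x I\<close>, cut into blocks of size
  \<open>m > d\<close>, is block tridiagonal with off-diagonal blocks \<open>T x I (-1)\<close> and \<open>T x I 1\<close>;
  \<open>x (0, I, _, _)\<close> and \<open>x (1, I, _, _)\<close> are the transfer matrices which map a
  block of a decaying solution to the next block on its right and on its left, respectively.\<close>

definition unknowns :: "(nat \<times> 'j \<times> nat \<times> nat) set" where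
  "unknowns = {..<3} \<times> J \<times> {..<m} \<times> {..<m}"

text \<open>The circle average of \<open>\<eta> powi j * \<Psi> \<eta>\<close> is the Fourier
  coefficient of \<open>\<Psi>\<close> with index \<open>-j\<close>, which sits in row
  \<open>d - j\<close> of column \<open>d\<close>. The default 0 makes Toeplitz entries outside the
  band vanish.\<close>

definition coef :: "(nat \<times> 'j \<times> nat \<times> nat \<Rightarrow> complex) \<Rightarrow> 'j \<Rightarrow> int \<Rightarrow> complex" where
  "coef x I k = (if k \<in> D then
     \<Sum>I'\<in>J. \<Sum>j\<in>D. a k I j I' * of_real (p I') * x (2, I', nat (int d - j), d) else 0)"

definition A :: "(nat \<times> 'j \<times> nat \<times> nat \<Rightarrow> complex) \<Rightarrow> 'j \<Rightarrow> complex \<Rightarrow> complex" where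
  "A x I \<xi> = (\<Sum>k\<in>D. coef x I k * \<xi> powi k)"

definition T :: "(nat \<times> 'j \<times> nat \<times> nat \<Rightarrow> complex) \<Rightarrow> 'j \<Rightarrow> int \<Rightarrow> nat \<Rightarrow> nat \<Rightarrow> complex" where
  "T x I \<iota> r u = coef x I (int r - int u - \<iota> * int m)"

text \<open>The direction in which the transfer matrix with number \<open>\<kappa>\<close> moves: to
  the right for 0, to the left for 1.\<close>

definition sg :: "nat \<Rightarrow> int" where "sg \<kappa> = (if \<kappa> = 0 then 1 else -1)"

text \<open>Inserting \<open>v(k+1) = X v(k)\<close> into the three-term recursion of blocks gives
  the matrix Riccati equation \<open>z X = T(-\<sigma>) + T(0) X + T(\<sigma>) X X\<close> for a
  transfer matrix. The central block \<open>G\<close> of the inverse satisfies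
  \<open>z G = 1 + (T(0) + T(1) X0 + T(-1) X1) G\<close>. Since \<open>T\<close> is linear in the
  unknowns, the degree is at most 3.\<close>

definition Q :: "nat \<times> 'j \<times> nat \<times> nat \<Rightarrow> (nat \<times> 'j \<times> nat \<times> nat \<Rightarrow> complex) \<Rightarrow> complex" where
  "Q = (\<lambda>(\<kappa>, I, r, u) x.
     if \<kappa> = 2 then (if r = u then 1 else 0) + (\<Sum>v<m. T x I 0 r v * x (2, I, v, u)) +
       (\<Sum>v<m. (\<Sum>t<m. T x I 1 r t * x (0, I, t, v)) * x (2, I, v, u)) +
       (\<Sum>v<m. (\<Sum>t<m. T x I (-1) r t * x (1, I, t, v)) * x (2, I, v, u))
     else T x I (- sg \<kappa>) r u + (\<Sum>v<m. T x I 0 r v * x (\<kappa>, I, v, u)) +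
       (\<Sum>v<m. (\<Sum>t<m. T x I (sg \<kappa>) r t * x (\<kappa>, I, t, v)) * x (\<kappa>, I, v, u)))"

text \<open>Position \<open>(d, d)\<close> holds the Fourier coefficient of index 0, so this is the
  integral of \<open>\<Psi>\<close> over color space.\<close>

definition l :: "(nat \<times> 'j \<times> nat \<times> nat \<Rightarrow> complex) \<Rightarrow> complex" where
  "l x = (\<Sum>I\<in>J. of_real (p I) * x (2, I, d, d))"

lemma Q_2: "Q (2, I, r, u) x = (if r = u then 1 else 0) + (\<Sum>v<m. T x I 0 r v * x (2, I, v, u)) +
    (\<Sum>v<m. (\<Sum>t<m. T x I 1 r t * x (0, I, t, v)) * x (2, I, v, u)) +
    (\<Sum>v<m. (\<Sum>t<m. T x I (-1) r t * x (1, I, t, v)) * x (2, I, v, u))"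
  by (simp only: Q_def prod.case refl if_True)

lemma Q_transfer:
  "\<kappa> \<noteq> 2 \<Longrightarrow> Q (\<kappa>, I, r, u) x = T x I (- sg \<kappa>) r u + (\<Sum>v<m. T x I 0 r v * x (\<kappa>, I, v, u)) +
    (\<Sum>v<m. (\<Sum>t<m. T x I (sg \<kappa>) r t * x (\<kappa>, I, t, v)) * x (\<kappa>, I, v, u))"
  by (simp only: Q_def prod.case if_False)

lemma finite_unknowns: "finite unknowns" unfolding unknowns_def using finite_J by simp

lemma poly_fun_unknown:
  "\<kappa> < 3 \<Longrightarrow> I \<in> J \<Longrightarrow> r < m \<Longrightarrow> u < m \<Longrightarrow> poly_fun unknowns 1 (\<lambda>x. x (\<kappa>, I, r, u))"
  by (rule poly_fun_var) (auto simp: finite_unknowns, simp add: unknowns_def)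

lemma d_less_m: "d < m" by (simp add: m_def)

lemma shift_less_m: "j \<in> D \<Longrightarrow> nat (int d - j) < m" by (auto simp: m_def)

lemma poly_fun_coef: "poly_fun unknowns 1 (\<lambda>x. coef x I k)"
proof (cases "k \<in> D")
  case True
  then have "(\<lambda>x. coef x I k) = (\<lambda>x. \<Sum>I'\<in>J. \<Sum>j\<in>D. a k I j I' * of_real (p I') * x (2, I', nat (int d - j), d))"
    unfolding coef_def by (simp only: if_True)
  moreover have "poly_fun unknowns 1 \<dots>"
    by (intro poly_fun_sum poly_fun_cmult poly_fun_unknown shift_less_m d_less_m) auto
  ultimately show ?thesis by (simp only:)
next
  case False
  then show ?thesis unfolding coef_def by (simp only: if_False poly_fun_const)
qed

lemma poly_fun_T: "poly_fun unknowns 1 (\<lambda>x. T x I \<iota> r u)"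
  unfolding T_def by (rule poly_fun_coef)

lemma poly_fun_l: "poly_fun unknowns 1 l"
  unfolding l_def[abs_def] by (intro poly_fun_sum poly_fun_cmult poly_fun_unknown d_less_m) auto

lemma poly_fun_transfer:
  assumes "\<kappa> < 3" "\<kappa>' < 3" "I \<in> J" "u < m"
  shows "poly_fun unknowns 3 (\<lambda>x. \<Sum>v<m. (\<Sum>t<m. T x I \<iota> r t * x (\<kappa>, I, t, v)) * x (\<kappa>', I, v, u))"
proof (rule poly_fun_sum)
  fix v assume "v \<in> {..<m}"
  then have "poly_fun unknowns 2 (\<lambda>x. \<Sum>t<m. T x I \<iota> r t * x (\<kappa>, I, t, v))"
    using assms by (intro poly_fun_sum poly_fun_mult[OF poly_fun_T poly_fun_unknown]) auto
  then show "poly_fun unknowns 3 (\<lambda>x. (\<Sum>t<m. T x I \<iota> r t * x (\<kappa>, I, t, v)) * x (\<kappa>', I, v, u))"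
    using assms \<open>v \<in> {..<m}\<close> by (intro poly_fun_mult[OF _ poly_fun_unknown]) auto
qed

lemma poly_fun_T_mult:
  assumes "\<kappa> < 3" "I \<in> J" "u < m"
  shows "poly_fun unknowns 3 (\<lambda>x. \<Sum>v<m. T x I \<iota> r v * x (\<kappa>, I, v, u))"
  using assms by (intro poly_fun_sum poly_fun_mult[OF poly_fun_T poly_fun_unknown]) auto

lemma poly_fun_Q:
  assumes "i \<in> unknowns"
  shows "poly_fun unknowns 3 (Q i)"
proof -
  obtain \<kappa> I r u where i: "i = (\<kappa>, I, r, u)" "\<kappa> < 3" "I \<in> J" "r < m" "u < m"
    using assms by (auto simp: unknowns_def)
  show ?thesis
  proof (cases "\<kappa> = 2")
    case True
    have "poly_fun unknowns 3 (\<lambda>x. Q (2, I, r, u) x)" unfolding Q_2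
      by (intro poly_fun.add poly_fun_const poly_fun_T_mult poly_fun_transfer i) auto
    then show ?thesis unfolding i(1) True .
  next
    case False
    have "poly_fun unknowns 3 (\<lambda>x. Q (\<kappa>, I, r, u) x)" unfolding Q_transfer[OF False]
      by (intro poly_fun.add poly_fun_mono[OF poly_fun_T] poly_fun_T_mult poly_fun_transfer i) auto
    then show ?thesis unfolding i(1) .
  qed
qed

text \<open>A crude bound both for the coefficients of \<open>A x I\<close> on the unit polydisc and
  for the kernel itself.\<close>

definition C :: real where
  "C = (\<Sum>k\<in>D. \<Sum>I\<in>J. \<Sum>I'\<in>J. \<Sum>j\<in>D. norm (a k I j I'))"

text \<open>Dominates both branches of \<open>Q\<close> on the unit polydisc, term by term.\<close>

definition B :: real where "B = 1 + C + m * C + 2 * (m * (m * C))"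

lemma C_nonneg: "C \<ge> 0" unfolding C_def by (intro sum_nonneg) auto

lemma B_ge_1: "B \<ge> 1" unfolding B_def using C_nonneg by simp

end

text \<open>The bound on \<open>z\<close> forces every unknown below \<open>1 / (3 * m)\<close>, so
  that the transfer matrices have absolute row sums at most 1/3 and really produce decaying
  blocks.\<close>

locale laurent_solution = laurent_system J d p a for J :: "'j set" and d p a +
  fixes x :: "nat \<times> 'j \<times> nat \<times> nat \<Rightarrow> complex" and z :: complex
  assumes x: "\<And>i. i \<in> unknowns \<Longrightarrow> norm (x i) \<le> 1 \<and> z * x i = Q i x"
    and z: "norm z \<ge> 3 * m * B"
begin

lemma coef_bound:
  assumes "I \<in> J"
  shows "norm (coef x I k) \<le> C"
proof (cases "k \<in> D")
  case True
  have "norm (coef x I k) \<le> (\<Sum>I'\<in>J. \<Sum>j\<in>D. norm (a k I j I'))"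
    unfolding coef_def using True
  proof (simp only: if_True, intro sum_norm_le)
    fix I' j assume *: "I' \<in> J" "j \<in> D"
    have "norm (x (2, I', nat (int d - j), d)) \<le> 1"
      using x[of "(2, I', nat (int d - j), d)"] * shift_less_m[of j] d_less_m
      by (auto simp: unknowns_def)
    moreover have "norm (of_real (p I') :: complex) \<le> 1" using p_bounds[of I'] * by simp
    ultimately have "norm (a k I j I') * norm (of_real (p I') :: complex) *
        norm (x (2, I', nat (int d - j), d)) \<le> norm (a k I j I') * 1 * 1"
      by (intro mult_mono) auto
    then show "norm (a k I j I' * of_real (p I') * x (2, I', nat (int d - j), d)) \<le> norm (a k I j I')"
      by (simp add: norm_mult)
  qed
  also have "\<dots> \<le> (\<Sum>I\<in>J. \<Sum>I'\<in>J. \<Sum>j\<in>D. norm (a k I j I'))"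
    using assms finite_J by (intro member_le_sum[of I J]) (auto intro!: sum_nonneg)
  also have "\<dots> \<le> C" unfolding C_def
    using True by (intro member_le_sum[of k D]) (auto intro!: sum_nonneg)
  finally show ?thesis .
next
  case False
  then show ?thesis unfolding coef_def using C_nonneg by (simp only: if_False norm_zero)
qed

lemma T_bound: "I \<in> J \<Longrightarrow> norm (T x I \<iota> r u) \<le> C"
  unfolding T_def by (rule coef_bound)

lemma x_bound: "\<kappa> < 3 \<Longrightarrow> I \<in> J \<Longrightarrow> r < m \<Longrightarrow> u < m \<Longrightarrow> norm (x (\<kappa>, I, r, u)) \<le> 1"
  using x[of "(\<kappa>, I, r, u)"] by (simp add: unknowns_def)

lemma T_mult_bound:
  assumes "\<kappa> < 3" "I \<in> J" "u < m"
  shows "norm (\<Sum>v<m. T x I \<iota> r v * x (\<kappa>, I, v, u)) \<le> m * C"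
proof -
  have "norm (\<Sum>v<m. T x I \<iota> r v * x (\<kappa>, I, v, u)) \<le> (\<Sum>v<m. C * 1)"
    using assms C_nonneg by (intro sum_norm_le) (auto simp: norm_mult intro!: mult_mono[where b = C and d = 1, simplified] T_bound x_bound)
  then show ?thesis by simp
qed

lemma transfer_bound:
  assumes "\<kappa> < 3" "\<kappa>' < 3" "I \<in> J" "u < m"
  shows "norm (\<Sum>v<m. (\<Sum>t<m. T x I \<iota> r t * x (\<kappa>, I, t, v)) * x (\<kappa>', I, v, u)) \<le> m * (m * C)"
proof -
  have "norm (\<Sum>v<m. (\<Sum>t<m. T x I \<iota> r t * x (\<kappa>, I, t, v)) * x (\<kappa>', I, v, u)) \<le> (\<Sum>v<m. (m * C) * 1)"
  proof (rule sum_norm_le)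
    fix v assume "v \<in> {..<m}"
    then show "norm ((\<Sum>t<m. T x I \<iota> r t * x (\<kappa>, I, t, v)) * x (\<kappa>', I, v, u)) \<le> (m * C) * 1"
      unfolding norm_mult using assms C_nonneg by (intro mult_mono T_mult_bound x_bound) auto
  qed
  then show ?thesis by simp
qed

lemma x_small:
  assumes "\<kappa> < 3" "I \<in> J" "r < m" "u < m"
  shows "norm (x (\<kappa>, I, r, u)) \<le> 1 / (3 * m)"
proof -
  have i: "(\<kappa>, I, r, u) \<in> unknowns" using assms by (simp add: unknowns_def)
  have "norm (Q (\<kappa>, I, r, u) x) \<le> B"
  proof (cases "\<kappa> = 2")
    case True
    have "norm (Q (\<kappa>, I, r, u) x) \<le> 1 + m * C + m * (m * C) + m * (m * C)"
      unfolding True Q_2 by (intro norm_triangle_le add_mono T_mult_bound transfer_bound assms) auto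
    then show ?thesis using C_nonneg by (simp add: B_def)
  next
    case False
    have "norm (Q (\<kappa>, I, r, u) x) \<le> C + m * C + m * (m * C)"
      unfolding Q_transfer[OF False]
      by (intro norm_triangle_le add_mono T_mult_bound transfer_bound T_bound assms)
    moreover have "0 \<le> m * (m * C)" using C_nonneg by simp
    ultimately show ?thesis unfolding B_def by linarith
  qed
  then have "norm z * norm (x (\<kappa>, I, r, u)) \<le> B" using x[OF i] by (metis norm_mult)
  moreover have "(3 * m * B) * norm (x (\<kappa>, I, r, u)) \<le> norm z * norm (x (\<kappa>, I, r, u))"
    using z by (intro mult_right_mono) auto
  ultimately have "B * (3 * m * norm (x (\<kappa>, I, r, u))) \<le> B * 1" by (simp add: mult_ac)
  then have "3 * m * norm (x (\<kappa>, I, r, u)) \<le> 1" using B_ge_1 by simp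
  then show ?thesis by (simp add: m_def field_simps)
qed

definition Tv :: "'j \<Rightarrow> int \<Rightarrow> (nat \<Rightarrow> complex) \<Rightarrow> nat \<Rightarrow> complex" where
  "Tv I \<iota> v r = (\<Sum>u<m. T x I \<iota> r u * v u)"

text \<open>Column \<open>d\<close> of the inverse Toeplitz operator, read block by block to the
  right (\<open>\<kappa> = 0\<close>) or to the left (\<open>\<kappa> = 1\<close>) of the central
  block, from which both directions start. Entry \<open>r\<close> of block \<open>k\<close> plays
  the Fourier coefficient of index \<open>r - d + k * m\<close> or
  \<open>r - d - k * m\<close>.\<close>

primrec vec :: "nat \<Rightarrow> 'j \<Rightarrow> nat \<Rightarrow> nat \<Rightarrow> complex" where
  "vec \<kappa> I 0 = (\<lambda>r. x (2, I, r, d))"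
| "vec \<kappa> I (Suc k) = (\<lambda>r. \<Sum>u<m. x (\<kappa>, I, r, u) * vec \<kappa> I k u)"

lemma vec_bound:
  assumes "\<kappa> < 2" "I \<in> J" "r < m"
  shows "norm (vec \<kappa> I k r) \<le> 1 / (3 * m) * (1 / 2) ^ k"
  using assms(3)
proof (induction k arbitrary: r)
  case 0
  then show ?case using x_small[of 2 I r d] d_less_m assms by simp
next
  case (Suc k)
  have "norm (vec \<kappa> I (Suc k) r) \<le> (\<Sum>u<m. 1 / (3 * m) * (1 / (3 * m) * (1 / 2) ^ k))"
    unfolding vec.simps
  proof (rule sum_norm_le)
    fix u assume "u \<in> {..<m}"
    then show "norm (x (\<kappa>, I, r, u) * vec \<kappa> I k u) \<le> 1 / (3 * m) * (1 / (3 * m) * (1 / 2) ^ k)"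
      unfolding norm_mult using Suc assms by (intro mult_mono x_small Suc.IH) auto
  qed
  also have "\<dots> = (1 / 3) * (1 / (3 * m) * (1 / 2) ^ k)" using d_less_m by (simp add: field_simps)
  \<comment> \<open>The actual gain per block is 1/3; the weaker rate 1/2 is all that is
    used.\<close>
  also have "\<dots> \<le> (1 / 2) * (1 / (3 * m) * (1 / 2) ^ k)" by (intro mult_right_mono) auto
  finally show ?case by simp
qed

lemma sum_mult_sum_assoc:
  fixes f :: "nat \<Rightarrow> complex"
  shows "(\<Sum>v<m. (\<Sum>t<m. f t * g t v) * h v) = (\<Sum>t<m. f t * (\<Sum>v<m. g t v * h v))"
  unfolding sum_distrib_right sum_distrib_left by (subst sum.swap) (simp add: mult.assoc)

text \<open>The Riccati equation of the transfer matrix applied to the vector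
  \<open>vec \<kappa> I k\<close>.\<close>

lemma vec_Suc_equation:
  assumes "\<kappa> < 2" "I \<in> J" "r < m"
  shows "z * vec \<kappa> I (Suc k) r =
    Tv I (- sg \<kappa>) (vec \<kappa> I k) r + Tv I 0 (vec \<kappa> I (Suc k)) r + Tv I (sg \<kappa>) (vec \<kappa> I (Suc (Suc k))) r"
proof -
  let ?v = "vec \<kappa> I k"
  have "z * vec \<kappa> I (Suc k) r = (\<Sum>u<m. (z * x (\<kappa>, I, r, u)) * ?v u)"
    by (simp add: sum_distrib_left mult.assoc)
  also have "\<dots> = (\<Sum>u<m. Q (\<kappa>, I, r, u) x * ?v u)"
    using x assms by (intro sum.cong refl) (auto simp: unknowns_def)
  also have "\<dots> = (\<Sum>u<m. T x I (- sg \<kappa>) r u * ?v u) +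
      (\<Sum>u<m. (\<Sum>v<m. T x I 0 r v * x (\<kappa>, I, v, u)) * ?v u) +
      (\<Sum>u<m. (\<Sum>v<m. (\<Sum>t<m. T x I (sg \<kappa>) r t * x (\<kappa>, I, t, v)) * x (\<kappa>, I, v, u)) * ?v u)"
    using assms by (simp add: Q_transfer distrib_right sum.distrib)
  also have "(\<Sum>u<m. (\<Sum>v<m. T x I 0 r v * x (\<kappa>, I, v, u)) * ?v u) = Tv I 0 (vec \<kappa> I (Suc k)) r"
    unfolding Tv_def vec.simps by (rule sum_mult_sum_assoc)
  also have "(\<Sum>u<m. (\<Sum>v<m. (\<Sum>t<m. T x I (sg \<kappa>) r t * x (\<kappa>, I, t, v)) * x (\<kappa>, I, v, u)) * ?v u) =
      Tv I (sg \<kappa>) (vec \<kappa> I (Suc (Suc k))) r"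
    unfolding Tv_def vec.simps by (simp only: sum_mult_sum_assoc)
  finally show ?thesis unfolding Tv_def .
qed

lemma vec_0_equation:
  assumes "I \<in> J" "r < m"
  shows "z * vec 0 I 0 r = (if r = d then 1 else 0) + Tv I 0 (vec 0 I 0) r +
    Tv I 1 (vec 0 I 1) r + Tv I (-1) (vec 1 I 1) r"
proof -
  have "z * vec 0 I 0 r = Q (2, I, r, d) x"
    using x[of "(2, I, r, d)"] assms d_less_m by (simp add: unknowns_def)
  then show ?thesis
    unfolding Q_2 Tv_def One_nat_def vec.simps by (simp only: sum_mult_sum_assoc)
qed

definition Blk :: "(nat \<Rightarrow> complex) \<Rightarrow> complex \<Rightarrow> complex" where
  "Blk v \<xi> = (\<Sum>r<m. \<xi> powi (int r - int d) * v r)"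

lemma Blk_cong: "(\<And>r. r < m \<Longrightarrow> v r = w r) \<Longrightarrow> Blk v \<xi> = Blk w \<xi>"
  unfolding Blk_def by (intro sum.cong) auto

lemma Blk_linear:
  "Blk (\<lambda>r. v r + w r) \<xi> = Blk v \<xi> + Blk w \<xi>" "Blk (\<lambda>r. c * v r) \<xi> = c * Blk v \<xi>"
  by (simp add: Blk_def distrib_left sum.distrib) (simp add: Blk_def sum_distrib_left mult_ac)

lemma Blk_delta: "Blk (\<lambda>r. if r = d then 1 else 0) \<xi> = 1"
  unfolding Blk_def using d_less_m by (simp add: if_distrib cong: if_cong)

lemma Blk_norm:
  fixes c :: real
  assumes "norm \<xi> = 1" "\<And>r. r < m \<Longrightarrow> norm (v r) \<le> c"
  shows "norm (Blk v \<xi>) \<le> m * c"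
proof -
  have "norm (Blk v \<xi>) \<le> (\<Sum>r<m. c)"
    unfolding Blk_def using assms by (intro sum_norm_le) (auto simp: norm_mult norm_power_int)
  then show ?thesis by simp
qed

text \<open>The degree of \<open>A x I\<close> is below the block size, so multiplication by it
  spills only into the two neighbouring blocks. The right neighbour receives \<open>T\<close> with
  index -1 because this index is the column block minus the row block.\<close>

lemma A_mult_Blk:
  assumes "\<xi> \<noteq> 0"
  shows "A x I \<xi> * Blk v \<xi> = Blk (Tv I 0 v) \<xi> + \<xi> powi int m * Blk (Tv I (-1) v) \<xi> +
    \<xi> powi (- int m) * Blk (Tv I 1 v) \<xi>"
proof -
  let ?part = "\<lambda>\<iota> u. \<Sum>k\<in>{\<iota> * int m..<(\<iota> + 1) * int m}. coef x I (k - int u) * \<xi> powi (k - int d)"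
  have part: "\<xi> powi (\<iota> * int m) * Blk (Tv I (- \<iota>) v) \<xi> =
    (\<Sum>u<m. v u * (\<Sum>r<m. coef x I (int r + \<iota> * int m - int u) * \<xi> powi (int r + \<iota> * int m - int d)))" for \<iota>
  proof -
    have "\<xi> powi (\<iota> * int m) * Blk (Tv I (- \<iota>) v) \<xi> =
      (\<Sum>r<m. \<Sum>u<m. v u * (coef x I (int r + \<iota> * int m - int u) * \<xi> powi (int r + \<iota> * int m - int d)))"
      unfolding Blk_def Tv_def T_def sum_distrib_left
    proof (intro sum.cong refl)
      fix r u
      have "\<xi> powi (int r + \<iota> * int m - int d) = \<xi> powi (\<iota> * int m) * \<xi> powi (int r - int d)"
        using assms by (simp flip: power_int_add add: algebra_simps)
      then show "\<xi> powi (\<iota> * int m) * (\<xi> powi (int r - int d) * (coef x I (int r - int u - - \<iota> * int m) * v u)) =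
          v u * (coef x I (int r + \<iota> * int m - int u) * \<xi> powi (int r + \<iota> * int m - int d))"
        by (simp add: algebra_simps)
    qed
    then show ?thesis by (subst (asm) sum.swap) (simp add: sum_distrib_left)
  qed
  have img: "(\<lambda>r. int r + \<iota> * int m) ` {..<m} = {\<iota> * int m..<(\<iota> + 1) * int m}" for \<iota>
  proof -
    have "(\<lambda>r. int r + \<iota> * int m) ` {..<m} = (\<lambda>k. k + \<iota> * int m) ` (int ` {..<m})" by (simp add: image_image)
    also have "int ` {..<m} = {0..<int m}" by (simp add: lessThan_atLeast0 image_int_atLeastLessThan)
    finally show ?thesis by (simp add: algebra_simps)
  qed
  have row: "(\<Sum>r<m. coef x I (int r + \<iota> * int m - int u) * \<xi> powi (int r + \<iota> * int m - int d)) =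
      ?part \<iota> u" for u \<iota>
    unfolding img[symmetric] by (subst sum.reindex) (auto simp: inj_on_def)
  have col: "A x I \<xi> * (v u * \<xi> powi (int u - int d)) = v u *
      (?part (-1) u + ?part 0 u + ?part 1 u)" if u: "u < m" for u
  proof -
    have "A x I \<xi> * \<xi> powi (int u - int d) = (\<Sum>k\<in>D. coef x I k * \<xi> powi (k + int u - int d))"
      unfolding A_def sum_distrib_right
      by (intro sum.cong refl) (use assms in \<open>simp flip: power_int_add add: mult.assoc algebra_simps\<close>)
    also have "\<dots> = (\<Sum>k\<in>(\<lambda>k. k + int u) ` D. coef x I (k - int u) * \<xi> powi (k - int d))"
      by (subst sum.reindex) (auto simp: inj_on_def)
    \<comment> \<open>As \<open>u < m\<close> and \<open>d < m\<close>, the shifted band fits into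
      three consecutive blocks; \<open>coef\<close> vanishes on the added indices.\<close>
    also have "\<dots> = (\<Sum>k\<in>{- int m..<2 * int m}. coef x I (k - int u) * \<xi> powi (k - int d))"
    proof (rule sum.mono_neutral_left)
      show "(\<lambda>k. k + int u) ` D \<subseteq> {- int m..<2 * int m}" using u by (auto simp: m_def)
      show "\<forall>k\<in>{- int m..<2 * int m} - (\<lambda>k. k + int u) ` D. coef x I (k - int u) * \<xi> powi (k - int d) = 0"
      proof
        fix k assume "k \<in> {- int m..<2 * int m} - (\<lambda>k. k + int u) ` D"
        then have "k - int u \<notin> D" by (metis DiffD2 diff_add_cancel imageI)
          then show "coef x I (k - int u) * \<xi> powi (k - int d) = 0"
            unfolding coef_def by (simp only: if_False mult_zero_left)
      qed
    qed simp
    also have "{- int m..<2 * int m} = {(-1) * int m..<((-1) + 1) * int m} \<union>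
        {0 * int m..<(0 + 1) * int m} \<union> {1 * int m..<(1 + 1) * int m}" by auto
    also have "(\<Sum>k\<in>\<dots>. coef x I (k - int u) * \<xi> powi (k - int d)) = ?part (-1) u + ?part 0 u + ?part 1 u"
      by (subst sum.union_disjoint; (subst sum.union_disjoint)?) auto
    finally show ?thesis by (metis mult.left_commute)
  qed
  have "A x I \<xi> * Blk v \<xi> = (\<Sum>u<m. A x I \<xi> * (v u * \<xi> powi (int u - int d)))"
    unfolding Blk_def by (simp add: sum_distrib_left mult_ac)
  also have "\<dots> = (\<Sum>u<m. v u *
      (?part (-1) u + ?part 0 u + ?part 1 u))"
    by (intro sum.cong refl col) simp
  also have "\<dots> = \<xi> powi (-1 * int m) * Blk (Tv I (- (-1)) v) \<xi> + \<xi> powi (0 * int m) * Blk (Tv I (- 0) v) \<xi> +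
      \<xi> powi (1 * int m) * Blk (Tv I (- 1) v) \<xi>"
    unfolding part row by (simp only: distrib_left sum.distrib)
  finally show ?thesis by (simp add: add_ac)
qed

text \<open>Partial sum of the Fourier series of \<open>1 / (z - A x I \<xi>)\<close> with
  \<open>K\<close> blocks on either side of the central one.\<close>

definition Psi :: "nat \<Rightarrow> 'j \<Rightarrow> complex \<Rightarrow> complex" where
  "Psi K I \<xi> = Blk (vec 0 I 0) \<xi> + (\<Sum>k<K. \<xi> powi (int (Suc k) * int m) * Blk (vec 0 I (Suc k)) \<xi> +
     \<xi> powi (- (int (Suc k) * int m)) * Blk (vec 1 I (Suc k)) \<xi>)"

text \<open>The defect of truncation on both sides: what the omitted blocks \<open>K + 1\<close>
  would have contributed to the blocks \<open>K\<close>, minus what the blocks \<open>K\<close>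
  spill outwards.\<close>

definition boundary :: "nat \<Rightarrow> 'j \<Rightarrow> complex \<Rightarrow> complex" where
  "boundary K I \<xi> = \<xi> powi (int K * int m) * Blk (Tv I 1 (vec 0 I (Suc K))) \<xi> +
     \<xi> powi (- (int K * int m)) * Blk (Tv I (-1) (vec 1 I (Suc K))) \<xi> -
     \<xi> powi (int (Suc K) * int m) * Blk (Tv I (-1) (vec 0 I K)) \<xi> -
     \<xi> powi (- (int (Suc K) * int m)) * Blk (Tv I 1 (vec 1 I K)) \<xi>"

text \<open>The recursion of the blocks telescopes: adding the next two blocks cancels the old
  defect and leaves the new one.\<close>

lemma Psi_equation:
  assumes "\<xi> \<noteq> 0" "I \<in> J"
  shows "z * Psi K I \<xi> - A x I \<xi> * Psi K I \<xi> = 1 + boundary K I \<xi>"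
proof (induction K)
  case 0
  have v01: "vec 1 I 0 = vec 0 I 0" by simp
  have "z * Blk (vec 0 I 0) \<xi> = Blk (\<lambda>r. z * vec 0 I 0 r) \<xi>" by (simp only: Blk_linear)
  also have "\<dots> = Blk (\<lambda>r. (if r = d then 1 else 0) + Tv I 0 (vec 0 I 0) r +
    Tv I 1 (vec 0 I 1) r + Tv I (-1) (vec 1 I 1) r) \<xi>"
    by (intro Blk_cong vec_0_equation assms)
  also have "\<dots> = 1 + Blk (Tv I 0 (vec 0 I 0)) \<xi> + Blk (Tv I 1 (vec 0 I 1)) \<xi> + Blk (Tv I (-1) (vec 1 I 1)) \<xi>"
    by (simp only: Blk_linear Blk_delta)
  finally show ?case
    unfolding Psi_def boundary_def v01 using A_mult_Blk[OF assms(1), of I "vec 0 I 0"]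
    by (simp del: vec.simps)
next
  case (Suc K)
  have eq: "z * Blk (vec \<kappa> I (Suc K)) \<xi> = Blk (Tv I (- sg \<kappa>) (vec \<kappa> I K)) \<xi> +
    Blk (Tv I 0 (vec \<kappa> I (Suc K))) \<xi> + Blk (Tv I (sg \<kappa>) (vec \<kappa> I (Suc (Suc K)))) \<xi>" if "\<kappa> < 2" for \<kappa>
  proof -
    have "z * Blk (vec \<kappa> I (Suc K)) \<xi> = Blk (\<lambda>r. z * vec \<kappa> I (Suc K) r) \<xi>" by (simp only: Blk_linear)
    also have "\<dots> = Blk (\<lambda>r. Tv I (- sg \<kappa>) (vec \<kappa> I K) r + Tv I 0 (vec \<kappa> I (Suc K)) r +
        Tv I (sg \<kappa>) (vec \<kappa> I (Suc (Suc K))) r) \<xi>"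
      by (intro Blk_cong vec_Suc_equation assms that)
    finally show ?thesis by (simp only: Blk_linear)
  qed
  \<comment> \<open>Once all powers are expressed by these four quantities, the induction step is a
    polynomial identity modulo \<open>X * Y = 1\<close>.\<close>
  define X where "X = \<xi> powi int m"
  define Y where "Y = \<xi> powi (- int m)"
  define XK where "XK = \<xi> powi (int K * int m)"
  define YK where "YK = \<xi> powi (- (int K * int m))"
  have "X * Y = \<xi> powi (int m + - int m)" unfolding X_def Y_def
    by (simp only: power_int_add[OF disjI1[OF assms(1)]])
  then have XY: "X * Y = 1" by simp
  have pw: "\<xi> powi (e + f) = \<xi> powi e * \<xi> powi f" for e f
    by (rule power_int_add[OF disjI1[OF assms(1)]])
  have i1: "int (Suc K) * int m = int m + int K * int m"
    "int (Suc (Suc K)) * int m = int m + (int m + int K * int m)" by (simp_all add: algebra_simps)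
  have i2: "- (int (Suc K) * int m) = - int m + - (int K * int m)"
    "- (int (Suc (Suc K)) * int m) = - int m + (- int m + - (int K * int m))" by (simp_all add: algebra_simps)
  have X1: "\<xi> powi (int (Suc K) * int m) = X * XK" "\<xi> powi (int (Suc (Suc K)) * int m) = X * (X * XK)"
    unfolding X_def XK_def i1 by (simp_all only: pw)
  have Y1: "\<xi> powi (- (int (Suc K) * int m)) = Y * YK" "\<xi> powi (- (int (Suc (Suc K)) * int m)) = Y * (Y * YK)"
    unfolding Y_def YK_def i2 by (simp_all only: pw)
  have Psi: "Psi (Suc K) I \<xi> = Psi K I \<xi> + X * XK * Blk (vec 0 I (Suc K)) \<xi> + Y * YK * Blk (vec 1 I (Suc K)) \<xi>"
    unfolding Psi_def X1[symmetric] Y1[symmetric] by (simp del: vec.simps add: add.assoc)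
  have e0: "(z - A x I \<xi>) * Blk (vec 0 I (Suc K)) \<xi> = Blk (Tv I (-1) (vec 0 I K)) \<xi> +
      Blk (Tv I 1 (vec 0 I (Suc (Suc K)))) \<xi> - X * Blk (Tv I (-1) (vec 0 I (Suc K))) \<xi> - Y * Blk (Tv I 1 (vec 0 I (Suc K))) \<xi>"
    unfolding left_diff_distrib A_mult_Blk[OF assms(1)] X_def Y_def
    using eq[of 0] by (simp del: vec.simps add: sg_def)
  have e1: "(z - A x I \<xi>) * Blk (vec 1 I (Suc K)) \<xi> = Blk (Tv I 1 (vec 1 I K)) \<xi> +
      Blk (Tv I (-1) (vec 1 I (Suc (Suc K)))) \<xi> - X * Blk (Tv I (-1) (vec 1 I (Suc K))) \<xi> - Y * Blk (Tv I 1 (vec 1 I (Suc K))) \<xi>"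
    unfolding left_diff_distrib A_mult_Blk[OF assms(1)] X_def Y_def
    using eq[of 1] by (simp del: vec.simps add: sg_def)
  have "z * Psi (Suc K) I \<xi> - A x I \<xi> * Psi (Suc K) I \<xi> = (z * Psi K I \<xi> - A x I \<xi> * Psi K I \<xi>) +
      X * XK * ((z - A x I \<xi>) * Blk (vec 0 I (Suc K)) \<xi>) + Y * YK * ((z - A x I \<xi>) * Blk (vec 1 I (Suc K)) \<xi>)"
  proof -
    have "w * (b + X' * c + Y' * e) - f * (b + X' * c + Y' * e) =
        (w * b - f * b) + X' * ((w - f) * c) + Y' * ((w - f) * e)" for w b X' c Y' e f :: complex
      by (simp add: algebra_simps)
    then show ?thesis unfolding Psi .
  qed
  also have "\<dots> = 1 + boundary (Suc K) I \<xi>"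
  proof -
    have "1 + (XK * b1 + YK * b2 - X * XK * b3 - Y * YK * b4) + X * XK * (b3 + b5 - X * b6 - Y * b1) +
        Y * YK * (b4 + b7 - X * b2 - Y * b8) =
        1 + (X * XK * b5 + Y * YK * b7 - X * (X * XK) * b6 - Y * (Y * YK) * b8)"
      for b1 b2 b3 b4 b5 b6 b7 b8
    proof -
      have "X * XK * (Y * b1) = (X * Y) * (XK * b1)" "Y * YK * (X * b2) = (X * Y) * (YK * b2)"
        by (simp_all only: mult_ac)
      then have cancel: "X * XK * (Y * b1) = XK * b1" "Y * YK * (X * b2) = YK * b2"
        unfolding XY by simp_all
      show ?thesis unfolding right_diff_distrib distrib_left cancel
        by (simp add: mult.assoc mult.left_commute)
    qed
    then show ?thesis
      unfolding Suc.IH e0 e1 boundary_def X1 Y1 XK_def[symmetric] YK_def[symmetric] .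
  qed
  finally show ?case .
qed

lemma boundary_bound:
  assumes "norm \<xi> = 1" "I \<in> J"
  shows "norm (boundary K I \<xi>) \<le> 4 * (m * C) * (1 / 2) ^ K"
proof -
  have *: "norm (Blk (Tv I \<iota> (vec \<kappa> I k)) \<xi>) \<le> (m * C) * (1 / 2) ^ K" if "\<kappa> < 2" "K \<le> k" for \<iota> \<kappa> k
  proof -
    have "norm (Tv I \<iota> (vec \<kappa> I k) r) \<le> C * (1 / 2) ^ K" for r
    proof -
      have "norm (Tv I \<iota> (vec \<kappa> I k) r) \<le> (\<Sum>u<m. C * (1 / (3 * m) * (1 / 2) ^ k))"
        unfolding Tv_def
      proof (rule sum_norm_le)
        fix u assume "u \<in> {..<m}"
        then show "norm (T x I \<iota> r u * vec \<kappa> I k u) \<le> C * (1 / (3 * m) * (1 / 2) ^ k)"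
          unfolding norm_mult using assms that C_nonneg by (intro mult_mono T_bound vec_bound) auto
      qed
      also have "\<dots> = (1 / 3) * (C * (1 / 2) ^ k)" using d_less_m by (simp add: field_simps)
      also have "\<dots> \<le> 1 * (C * (1 / 2) ^ K)"
        using that C_nonneg by (intro mult_mono power_decreasing) auto
      finally show ?thesis by simp
    qed
    then have "norm (Blk (Tv I \<iota> (vec \<kappa> I k)) \<xi>) \<le> m * (C * (1 / 2) ^ K)" by (intro Blk_norm assms)
    then show ?thesis by (simp add: mult.assoc)
  qed
  have u: "norm (\<xi> powi e * w) = norm w" for e w using assms by (simp add: norm_mult norm_power_int)
  have tri: "norm (b + c - e - f) \<le> norm b + norm c + norm e + norm f" for b c e f :: complex
    using norm_triangle_ineq4[of "b + c - e" f] norm_triangle_ineq4[of "b + c" e]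
      norm_triangle_ineq[of b c] by linarith
  have "norm (boundary K I \<xi>) \<le> norm (Blk (Tv I 1 (vec 0 I (Suc K))) \<xi>) +
     norm (Blk (Tv I (-1) (vec 1 I (Suc K))) \<xi>) +
     norm (Blk (Tv I (-1) (vec 0 I K)) \<xi>) + norm (Blk (Tv I 1 (vec 1 I K)) \<xi>)"
    unfolding boundary_def by (rule order_trans[OF tri]) (simp only: u order_refl)
  also have "\<dots> \<le> (m * C) * (1 / 2) ^ K + (m * C) * (1 / 2) ^ K + (m * C) * (1 / 2) ^ K + (m * C) * (1 / 2) ^ K"
    by (intro add_mono *) auto
  finally show ?thesis by simp
qed

text \<open>The central block contributes 1/3 and the remaining pairs at most 2/3 in total. The
  bound 1, uniform in \<open>K\<close>, is what the comparison with resolvent moments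
  requires.\<close>

lemma Psi_bound:
  assumes "norm \<xi> = 1" "I \<in> J"
  shows "norm (Psi K I \<xi>) \<le> 1"
proof -
  have b: "norm (Blk (vec \<kappa> I k) \<xi>) \<le> (1 / 3) * (1 / 2) ^ k" if "\<kappa> < 2" for \<kappa> k
  proof -
    have "norm (Blk (vec \<kappa> I k) \<xi>) \<le> m * (1 / (3 * m) * (1 / 2) ^ k)"
      using assms that by (intro Blk_norm vec_bound)
    then show ?thesis using d_less_m by simp
  qed
  have u: "norm (\<xi> powi e * w) = norm w" for e w using assms by (simp add: norm_mult norm_power_int)
  have "norm (Psi K I \<xi>) \<le> 1 / 3 + (\<Sum>k<K. 2 / 3 * (1 / 2) ^ Suc k)"
    unfolding Psi_def
  proof (rule order_trans[OF norm_triangle_ineq], intro add_mono sum_norm_le)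
    show "norm (Blk (vec 0 I 0) \<xi>) \<le> 1 / 3" using b[of 0 0] by simp
    fix k
    have "norm (\<xi> powi (int (Suc k) * int m) * Blk (vec 0 I (Suc k)) \<xi> +
        \<xi> powi (- (int (Suc k) * int m)) * Blk (vec 1 I (Suc k)) \<xi>) \<le>
        (1 / 3) * (1 / 2) ^ Suc k + (1 / 3) * (1 / 2) ^ Suc k"
      by (intro norm_triangle_le add_mono) (simp_all only: u b)
    then show "norm (\<xi> powi (int (Suc k) * int m) * Blk (vec 0 I (Suc k)) \<xi> +
        \<xi> powi (- (int (Suc k) * int m)) * Blk (vec 1 I (Suc k)) \<xi>) \<le> 2 / 3 * (1 / 2) ^ Suc k"
      by simp
  qed
  also have "(\<Sum>k<K. 2 / 3 * (1 / 2) ^ Suc k) \<le> (2 / 3 :: real)"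
  proof -
    have "(\<Sum>k<K. 2 / 3 * (1 / 2) ^ Suc k) = 2 / 3 * (1 - (1 / 2 :: real) ^ K)"
    proof (induction K)
      case (Suc K)
      have "s + 2 / 3 * (1 / 2 * t) = 2 / 3 * (1 - 1 / 2 * t)" if "s = 2 / 3 * (1 - t)" for s t :: real
        using that by (simp add: field_simps)
      then show ?case using Suc unfolding sum.lessThan_Suc power_Suc by blast
    qed simp
    then show ?thesis by simp
  qed
  finally show ?thesis by simp
qed

lemma sum_roots_Blk:
  assumes "\<And>r. r < m \<Longrightarrow> \<bar>e + int r - int d\<bar> < int N" "N > 0"
  shows "(\<Sum>\<xi> | \<xi> ^ N = 1. \<xi> powi e * Blk v \<xi>) =
    (if int d - e \<in> {0..<int m} then of_nat N * v (nat (int d - e)) else 0)"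
proof -
  have "(\<Sum>\<xi> | \<xi> ^ N = 1. \<xi> powi e * Blk v \<xi>) = (\<Sum>\<xi> | \<xi> ^ N = 1. \<Sum>r<m. \<xi> powi (e + int r - int d) * v r)"
    unfolding Blk_def sum_distrib_left
  proof (intro sum.cong refl)
    fix \<xi> :: complex and r assume "\<xi> \<in> {\<xi>. \<xi> ^ N = 1}"
    then have "\<xi> \<noteq> 0" using assms by (auto simp: power_0_left)
    then show "\<xi> powi e * (\<xi> powi (int r - int d) * v r) = \<xi> powi (e + int r - int d) * v r"
      by (simp flip: power_int_add mult.assoc add: add_diff_eq)
  qed
  also have "\<dots> = (\<Sum>r<m. (\<Sum>\<xi> | \<xi> ^ N = 1. \<xi> powi (e + int r - int d)) * v r)"
    by (subst sum.swap) (simp add: sum_distrib_right)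
  also have "\<dots> = (\<Sum>r<m. if int r = int d - e then of_nat N * v r else 0)"
  proof (intro sum.cong refl)
    fix r assume "r \<in> {..<m}"
    then have "(\<Sum>\<xi> | \<xi> ^ N = 1. \<xi> powi (e + int r - int d)) = (if e + int r - int d = 0 then of_nat N else (0::complex))"
      using assms by (intro sum_roots_of_unity_powi) auto
    moreover have "e + int r - int d = 0 \<longleftrightarrow> int r = int d - e" by auto
    ultimately show "(\<Sum>\<xi> | \<xi> ^ N = 1. \<xi> powi (e + int r - int d)) * v r = (if int r = int d - e then of_nat N * v r else 0)"
      by simp
  qed
  also have "\<dots> = (if int d - e \<in> {0..<int m} then of_nat N * v (nat (int d - e)) else 0)"
  proof (cases "int d - e \<in> {0..<int m}")
    case True
    then have "(\<Sum>r<m. if int r = int d - e then of_nat N * v r else 0) = (\<Sum>r<m. if r = nat (int d - e) then of_nat N * v r else 0)"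
      by (intro sum.cong refl) (auto simp: nat_eq_iff2)
    then show ?thesis using True by (auto simp: nat_less_iff)
  qed (auto intro!: sum.neutral)
  finally show ?thesis .
qed

text \<open>All exponents of \<open>\<xi> powi j * Psi K I \<xi>\<close> are below \<open>N\<close>
  in absolute value, so there is no aliasing. Since \<open>\<bar>j\<bar> \<le> d\<close>, only the
  central block contributes, and the average depends on neither \<open>K\<close> nor
  \<open>N\<close>.\<close>

lemma sum_roots_Psi:
  assumes "j \<in> D" "N > (K + 2) * m"
  shows "(\<Sum>\<xi> | \<xi> ^ N = 1. \<xi> powi j * Psi K I \<xi>) = of_nat N * x (2, I, nat (int d - j), d)"
proof -
  let ?b = "\<lambda>\<kappa> e k. \<Sum>\<xi> | \<xi> ^ N = 1. \<xi> powi e * Blk (vec \<kappa> I k) \<xi>"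
  have N: "N > 0" "int N > (int K + 2) * int m"
    using assms by (auto, metis of_nat_less_iff of_nat_mult of_nat_add of_nat_numeral)
  have "(\<Sum>\<xi> | \<xi> ^ N = 1. \<xi> powi j * Psi K I \<xi>) = ?b 0 j 0 +
    (\<Sum>k<K. ?b 0 (j + int (Suc k) * int m) (Suc k) + ?b 1 (j - int (Suc k) * int m) (Suc k))"
  proof -
    have "\<xi> powi j * Psi K I \<xi> = \<xi> powi j * Blk (vec 0 I 0) \<xi> +
      (\<Sum>k<K. \<xi> powi (j + int (Suc k) * int m) * Blk (vec 0 I (Suc k)) \<xi> +
      \<xi> powi (j - int (Suc k) * int m) * Blk (vec 1 I (Suc k)) \<xi>)" if "\<xi> ^ N = 1" for \<xi>
    proof -
      have "\<xi> \<noteq> 0" using that N by (auto simp: power_0_left)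
      then show ?thesis
        unfolding Psi_def distrib_left sum_distrib_left diff_conv_add_uminus
        by (simp only: power_int_add[OF disjI1[OF \<open>\<xi> \<noteq> 0\<close>]] mult.assoc)
    qed
    then have "(\<Sum>\<xi> | \<xi> ^ N = 1. \<xi> powi j * Psi K I \<xi>) = (\<Sum>\<xi> | \<xi> ^ N = 1. \<xi> powi j * Blk (vec 0 I 0) \<xi> +
      (\<Sum>k<K. \<xi> powi (j + int (Suc k) * int m) * Blk (vec 0 I (Suc k)) \<xi> +
      \<xi> powi (j - int (Suc k) * int m) * Blk (vec 1 I (Suc k)) \<xi>))"
      by (intro sum.cong refl) (simp del: vec.simps)
    then show ?thesis by (simp only: sum.distrib sum.swap[of _ "{..<K}"])
  qed
  also have "?b 0 j 0 = of_nat N * x (2, I, nat (int d - j), d)"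
  proof (subst sum_roots_Blk)
    have "int m * 1 \<le> int m * (int K + 2)" by (intro mult_left_mono) auto
    then have "int m < int N" using N(2) by (simp add: mult.commute)
    then show "\<bar>j + int r - int d\<bar> < int N" if "r < m" for r
      using that assms(1) by (auto simp: m_def)
  qed (use assms N in \<open>auto simp: m_def\<close>)
  also have "(\<Sum>k<K. ?b 0 (j + int (Suc k) * int m) (Suc k) + ?b 1 (j - int (Suc k) * int m) (Suc k)) = 0"
  proof (intro sum.neutral ballI)
    fix k assume "k \<in> {..<K}"
    then have k1: "int (Suc k) * int m \<le> int K * int m" by (intro mult_right_mono) auto
    have "1 * int m \<le> int (Suc k) * int m" by (intro mult_right_mono) auto
    with k1 have k: "int (Suc k) * int m \<le> int K * int m" "int m \<le> int (Suc k) * int m" by simp_all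
    have N': "int N > int K * int m + 2 * int m" using N(2) by (simp add: algebra_simps)
    define t where "t = int (Suc k) * int m"
    have t: "int m \<le> t" "t + 2 * int m < int N" using k N' by (simp_all add: t_def)
    have "?b 0 (j + int (Suc k) * int m) (Suc k) = 0"
    proof (subst sum_roots_Blk)
      show "\<bar>j + int (Suc k) * int m + int r - int d\<bar> < int N" if "r < m" for r
        using that assms(1) t unfolding t_def[symmetric] abs_less_iff by (auto simp: m_def)
      have "\<not> int d - (j + int (Suc k) * int m) \<in> {0..<int m}"
        using assms(1) t unfolding t_def[symmetric] by (auto simp: m_def)
      then show "(if int d - (j + int (Suc k) * int m) \<in> {0..<int m}
        then of_nat N * vec 0 I (Suc k) (nat (int d - (j + int (Suc k) * int m))) else 0) = 0" by (simp only: if_False)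
    qed (rule N)
    moreover have "?b 1 (j - int (Suc k) * int m) (Suc k) = 0"
    proof (subst sum_roots_Blk)
      show "\<bar>j - int (Suc k) * int m + int r - int d\<bar> < int N" if "r < m" for r
        using that assms(1) t unfolding t_def[symmetric] abs_less_iff by (auto simp: m_def)
      have "\<not> int d - (j - int (Suc k) * int m) \<in> {0..<int m}"
        using assms(1) t unfolding t_def[symmetric] by (auto simp: m_def)
      then show "(if int d - (j - int (Suc k) * int m) \<in> {0..<int m}
        then of_nat N * vec 1 I (Suc k) (nat (int d - (j - int (Suc k) * int m))) else 0) = 0" by (simp only: if_False)
    qed (rule N)
    ultimately show "?b 0 (j + int (Suc k) * int m) (Suc k) +
      ?b 1 (j - int (Suc k) * int m) (Suc k) = 0" by simp
  qed
  finally show ?thesis by simp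
qed

end

section \<open>Resolvents of real symmetric matrices\<close>

definition resolvent_denom :: "complex \<Rightarrow> nat \<Rightarrow> (nat \<Rightarrow> nat \<Rightarrow> real) \<Rightarrow> complex mat" where
  "resolvent_denom z n a = mat n n (\<lambda>(i, j). (if i = j then z else 0) - complex_of_real (a i j))"

text \<open>Cramer's rule makes measurability in the matrix entries immediate. The value 0 for a
  vanishing determinant does not occur for symmetric \<open>a\<close> and
  \<open>Im z \<noteq> 0\<close>.\<close>

definition resolvent :: "complex \<Rightarrow> nat \<Rightarrow> (nat \<Rightarrow> nat \<Rightarrow> real) \<Rightarrow> nat \<Rightarrow> nat \<Rightarrow> complex" where
  "resolvent z n a i j = cofactor (resolvent_denom z n a) j i / det (resolvent_denom z n a)"

definition symmetric_on :: "nat \<Rightarrow> (nat \<Rightarrow> nat \<Rightarrow> real) \<Rightarrow> bool" where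
  "symmetric_on n a \<longleftrightarrow> (\<forall>i<n. \<forall>j<n. a i j = a j i)"

lemma resolvent_denom_carrier [simp]: "resolvent_denom z n a \<in> carrier_mat n n"
  by (simp add: resolvent_denom_def)

lemma resolvent_denom_simps [simp]:
  "dim_row (resolvent_denom z n a) = n" "dim_col (resolvent_denom z n a) = n"
  "i < n \<Longrightarrow> j < n \<Longrightarrow> resolvent_denom z n a $$ (i, j) = (if i = j then z else 0) - of_real (a i j)"
  by (simp_all add: resolvent_denom_def)

lemma sum_delta_mult:
  fixes f :: "nat \<Rightarrow> complex"
  assumes "l < n"
  shows "(\<Sum>i<n. f i * (if i = l then 1 else 0)) = f l"
    "(\<Sum>i<n. (if i = l then 1 else 0) * f i) = f l"
    "(\<Sum>i<n. (if l = i then 1 else 0) * f i) = f l"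
  using assms by (simp_all add: if_distrib if_distribR cong: if_cong)

lemma symmetric_quadratic_form_real:
  fixes v :: "nat \<Rightarrow> complex"
  assumes "symmetric_on n a"
  shows "Im (\<Sum>i<n. \<Sum>j<n. cnj (v i) * of_real (a i j) * v j) = 0"
proof -
  let ?q = "\<Sum>i<n. \<Sum>j<n. cnj (v i) * of_real (a i j) * v j"
  have "cnj ?q = (\<Sum>i<n. \<Sum>j<n. v i * of_real (a i j) * cnj (v j))" by (simp add: mult_ac)
  also have "\<dots> = (\<Sum>j<n. \<Sum>i<n. v i * of_real (a i j) * cnj (v j))" by (rule sum.swap)
  also have "\<dots> = ?q"
    using assms by (intro sum.cong refl) (auto simp: symmetric_on_def mult_ac)
  finally have "?q \<in> \<real>" by (simp only: Reals_cnj_iff)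
  then show ?thesis by (simp only: complex_is_Real_iff)
qed

text \<open>The quadratic form of a real symmetric matrix is real, so only \<open>z\<close>
  contributes to the imaginary part. Applied to a kernel vector this gives invertibility, applied to
  a column of the resolvent its norm bound.\<close>

lemma imaginary_part_lower_bound:
  fixes v :: "nat \<Rightarrow> complex"
  assumes "symmetric_on n a"
  shows "\<bar>Im z\<bar> * (\<Sum>i<n. (norm (v i))\<^sup>2) \<le>
    norm (\<Sum>i<n. cnj (v i) * (z * v i - (\<Sum>j<n. of_real (a i j) * v j)))"
proof -
  have "(\<Sum>i<n. cnj (v i) * (z * v i - (\<Sum>j<n. of_real (a i j) * v j))) =
     z * of_real (\<Sum>i<n. (norm (v i))\<^sup>2) - (\<Sum>i<n. \<Sum>j<n. cnj (v i) * of_real (a i j) * v j)"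
    unfolding of_real_sum complex_norm_square
    by (simp add: right_diff_distrib sum_subtractf sum_distrib_left mult_ac)
  then have "Im (\<Sum>i<n. cnj (v i) * (z * v i - (\<Sum>j<n. of_real (a i j) * v j))) =
     Im z * (\<Sum>i<n. (norm (v i))\<^sup>2)"
    using symmetric_quadratic_form_real[OF assms, of v]
    by (simp only: minus_complex.sel times_complex.sel Re_complex_of_real Im_complex_of_real
      mult_zero_right add_0 diff_zero)
  then have "\<bar>Im z\<bar> * (\<Sum>i<n. (norm (v i))\<^sup>2) =
      \<bar>Im (\<Sum>i<n. cnj (v i) * (z * v i - (\<Sum>j<n. of_real (a i j) * v j)))\<bar>"
    by (simp only: abs_mult abs_of_nonneg sum_nonneg zero_le_power2)
  then show ?thesis by (simp only: abs_Im_le_cmod)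
qed

lemma det_resolvent_denom:
  assumes "symmetric_on n a" "Im z \<noteq> 0"
  shows "det (resolvent_denom z n a) \<noteq> 0"
proof
  assume "det (resolvent_denom z n a) = 0"
  then obtain v where v: "v \<in> carrier_vec n" "v \<noteq> 0\<^sub>v n" "resolvent_denom z n a *\<^sub>v v = 0\<^sub>v n"
    using det_0_iff_vec_prod_zero_field[OF resolvent_denom_carrier] by blast
  have "z * v $ i - (\<Sum>j<n. of_real (a i j) * v $ j) = 0" if i: "i < n" for i
  proof -
    have "0 = (resolvent_denom z n a *\<^sub>v v) $ i" using i v by simp
    also have "\<dots> = (\<Sum>j<n. ((if i = j then z else 0) - of_real (a i j)) * v $ j)"
      using i v(1) by (simp add: mult_mat_vec_def scalar_prod_def lessThan_atLeast0)
    also have "\<dots> = (\<Sum>j<n. (if i = j then z * v $ j else 0) - of_real (a i j) * v $ j)"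
      by (intro sum.cong) (auto simp: algebra_simps)
    also have "\<dots> = z * v $ i - (\<Sum>j<n. of_real (a i j) * v $ j)"
      using i by (simp add: sum_subtractf)
    finally show ?thesis by simp
  qed
  then have "(\<Sum>i<n. (norm (v $ i))\<^sup>2) \<le> 0"
    using imaginary_part_lower_bound[OF assms(1), of z "\<lambda>i. v $ i"] assms(2)
    by (simp add: mult_le_0_iff)
  then have "(\<Sum>i<n. (norm (v $ i))\<^sup>2) = 0" by (intro antisym sum_nonneg) auto
  then have "\<forall>i<n. v $ i = 0" by (simp add: sum_nonneg_eq_0_iff)
  then show False using v(1,2) by (auto intro!: eq_vecI)
qed

lemma resolvent_right_inverse:
  assumes "symmetric_on n a" "Im z \<noteq> 0" "i < n" "j < n"
  shows "(\<Sum>k<n. ((if i = k then z else 0) - of_real (a i k)) * resolvent z n a k j) = (if i = j then 1 else 0)"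
proof -
  let ?R = "resolvent_denom z n a"
  have "(?R * adj_mat ?R) $$ (i, j) = (\<Sum>k<n. ((if i = k then z else 0) - of_real (a i k)) * cofactor ?R j k)"
    using assms by (simp add: times_mat_def scalar_prod_def lessThan_atLeast0 adj_mat_def)
  moreover have "(?R * adj_mat ?R) $$ (i, j) = det ?R * (if i = j then 1 else 0)"
    using assms adj_mat(2)[OF resolvent_denom_carrier, of z n a] by simp
  ultimately show ?thesis
    using det_resolvent_denom[OF assms(1,2)]
    by (cases "i = j") (simp_all add: resolvent_def sum_divide_distrib[symmetric])
qed

lemma resolvent_left_inverse:
  assumes "symmetric_on n a" "Im z \<noteq> 0" "i < n" "j < n"
  shows "(\<Sum>k<n. resolvent z n a i k * ((if k = j then z else 0) - of_real (a k j))) = (if i = j then 1 else 0)"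
proof -
  let ?R = "resolvent_denom z n a"
  have "(adj_mat ?R * ?R) $$ (i, j) = (\<Sum>k<n. cofactor ?R k i * ((if k = j then z else 0) - of_real (a k j)))"
    using assms by (simp add: times_mat_def scalar_prod_def lessThan_atLeast0 adj_mat_def)
  moreover have "(adj_mat ?R * ?R) $$ (i, j) = det ?R * (if i = j then 1 else 0)"
    using assms adj_mat(3)[OF resolvent_denom_carrier, of z n a] by simp
  ultimately show ?thesis
    using det_resolvent_denom[OF assms(1,2)]
    by (cases "i = j") (simp_all add: resolvent_def sum_divide_distrib[symmetric])
qed

text \<open>The second resolvent identity: \<open>(z - b) - (z - a)\<close> is inserted between the
  two resolvents.\<close>

lemma resolvent_difference:
  assumes "symmetric_on n a" "symmetric_on n b" "Im z \<noteq> 0" "k < n" "l < n"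
  shows "resolvent z n a k l - resolvent z n b k l =
    (\<Sum>i<n. \<Sum>j<n. resolvent z n a k i * of_real (a i j - b i j) * resolvent z n b j l)"
proof -
  let ?d = "\<lambda>i j. if i = j then z else 0"
  let ?G = "resolvent z n a" and ?H = "resolvent z n b"
  have "(\<Sum>i<n. \<Sum>j<n. ?G k i * of_real (a i j - b i j) * ?H j l) =
    (\<Sum>i<n. \<Sum>j<n. ?G k i * ((?d i j - of_real (b i j)) * ?H j l)) -
    (\<Sum>i<n. \<Sum>j<n. (?G k i * (?d i j - of_real (a i j))) * ?H j l)"
    unfolding sum_subtractf[symmetric] by (intro sum.cong refl) (simp add: algebra_simps)
  also have "(\<Sum>i<n. \<Sum>j<n. ?G k i * ((?d i j - of_real (b i j)) * ?H j l)) =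
      (\<Sum>i<n. ?G k i * (if i = l then 1 else 0))"
    unfolding sum_distrib_left[symmetric]
    using resolvent_right_inverse[OF assms(2,3) _ assms(5)] by (intro sum.cong refl) auto
  also have "(\<Sum>i<n. ?G k i * (if i = l then 1 else 0)) = ?G k l" using assms by (simp only: sum_delta_mult)
  also have "(\<Sum>i<n. \<Sum>j<n. (?G k i * (?d i j - of_real (a i j))) * ?H j l) =
      (\<Sum>j<n. (if k = j then 1 else 0) * ?H j l)"
    using resolvent_left_inverse[OF assms(1,3) assms(4)]
    by (subst sum.swap) (auto simp: sum_distrib_right[symmetric] intro!: sum.cong)
  also have "(\<Sum>j<n. (if k = j then 1 else 0) * ?H j l) = ?H k l" using assms by (simp only: sum_delta_mult)
  finally show ?thesis by simp
qed

lemma resolvent_dyson: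
  assumes "symmetric_on n a" "Im z \<noteq> 0" "i < n" "j < n"
  shows "z * resolvent z n a i j = (if i = j then 1 else 0) + (\<Sum>k<n. of_real (a i k) * resolvent z n a k j)"
proof -
  have "(\<Sum>k<n. ((if i = k then z else 0) - of_real (a i k)) * resolvent z n a k j) =
    (\<Sum>k<n. (if i = k then z * resolvent z n a k j else 0) - of_real (a i k) * resolvent z n a k j)"
    by (intro sum.cong) (auto simp: algebra_simps)
  also have "\<dots> = z * resolvent z n a i j - (\<Sum>k<n. of_real (a i k) * resolvent z n a k j)"
    using assms by (simp add: sum_subtractf)
  finally show ?thesis using resolvent_right_inverse[OF assms] by (simp add: algebra_simps)
qed

text \<open>The product of the transposed resolvent, \<open>z - a\<close> and the resolvent is
  evaluated in both bracketings.\<close>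

lemma resolvent_symmetric:
  assumes "symmetric_on n a" "Im z \<noteq> 0" "k < n" "l < n"
  shows "resolvent z n a k l = resolvent z n a l k"
proof -
  let ?d = "\<lambda>i j. if i = j then z else 0"
  let ?G = "resolvent z n a"
  have "(\<Sum>i<n. \<Sum>j<n. ?G i k * (?d i j - of_real (a i j)) * ?G j l) =
      (\<Sum>i<n. ?G i k * (\<Sum>j<n. (?d i j - of_real (a i j)) * ?G j l))"
    by (simp add: sum_distrib_left mult.assoc)
  also have "\<dots> = (\<Sum>i<n. ?G i k * (if i = l then 1 else 0))"
    using resolvent_right_inverse[OF assms(1,2) _ assms(4)] by (intro sum.cong refl) auto
  also have "\<dots> = ?G l k" using assms by (simp only: sum_delta_mult)
  finally have 1: "(\<Sum>i<n. \<Sum>j<n. ?G i k * (?d i j - of_real (a i j)) * ?G j l) = ?G l k" .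
  have "(\<Sum>i<n. \<Sum>j<n. ?G i k * (?d i j - of_real (a i j)) * ?G j l) =
      (\<Sum>j<n. (\<Sum>i<n. ?G i k * (?d i j - of_real (a i j))) * ?G j l)"
    by (subst sum.swap) (simp add: sum_distrib_right)
  also have "\<dots> = (\<Sum>j<n. (if j = k then 1 else 0) * ?G j l)"
  proof (intro sum.cong refl)
    fix j assume j: "j \<in> {..<n}"
    have "(\<Sum>i<n. ?G i k * (?d i j - of_real (a i j))) = (\<Sum>i<n. (?d j i - of_real (a j i)) * ?G i k)"
      using assms(1) j by (intro sum.cong refl) (auto simp: symmetric_on_def mult_ac)
    then show "(\<Sum>i<n. ?G i k * (?d i j - of_real (a i j))) * ?G j l = (if j = k then 1 else 0) * ?G j l"
      using resolvent_right_inverse[OF assms(1,2) _ assms(3), of j] j by auto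
  qed
  also have "\<dots> = ?G k l" using assms by (simp only: sum_delta_mult)
  finally show ?thesis using 1 by simp
qed

text \<open>For the column \<open>v\<close> with index \<open>j\<close>, the form of
  \<open>z - a\<close> at \<open>v\<close> is the conjugate of the diagonal entry, itself a
  component of \<open>v\<close>; hence \<open>\<bar>Im z\<bar>\<close> times the squared norm of
  \<open>v\<close> is at most the norm of \<open>v\<close>. As \<open>n\<close> does not enter, sums
  of \<open>n\<close> error terms with weights \<open>S / n\<close> stay of order
  \<open>1 / n\<close> later on.\<close>

lemma resolvent_column_bound:
  assumes "symmetric_on n a" "Im z \<noteq> 0" "j < n"
  shows "(\<Sum>i<n. (norm (resolvent z n a i j))\<^sup>2) \<le> 1 / (Im z)\<^sup>2"
proof -
  let ?G = "resolvent z n a" and ?T = "\<Sum>i<n. (norm (resolvent z n a i j))\<^sup>2"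
  have T: "?T \<ge> 0" by (intro sum_nonneg) auto
  have "(\<Sum>i<n. cnj (?G i j) * (z * ?G i j - (\<Sum>k<n. of_real (a i k) * ?G k j))) =
      (\<Sum>i<n. cnj (?G i j) * (if i = j then 1 else 0))"
    using resolvent_dyson[OF assms(1,2) _ assms(3)] by (intro sum.cong refl) auto
  also have "\<dots> = cnj (?G j j)" using assms by (simp only: sum_delta_mult)
  finally have "\<bar>Im z\<bar> * ?T \<le> norm (?G j j)"
    using imaginary_part_lower_bound[OF assms(1), of z "\<lambda>i. ?G i j"] by simp
  then have "(\<bar>Im z\<bar> * ?T)\<^sup>2 \<le> (norm (?G j j))\<^sup>2" using T by (intro power_mono) auto
  also have "\<dots> \<le> ?T" using assms by (intro member_le_sum) auto
  finally have "((Im z)\<^sup>2 * ?T) * ?T \<le> 1 * ?T" by (simp add: power_mult_distrib power2_eq_square mult_ac)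
  then have "(Im z)\<^sup>2 * ?T \<le> 1" using T by (cases "?T = 0") (auto simp del: mult_1)
  then show ?thesis using assms(2) by (simp add: field_simps)
qed

lemma resolvent_bound:
  assumes "symmetric_on n a" "Im z \<noteq> 0" "i < n" "j < n"
  shows "norm (resolvent z n a i j) \<le> 1 / \<bar>Im z\<bar>"
proof -
  have "(norm (resolvent z n a i j))\<^sup>2 \<le> (\<Sum>i<n. (norm (resolvent z n a i j))\<^sup>2)"
    using assms by (intro member_le_sum) auto
  also have "\<dots> \<le> (1 / \<bar>Im z\<bar>)\<^sup>2" using resolvent_column_bound[OF assms(1,2,4)] by (simp add: power_divide)
  finally show ?thesis by (rule power2_le_imp_le) auto
qed

section \<open>Measurability of resolvent entries\<close>

lemma measurable_det:
  assumes "\<And>\<omega>. dim_row (A \<omega>) = n" "\<And>\<omega>. dim_col (A \<omega>) = n"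
    "\<And>i j. i < n \<Longrightarrow> j < n \<Longrightarrow> (\<lambda>\<omega>. A \<omega> $$ (i, j)) \<in> borel_measurable M"
  shows "(\<lambda>\<omega>. det (A \<omega>) :: complex) \<in> borel_measurable M"
proof -
  have "(\<lambda>\<omega>. \<Sum>p | p permutes {0..<n}. signof p * (\<Prod>i = 0..<n. A \<omega> $$ (i, p i)) :: complex)
      \<in> borel_measurable M"
  proof (intro borel_measurable_sum borel_measurable_times borel_measurable_prod borel_measurable_const)
    fix p i assume "p \<in> {p. p permutes {0..<n}}" "i \<in> {0..<n}"
    then show "(\<lambda>\<omega>. A \<omega> $$ (i, p i)) \<in> borel_measurable M"
      using permutes_in_image[of p "{0..<n}" i] by (intro assms(3)) auto
  qed
  then show ?thesis by (simp add: det_def assms(1,2))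
qed

lemma measurable_resolvent:
  assumes "\<And>i j. i < n \<Longrightarrow> j < n \<Longrightarrow> (\<lambda>\<omega>. a \<omega> i j) \<in> borel_measurable M" "i < n" "j < n"
  shows "(\<lambda>\<omega>. resolvent z n (a \<omega>) i j) \<in> borel_measurable M"
proof -
  have e: "(\<lambda>\<omega>. resolvent_denom z n (a \<omega>) $$ (k, l)) \<in> borel_measurable M" if "k < n" "l < n" for k l
    using assms(1)[OF that] that by (simp add: resolvent_denom_def)
  have "(\<lambda>\<omega>. det (mat_delete (resolvent_denom z n (a \<omega>)) j i)) \<in> borel_measurable M"
  proof (rule measurable_det)
    fix k l assume "k < n - 1" "l < n - 1"
    let ?k = "if k < j then k else Suc k" and ?l = "if l < i then l else Suc l"
    have "mat_delete (resolvent_denom z n (a \<omega>)) j i $$ (k, l) = resolvent_denom z n (a \<omega>) $$ (?k, ?l)"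
      for \<omega> using \<open>k < n - 1\<close> \<open>l < n - 1\<close> by (simp add: mat_delete_def)
    moreover have "?k < n" "?l < n" using \<open>k < n - 1\<close> \<open>l < n - 1\<close> by auto
    ultimately show "(\<lambda>\<omega>. mat_delete (resolvent_denom z n (a \<omega>)) j i $$ (k, l)) \<in> borel_measurable M"
      using e[of ?k ?l] by (simp only:)
  qed (simp_all add: mat_delete_def)
  moreover have "(\<lambda>\<omega>. det (resolvent_denom z n (a \<omega>))) \<in> borel_measurable M"
    by (rule measurable_det[OF resolvent_denom_simps(1,2) e])
  ultimately show ?thesis
    unfolding resolvent_def cofactor_def
    by (intro borel_measurable_divide borel_measurable_times borel_measurable_const)
qed

section \<open>Trace of the resolvent in terms of eigenvalues\<close>

lemma pderiv_linear_factors: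
  fixes z :: complex
  assumes "\<forall>a\<in>set as. z \<noteq> a"
  shows "poly (pderiv (\<Prod>a\<leftarrow>as. [:- a, 1:])) z = poly (\<Prod>a\<leftarrow>as. [:- a, 1:]) z * (\<Sum>a\<leftarrow>as. 1 / (z - a))"
  using assms
proof (induction as)
  case (Cons a as)
  let ?P = "\<Prod>a\<leftarrow>as. [:- a, 1:]" and ?S = "\<Sum>a\<leftarrow>as. 1 / (z - a)"
  have "poly [:- a, 1:] z = z - a" by simp
  have "poly (pderiv ([:- a, 1:] * ?P)) z = (z - a) * poly (pderiv ?P) z + poly ?P z"
    unfolding pderiv_mult poly_add poly_mult by (simp add: pderiv_pCons)
  also have "poly (pderiv ?P) z = poly ?P z * ?S" using Cons by simp
  also have "(z - a) * (poly ?P z * ?S) + poly ?P z = ((z - a) * poly ?P z) * (1 / (z - a) + ?S)"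
    using Cons.prems by (simp add: field_simps)
  finally show ?case
    using \<open>poly [:- a, 1:] z = z - a\<close>
    by (simp only: list.map prod_list.Cons sum_list.Cons poly_mult)
qed (simp add: pderiv_1)

text \<open>Nonreal roots are excluded because \<open>z - a\<close> is invertible off the real line.
  The derivative of the characteristic polynomial is the trace of the adjugate, so the trace of the
  resolvent is a logarithmic derivative; no diagonalization is involved.\<close>

lemma char_poly_real_symmetric:
  assumes "symmetric_on n a"
  shows "\<exists>rs. char_poly (mat n n (\<lambda>(i, j). a i j)) = (\<Prod>r\<leftarrow>rs. [:- r, 1:]) \<and> length rs = n \<and>
    (\<forall>z. Im z \<noteq> 0 \<longrightarrow> (\<Sum>i<n. resolvent z n a i i) = (\<Sum>r\<leftarrow>rs. 1 / (z - complex_of_real r)))"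
proof -
  let ?A = "mat n n (\<lambda>(i, j). a i j)" and ?C = "mat n n (\<lambda>(i, j). complex_of_real (a i j))"
  have AC: "?C = map_mat complex_of_real ?A" by (intro eq_matI) auto
  have C: "?C \<in> carrier_mat n n" by simp
  obtain as where as: "char_poly ?C = (\<Prod>a\<leftarrow>as. [:- a, 1:])" "length as = n"
    using char_poly_factorized[OF C] by blast
  have det: "poly (char_poly ?C) z = det (resolvent_denom z n a)" for z
    unfolding char_poly_def
    by (rule poly_det_cong[of _ n]) (auto simp: char_poly_matrix_def resolvent_denom_def)
  have real: "x \<in> \<real>" if "x \<in> set as" for x
  proof (rule ccontr)
    assume "x \<notin> \<real>"
    then have "poly (char_poly ?C) x \<noteq> 0"
      unfolding det using det_resolvent_denom[OF assms] by (auto simp: complex_is_Real_iff)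
    moreover have "poly (\<Prod>a\<leftarrow>as. [:- a, 1:]) x = 0" using that by (induction as) auto
    ultimately show False by (simp add: as)
  qed
  define rs where "rs = map Re as"
  have as_rs: "as = map complex_of_real rs"
    unfolding rs_def map_map using real by (intro map_idI[symmetric]) (auto simp: of_real_Re)
  interpret h: map_poly_inj_idom_hom complex_of_real ..
  have "map_poly complex_of_real (char_poly ?A) = char_poly ?C"
    unfolding AC by (subst of_real_hom.char_poly_hom[of _ n]) auto
  also have "\<dots> = map_poly complex_of_real (\<Prod>r\<leftarrow>rs. [:- r, 1:])"
    unfolding as(1) as_rs
  proof (induction rs)
    case (Cons r rs)
    have "map_poly complex_of_real ([:- r, 1:] * (\<Prod>r\<leftarrow>rs. [:- r, 1:])) =
        [:- complex_of_real r, 1:] * map_poly complex_of_real (\<Prod>r\<leftarrow>rs. [:- r, 1:])"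
      unfolding h.hom_mult by (simp add: map_poly_pCons)
    then show ?case using Cons by (simp add: o_def)
  qed simp
  finally have "char_poly ?A = (\<Prod>r\<leftarrow>rs. [:- r, 1:])" by simp
  moreover have "length rs = n" using as by (simp add: rs_def)
  moreover have "(\<Sum>i<n. resolvent z n a i i) = (\<Sum>r\<leftarrow>rs. 1 / (z - complex_of_real r))"
    if z: "Im z \<noteq> 0" for z
  proof -
    have cof: "cofactor (resolvent_denom z n a) i i = poly (char_poly (mat_delete ?C i i)) z"
      if i: "i < n" for i
    proof -
      have "poly (char_poly (mat_delete ?C i i)) z = det (mat_delete (resolvent_denom z n a) i i)"
        unfolding char_poly_def using i
        by (intro poly_det_cong[of _ "n - 1"])
           (auto simp: char_poly_matrix_def resolvent_denom_def mat_delete_def)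
      then show ?thesis by (simp add: cofactor_def)
    qed
    have "(\<Sum>i<n. resolvent z n a i i) = poly (pderiv (char_poly ?C)) z / poly (char_poly ?C) z"
      unfolding pderiv_char_poly[OF C] poly_sum det sum_divide_distrib
      by (intro sum.cong refl) (simp add: resolvent_def cof)
    also have "poly (pderiv (char_poly ?C)) z = poly (char_poly ?C) z * (\<Sum>a\<leftarrow>as. 1 / (z - a))"
      unfolding as(1) using real z by (intro pderiv_linear_factors) (auto simp: complex_is_Real_iff)
    finally show ?thesis
      using det_resolvent_denom[OF assms z] det[of z] by (simp add: as_rs o_def)
  qed
  ultimately show ?thesis by blast
qed

lemma proots_linear_factors:
  fixes rs :: "'a::idom list"
  shows "proots (\<Prod>r\<leftarrow>rs. [:- r, 1:]) = mset rs"
proof (induction rs)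
  case (Cons r rs)
  have "(\<Prod>r\<leftarrow>rs. [:- r, 1:]) \<noteq> 0" by (auto simp: prod_list_zero_iff)
  then have "proots ([:- r, 1:] * (\<Prod>r\<leftarrow>rs. [:- r, 1:])) = proots [:- r, 1:] + proots (\<Prod>r\<leftarrow>rs. [:- r, 1:])"
    by (intro proots_mult) auto
  then show ?case using Cons by simp
qed simp

lemma sum_count_list:
  assumes "finite A" "set rs \<subseteq> A"
  shows "(\<Sum>x\<in>A. of_nat (count_list rs x) * f x) = (\<Sum>r\<leftarrow>rs. f r :: 'b::semiring_1)"
  using assms(2)
proof (induction rs)
  case (Cons r rs)
  have "(\<Sum>x\<in>A. of_nat (count_list (r # rs) x) * f x) =
      (\<Sum>x\<in>A. (if x = r then f x else 0) + of_nat (count_list rs x) * f x)"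
    by (intro sum.cong) (auto simp: distrib_right)
  then show ?case using Cons assms(1) by (simp add: sum.distrib)
qed simp

lemma integral_pmf_of_mset:
  fixes f :: "'a \<Rightarrow> complex"
  assumes "rs \<noteq> []"
  shows "(LINT x|measure_pmf (pmf_of_multiset (mset rs)). f x) = (\<Sum>r\<leftarrow>rs. f r) / of_nat (length rs)"
proof -
  have "(LINT x|measure_pmf (pmf_of_multiset (mset rs)). f x) =
      (\<Sum>x\<in>set rs. pmf (pmf_of_multiset (mset rs)) x *\<^sub>R f x)"
    using assms by (intro integral_measure_pmf) auto
  also have "\<dots> = (\<Sum>x\<in>set rs. of_nat (count (mset rs) x) * f x) / of_nat (length rs)"
    using assms unfolding sum_divide_distrib
    by (intro sum.cong refl) (simp add: scaleR_conv_of_real)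
  also have "(\<Sum>x\<in>set rs. of_nat (count (mset rs) x) * f x) = (\<Sum>r\<leftarrow>rs. f r)"
    by (simp add: count_mset sum_count_list)
  finally show ?thesis .
qed

lemma stieltjes_empirical_eigenvalue_distribution:
  assumes "symmetric_on n a" "Im z \<noteq> 0" "n > 0"
  shows "(LINT x|empirical_eigenvalue_distribution (mat n n (\<lambda>(i, j). a i j)). 1 / (z - complex_of_real x)) =
    (\<Sum>i<n. resolvent z n a i i) / of_nat n"
proof -
  obtain rs where rs: "char_poly (mat n n (\<lambda>(i, j). a i j)) = (\<Prod>r\<leftarrow>rs. [:- r, 1:])" "length rs = n"
    "(\<Sum>i<n. resolvent z n a i i) = (\<Sum>r\<leftarrow>rs. 1 / (z - complex_of_real r))"
    using char_poly_real_symmetric[OF assms(1)] assms(2) by blast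
  have "rs \<noteq> []" using rs assms by auto
  then show ?thesis
    unfolding empirical_eigenvalue_distribution_def rs(1,3) proots_linear_factors
    by (subst integral_distr) (auto simp: integral_pmf_of_mset rs(2))
qed

section \<open>Gaussian integration by parts for the resolvent\<close>

text \<open>The resolvent identity provides the increment in exactly this factored form, so that
  differentiability reduces to continuity.\<close>

lemma has_vector_derivative_caratheodory:
  fixes f g :: "real \<Rightarrow> 'a::real_normed_vector"
  assumes "\<And>y. f y - f x = (y - x) *\<^sub>R g y" "isCont g x"
  shows "(f has_vector_derivative g x) (at x)"
  unfolding has_vector_derivative_def
proof (rule has_derivativeI_sandwich[of 1])
  show "bounded_linear (\<lambda>h. h *\<^sub>R g x)" by (rule bounded_linear_scaleR_left)
  show "((\<lambda>y. norm (g y - g x)) \<longlongrightarrow> 0) (at x)"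
    using assms(2) by (simp add: isCont_def tendsto_norm_zero LIM_zero)
  fix y assume "y \<noteq> x"
  then show "norm (f y - f x - (y - x) *\<^sub>R g x) / norm (y - x) \<le> norm (g y - g x)"
    unfolding assms(1) scaleR_diff_right[symmetric] norm_scaleR by simp
qed simp

abbreviation std_normal :: "real measure" where
  "std_normal \<equiv> density lborel std_normal_density"

lemma integrable_id_std_normal: "integrable std_normal (\<lambda>y. y)"
  using integrable_std_normal_moment[of 1] by (simp add: integrable_density normal_density_nonneg)

text \<open>The density \<open>\<phi>\<close> satisfies \<open>\<phi>' y = - y * \<phi> y\<close>.
  The fundamental theorem of calculus is applied to \<open>\<phi> * F\<close> on the whole line; it
  vanishes at both ends because \<open>F\<close> is bounded.\<close>

lemma integral_std_normal_by_parts: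
  fixes F F' :: "real \<Rightarrow> complex"
  assumes F: "\<And>y. (F has_vector_derivative F' y) (at y)" and F': "\<And>y. isCont F' y"
    and B: "\<And>y. norm (F y) \<le> B" and B': "\<And>y. norm (F' y) \<le> B'"
  shows "(LINT y|std_normal. y *\<^sub>R F y) = (LINT y|std_normal. F' y)"
proof -
  let ?\<phi> = std_normal_density
  let ?h = "\<lambda>y. ?\<phi> y *\<^sub>R F y" and ?h' = "\<lambda>y. ?\<phi> y *\<^sub>R F' y - (?\<phi> y * y) *\<^sub>R F y"
  have contF: "isCont F y" for y using F has_vector_derivative_continuous by blast
  have [measurable]: "F \<in> borel_measurable borel" "F' \<in> borel_measurable borel"
    using contF F' by (auto intro!: borel_measurable_continuous_onI continuous_at_imp_continuous_on)
  have d\<phi>: "(?\<phi> has_real_derivative - (?\<phi> y * y)) (at y)" for y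
    unfolding std_normal_density_def[abs_def]
    by (auto intro!: derivative_eq_intros simp: field_simps)
  have contphi: "isCont ?\<phi> y" for y using d\<phi> DERIV_isCont by blast
  have 1: "integrable lborel (\<lambda>y. ?\<phi> y *\<^sub>R F' y)"
  proof (rule Bochner_Integration.integrable_bound)
    show "integrable lborel (\<lambda>y. B' * (?\<phi> y * y ^ 0))"
      using integrable_std_normal_moment[of 0] by (intro integrable_mult_right)
    show "AE y in lborel. norm (?\<phi> y *\<^sub>R F' y) \<le> norm (B' * (?\<phi> y * y ^ 0))"
      using order_trans[OF norm_ge_zero B'] by (auto simp: abs_mult mult.commute intro!: AE_I2 mult_mono B')
  qed measurable
  have 2: "integrable lborel (\<lambda>y. (?\<phi> y * y) *\<^sub>R F y)"
  proof (rule Bochner_Integration.integrable_bound)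
    show "integrable lborel (\<lambda>y. B * (?\<phi> y * y ^ 1))"
      using integrable_std_normal_moment[of 1] by (intro integrable_mult_right)
    show "AE y in lborel. norm ((?\<phi> y * y) *\<^sub>R F y) \<le> norm (B * (?\<phi> y * y ^ 1))"
    proof (rule AE_I2)
      fix y
      have "norm (F y) * \<bar>?\<phi> y * y\<bar> \<le> \<bar>B\<bar> * \<bar>?\<phi> y * y\<bar>"
        using B[of y] by (intro mult_right_mono) auto
      then show "norm ((?\<phi> y * y) *\<^sub>R F y) \<le> norm (B * (?\<phi> y * y ^ 1))"
        by (simp only: norm_scaleR real_norm_def abs_mult power_one_right mult_ac)
    qed
  qed measurable
  have lim: "(?h \<longlongrightarrow> 0) G" if "(?\<phi> \<longlongrightarrow> 0) G" for G
  proof (rule Lim_null_comparison)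
    show "eventually (\<lambda>y. norm (?h y) \<le> ?\<phi> y * B) G"
      by (auto intro!: always_eventually mult_left_mono B normal_density_nonneg simp: abs_of_nonneg normal_density_nonneg)
    show "((\<lambda>y. ?\<phi> y * B) \<longlongrightarrow> 0) G" using that by (rule tendsto_mult_left_zero)
  qed
  have "(LBINT y=-\<infinity>..\<infinity>. ?h' y) = 0 - 0"
  proof (rule interval_integral_FTC_integrable)
    fix y
    show "(?h has_vector_derivative ?h' y) (at y)"
      using d\<phi>[of y] F[of y]
      by (auto intro!: derivative_eq_intros simp: has_real_derivative_iff_has_vector_derivative)
    show "isCont ?h' y" using contF F' contphi by (intro continuous_intros) auto
  next
    show "set_integrable lborel (einterval (-\<infinity>) \<infinity>) ?h'"
      using 1 2 by (simp add: set_integrable_def)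
    have "((\<lambda>y. (1 / sqrt (2 * pi)) * exp (- y\<^sup>2 / 2)) \<longlongrightarrow> (0::real)) at_bot" by real_asymp
    then show "((?h \<circ> real_of_ereal) \<longlongrightarrow> 0) (at_right (-\<infinity>))"
      unfolding ereal_tendsto_simps1 by (intro lim) (simp add: std_normal_density_def[abs_def])
    have "((\<lambda>y. (1 / sqrt (2 * pi)) * exp (- y\<^sup>2 / 2)) \<longlongrightarrow> (0::real)) at_top" by real_asymp
    then show "((?h \<circ> real_of_ereal) \<longlongrightarrow> 0) (at_left \<infinity>)"
      unfolding ereal_tendsto_simps1 by (intro lim) (simp add: std_normal_density_def[abs_def])
  qed simp
  then have "(LINT y|lborel. ?h' y) = 0"
    by (simp add: interval_lebesgue_integral_def set_lebesgue_integral_def)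
  then have "(LINT y|lborel. ?\<phi> y *\<^sub>R F' y) = (LINT y|lborel. (?\<phi> y * y) *\<^sub>R F y)"
    using 1 2 by simp
  then show ?thesis
    by (simp add: integral_density normal_density_nonneg)
qed

text \<open>Fubini isolates the coordinate \<open>e\<close>; the hypotheses speak of updates
  \<open>y(e := h)\<close> because the inner integral runs over \<open>h\<close>.\<close>

lemma integral_PiM_std_normal_by_parts:
  fixes F F' :: "('e \<Rightarrow> real) \<Rightarrow> complex" and K :: "'e set"
  defines "\<Omega> \<equiv> PiM K (\<lambda>_. std_normal)"
  assumes K: "finite K" "e \<in> K"
    and F: "\<And>y h. ((\<lambda>h. F (y(e := h))) has_vector_derivative F' (y(e := h))) (at h)"
    and F': "\<And>y h. isCont (\<lambda>h. F' (y(e := h))) h"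
    and B: "\<And>y. norm (F y) \<le> B" and B': "\<And>y. norm (F' y) \<le> B'"
    and meas: "F \<in> borel_measurable \<Omega>" "F' \<in> borel_measurable \<Omega>"
  shows "integrable \<Omega> (\<lambda>y. y e *\<^sub>R F y)" "(LINT y|\<Omega>. y e *\<^sub>R F y) = (LINT y|\<Omega>. F' y)"
proof -
  interpret N: prob_space std_normal by (rule prob_space_normal_density) simp
  interpret P: product_sigma_finite "\<lambda>_::'e. std_normal" ..
  interpret PP: prob_space \<Omega> unfolding \<Omega>_def by (intro prob_space_PiM N.prob_space_axioms)
  have proj: "distr \<Omega> std_normal (\<lambda>y. y e) = std_normal"
    unfolding \<Omega>_def by (rule distr_PiM_component) (auto intro: N.prob_space_axioms K)
  have m: "(\<lambda>y. y e) \<in> \<Omega> \<rightarrow>\<^sub>M std_normal"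
    unfolding \<Omega>_def using K by (intro measurable_component_singleton)
  have "integrable (distr \<Omega> std_normal (\<lambda>y. y e)) (\<lambda>y. y)" unfolding proj by (rule integrable_id_std_normal)
  then have int1: "integrable \<Omega> (\<lambda>y. y e)" by (rule integrable_distr[OF m])
  show int: "integrable \<Omega> (\<lambda>y. y e *\<^sub>R F y)"
  proof (rule Bochner_Integration.integrable_bound)
    show "integrable \<Omega> (\<lambda>y. B * y e)" using int1 by simp
    show "AE y in \<Omega>. norm (y e *\<^sub>R F y) \<le> norm (B * y e)"
    proof (rule AE_I2)
      fix y
      have "norm (F y) * \<bar>y e\<bar> \<le> \<bar>B\<bar> * \<bar>y e\<bar>" using B[of y] by (intro mult_right_mono) auto
      then show "norm (y e *\<^sub>R F y) \<le> norm (B * y e)" by (simp add: abs_mult mult.commute)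
    qed
    show "(\<lambda>y. y e *\<^sub>R F y) \<in> borel_measurable \<Omega>" using int1 meas(1) by (intro borel_measurable_scaleR) auto
  qed
  have int': "integrable \<Omega> F'"
    by (rule PP.integrable_const_bound[of _ B']) (auto intro: B' meas)
  let ?J = "K - {e}"
  have KJ: "K = insert e ?J" and J: "finite ?J" "e \<notin> ?J" using K by auto
  have 1: "(LINT y|\<Omega>. f y) = (LINT x|PiM ?J (\<lambda>_. std_normal). LINT h|std_normal. f (x(e := h)))"
    if "integrable \<Omega> f" for f :: "('e \<Rightarrow> real) \<Rightarrow> complex"
    using P.product_integral_insert[OF J, of f] that unfolding \<Omega>_def KJ[symmetric] by simp
  have "(LINT y|\<Omega>. y e *\<^sub>R F y) =
      (LINT x|PiM ?J (\<lambda>_. std_normal). LINT h|std_normal. h *\<^sub>R F (x(e := h)))"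
    using 1[OF int] by simp
  also have "\<dots> = (LINT x|PiM ?J (\<lambda>_. std_normal). LINT h|std_normal. F' (x(e := h)))"
    by (intro Bochner_Integration.integral_cong refl integral_std_normal_by_parts[where B = B and B' = B'])
       (auto intro: F F' B B')
  also have "\<dots> = (LINT y|\<Omega>. F' y)" using 1[OF int'] by simp
  finally show "(LINT y|\<Omega>. y e *\<^sub>R F y) = (LINT y|\<Omega>. F' y)" .
qed

text \<open>\<open>e i j\<close> names the Gaussian variable at position \<open>(i, j)\<close>; by
  \<open>edge\<close> it amounts to an unordered pair. The bound on \<open>Im z\<close> makes
  resolvent entries at most 1/2, which beats the number of derivative terms of a long product; the
  bound on \<open>norm z\<close> makes the hierarchy of moments contractive.\<close>

locale gaussian_profile =
  fixes n :: nat and e :: "nat \<Rightarrow> nat \<Rightarrow> 'e" and s :: "nat \<Rightarrow> nat \<Rightarrow> real" and S :: real and z :: complex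
  assumes n: "n > 0"
    and edge: "\<And>i j k l. i < n \<Longrightarrow> j < n \<Longrightarrow> k < n \<Longrightarrow> l < n \<Longrightarrow>
      e i j = e k l \<longleftrightarrow> i = k \<and> j = l \<or> i = l \<and> j = k"
    and s_sym: "\<And>i j. i < n \<Longrightarrow> j < n \<Longrightarrow> s i j = s j i"
    and s_bound: "\<And>i j. i < n \<Longrightarrow> j < n \<Longrightarrow> 0 \<le> s i j \<and> s i j \<le> S"
    and z: "\<bar>Im z\<bar> \<ge> 2" "norm z \<ge> 2 * (1 + S)"
begin

definition w :: "nat \<Rightarrow> nat \<Rightarrow> real" where
  "w i j = sqrt ((1 + of_bool (i = j)) * s i j / n)"

definition K :: "'e set" where "K = (\<lambda>(i, j). e i j) ` ({..<n} \<times> {..<n})"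

definition X :: "('e \<Rightarrow> real) \<Rightarrow> nat \<Rightarrow> nat \<Rightarrow> real" where "X y i j = w i j * y (e i j)"

definition G :: "('e \<Rightarrow> real) \<Rightarrow> nat \<Rightarrow> nat \<Rightarrow> complex" where "G y = resolvent z n (X y)"

text \<open>The derivative of the matrix \<open>X y\<close> with respect to the variable
  \<open>e i j\<close>: it has two entries for \<open>i \<noteq> j\<close> but only one for
  \<open>i = j\<close>.\<close>

definition E :: "nat \<Rightarrow> nat \<Rightarrow> nat \<Rightarrow> nat \<Rightarrow> real" where
  "E i j a b = (if e a b = e i j then w a b else 0)"

definition dG :: "nat \<Rightarrow> nat \<Rightarrow> nat \<Rightarrow> nat \<Rightarrow> ('e \<Rightarrow> real) \<Rightarrow> complex" where
  "dG i j k l y = (\<Sum>a<n. \<Sum>b<n. G y k a * of_real (E i j a b) * G y b l)"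

text \<open>Lists rather than sets, since the recursion prepends arbitrary indices and repetitions
  occur.\<close>

definition P :: "nat list \<Rightarrow> ('e \<Rightarrow> real) \<Rightarrow> complex" where
  "P L y = (\<Prod>k\<leftarrow>L. G y k k)"

fun dP :: "nat \<Rightarrow> nat \<Rightarrow> nat list \<Rightarrow> ('e \<Rightarrow> real) \<Rightarrow> complex" where
  "dP i j [] y = 0"
| "dP i j (k # L) y = dG i j k k y * P L y + G y k k * dP i j L y"

abbreviation \<Omega> :: "('e \<Rightarrow> real) measure" where "\<Omega> \<equiv> PiM K (\<lambda>_. std_normal)"

definition U :: "nat list \<Rightarrow> complex" where "U L = (LINT y|\<Omega>. P L y)"

definition q :: real where "q = 1 / \<bar>Im z\<bar>"

lemma Imz: "Im z \<noteq> 0" using z by auto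

lemma q: "0 < q" "q \<le> 1 / 2" using z by (auto simp: q_def field_simps)

lemma S0: "S \<ge> 0" using s_bound[of 0 0] n by simp

lemma finite_K: "finite K" by (simp add: K_def)

lemma e_in_K: "i < n \<Longrightarrow> j < n \<Longrightarrow> e i j \<in> K" by (auto simp: K_def)

lemma w_sym: "i < n \<Longrightarrow> j < n \<Longrightarrow> w i j = w j i" using s_sym by (auto simp: w_def)

lemma e_sym: "i < n \<Longrightarrow> j < n \<Longrightarrow> e i j = e j i" using edge by simp

lemma w_square: "i < n \<Longrightarrow> j < n \<Longrightarrow> w i j * w i j = (1 + of_bool (i = j)) * s i j / n"
  using s_bound by (simp add: w_def)

lemma X_symmetric: "symmetric_on n (X y)"
  unfolding symmetric_on_def X_def using w_sym e_sym by simp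

lemma G_symmetric: "k < n \<Longrightarrow> l < n \<Longrightarrow> G y k l = G y l k"
  unfolding G_def by (rule resolvent_symmetric[OF X_symmetric Imz])

lemma G_bound: "k < n \<Longrightarrow> l < n \<Longrightarrow> norm (G y k l) \<le> q"
  unfolding G_def q_def by (rule resolvent_bound[OF X_symmetric Imz])

lemma G_column_bound: "j < n \<Longrightarrow> (\<Sum>i<n. (norm (G y i j))\<^sup>2) \<le> q\<^sup>2"
  using resolvent_column_bound[OF X_symmetric Imz] unfolding G_def q_def
  by (simp add: power_divide)

lemma G_dyson: "i < n \<Longrightarrow> j < n \<Longrightarrow> z * G y i j = (if i = j then 1 else 0) + (\<Sum>k<n. of_real (X y i k) * G y k j)"
  unfolding G_def by (rule resolvent_dyson[OF X_symmetric Imz])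

lemma X_update: "X (y(e i j := h')) a b - X (y(e i j := h)) a b = (h' - h) * E i j a b"
  by (simp add: X_def E_def algebra_simps)

text \<open>An exact increment, with one resolvent at \<open>h'\<close> and the other at
  \<open>h\<close>. Together with the uniform bound on entries it yields continuity first and then
  the derivative.\<close>

lemma G_update_difference:
  assumes "i < n" "j < n" "k < n" "l < n"
  shows "G (y(e i j := h')) k l - G (y(e i j := h)) k l =
    (h' - h) *\<^sub>R (\<Sum>a<n. \<Sum>b<n. G (y(e i j := h')) k a * of_real (E i j a b) * G (y(e i j := h)) b l)"
proof -
  have "G (y(e i j := h')) k l - G (y(e i j := h)) k l =
    (\<Sum>a<n. \<Sum>b<n. G (y(e i j := h')) k a * of_real ((h' - h) * E i j a b) * G (y(e i j := h)) b l)"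
    unfolding G_def resolvent_difference[OF X_symmetric X_symmetric Imz assms(3,4)]
    using assms by (intro sum.cong refl) (simp add: X_update)
  also have "\<dots> = (h' - h) *\<^sub>R (\<Sum>a<n. \<Sum>b<n. G (y(e i j := h')) k a * of_real (E i j a b) * G (y(e i j := h)) b l)"
    unfolding scaleR_conv_of_real sum_distrib_left by (intro sum.cong refl) (simp add: mult_ac)
  finally show ?thesis .
qed

lemma G_continuous:
  assumes "i < n" "j < n" "k < n" "l < n"
  shows "isCont (\<lambda>h. G (y(e i j := h)) k l) h"
proof -
  let ?C = "\<Sum>a<n. \<Sum>b<n. q * \<bar>E i j a b\<bar> * q"
  have "norm (G (y(e i j := h')) k l - G (y(e i j := h)) k l) \<le> \<bar>h' - h\<bar> * ?C" for h'
  proof -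
    have "norm (\<Sum>a<n. \<Sum>b<n. G (y(e i j := h')) k a * of_real (E i j a b) * G (y(e i j := h)) b l) \<le> ?C"
      using assms q
      by (intro sum_norm_le) (auto simp: norm_mult intro!: mult_mono G_bound)
    then show ?thesis
      unfolding G_update_difference[OF assms] norm_scaleR real_norm_def by (intro mult_left_mono) auto
  qed
  then have 1: "eventually (\<lambda>h'. norm (G (y(e i j := h')) k l - G (y(e i j := h)) k l) \<le> \<bar>h' - h\<bar> * ?C) (at h)"
    by (rule always_eventually[OF allI])
  have 2: "((\<lambda>h'. \<bar>h' - h\<bar> * ?C) \<longlongrightarrow> 0) (at h)"
    by (intro tendsto_mult_left_zero tendsto_rabs_zero LIM_zero tendsto_ident_at)
  show ?thesis
    unfolding isCont_def by (rule LIM_zero_cancel, rule Lim_null_comparison[OF 1 2])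
qed

lemma G_derivative:
  assumes "i < n" "j < n" "k < n" "l < n"
  shows "((\<lambda>h. G (y(e i j := h)) k l) has_vector_derivative dG i j k l (y(e i j := h))) (at h)"
proof -
  let ?g = "\<lambda>h'. \<Sum>a<n. \<Sum>b<n. G (y(e i j := h')) k a * of_real (E i j a b) * G (y(e i j := h)) b l"
  have "((\<lambda>h. G (y(e i j := h)) k l) has_vector_derivative ?g h) (at h)"
  proof (rule has_vector_derivative_caratheodory[where g = ?g])
    show "isCont ?g h"
      by (intro continuous_sum continuous_mult continuous_const G_continuous assms)
        (simp_all only: lessThan_iff assms)
  qed (rule G_update_difference[OF assms])
  then show ?thesis by (simp only: dG_def)
qed

lemma dG_continuous:
  assumes "i < n" "j < n" "k < n" "l < n"
  shows "isCont (\<lambda>h. dG i j k l (y(e i j := h))) h"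
  unfolding dG_def
  by (intro continuous_sum continuous_mult continuous_const G_continuous assms)
    (simp_all only: lessThan_iff assms)

lemma P_simps [simp]: "P [] y = 1" "P (k # L) y = G y k k * P L y" by (simp_all add: P_def)

lemma P_derivative:
  assumes "i < n" "j < n" "set L \<subseteq> {..<n}"
  shows "((\<lambda>h. P L (y(e i j := h))) has_vector_derivative dP i j L (y(e i j := h))) (at h)"
  using assms(3)
proof (induction L)
  case (Cons k L)
  then have "k < n" "set L \<subseteq> {..<n}" by simp_all
  then have "((\<lambda>h. G (y(e i j := h)) k k * P L (y(e i j := h))) has_vector_derivative
      (G (y(e i j := h)) k k * dP i j L (y(e i j := h)) + dG i j k k (y(e i j := h)) * P L (y(e i j := h)))) (at h)"
    by (intro has_vector_derivative_mult G_derivative Cons.IH assms)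
  then show ?case by (simp only: P_simps dP.simps add.commute)
qed (simp add: has_vector_derivative_const)

lemma P_continuous:
  assumes "i < n" "j < n" "set L \<subseteq> {..<n}"
  shows "isCont (\<lambda>h. P L (y(e i j := h))) h"
  using P_derivative[OF assms] has_vector_derivative_continuous by blast

lemma dP_continuous:
  assumes "i < n" "j < n" "set L \<subseteq> {..<n}"
  shows "isCont (\<lambda>h. dP i j L (y(e i j := h))) h"
  using assms(3)
proof (induction L)
  case (Cons k L)
  then have "k < n" "set L \<subseteq> {..<n}" by simp_all
  then show ?case unfolding dP.simps
    by (intro continuous_add continuous_mult G_continuous dG_continuous P_continuous Cons.IH assms)
qed simp

lemma P_bound: "set L \<subseteq> {..<n} \<Longrightarrow> norm (P L y) \<le> q ^ length L"
proof (induction L)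
  case (Cons k L)
  then show ?case using q by (auto simp: norm_mult intro!: mult_mono G_bound)
qed simp

lemma dG_bound:
  assumes "k < n" "l < n"
  shows "norm (dG i j k l y) \<le> (\<Sum>a<n. \<Sum>b<n. q * \<bar>E i j a b\<bar> * q)"
  unfolding dG_def using assms q
  by (intro sum_norm_le) (auto simp: norm_mult intro!: mult_mono G_bound)

lemma dP_bounded:
  assumes "set L \<subseteq> {..<n}"
  shows "\<exists>B. \<forall>y. norm (dP i j L y) \<le> B"
  using assms
proof (induction L)
  case (Cons k L)
  then obtain B where B: "\<And>y. norm (dP i j L y) \<le> B" by auto
  let ?C = "\<Sum>a<n. \<Sum>b<n. q * \<bar>E i j a b\<bar> * q"
  have "norm (dP i j (k # L) y) \<le> ?C * q ^ length L + q * B" for y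
  proof -
    have "norm (dG i j k k y * P L y) \<le> ?C * q ^ length L"
      unfolding norm_mult using Cons.prems q
      by (intro mult_mono dG_bound P_bound sum_nonneg) auto
    moreover have "norm (G y k k * dP i j L y) \<le> q * B"
      unfolding norm_mult using Cons.prems q
      by (intro mult_mono G_bound B) auto
    ultimately show ?thesis by (auto intro: norm_triangle_le)
  qed
  then show ?case by blast
qed auto

lemma G_measurable [measurable]:
  assumes "k < n" "l < n"
  shows "(\<lambda>y. G y k l) \<in> borel_measurable \<Omega>"
  unfolding G_def
proof (rule measurable_resolvent[OF _ assms])
  fix i j assume "i < n" "j < n"
  then have "(\<lambda>y. y (e i j)) \<in> \<Omega> \<rightarrow>\<^sub>M std_normal"
    by (intro measurable_component_singleton e_in_K)
  then have "(\<lambda>y. y (e i j)) \<in> borel_measurable \<Omega>" by (simp cong: measurable_cong_sets)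
  then show "(\<lambda>y. X y i j) \<in> borel_measurable \<Omega>" unfolding X_def by simp
qed

lemma P_measurable: "set L \<subseteq> {..<n} \<Longrightarrow> P L \<in> borel_measurable \<Omega>"
  unfolding P_def by (induction L) (auto intro!: borel_measurable_times G_measurable)

lemma dG_measurable: "k < n \<Longrightarrow> l < n \<Longrightarrow> dG i j k l \<in> borel_measurable \<Omega>"
  unfolding dG_def
  by (intro borel_measurable_sum borel_measurable_times borel_measurable_const G_measurable) auto

lemma dP_measurable: "set L \<subseteq> {..<n} \<Longrightarrow> dP i j L \<in> borel_measurable \<Omega>"
proof (induction L)
  case (Cons k L)
  then have "(\<lambda>y. dG i j k k y * P L y + G y k k * dP i j L y) \<in> borel_measurable \<Omega>"
    by (intro borel_measurable_add borel_measurable_times dG_measurable P_measurable G_measurable) auto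
  then show ?case by (simp add: fun_eq_iff cong: measurable_cong)
next
  case Nil
  have "dP i j [] = (\<lambda>_. 0)" by (rule ext) simp
  then show ?case by simp
qed

lemma prob_space_\<Omega>: "prob_space \<Omega>"
  by (intro prob_space_PiM prob_space_normal_density) simp

lemma sum_pair_delta:
  fixes f :: "nat \<Rightarrow> nat \<Rightarrow> complex"
  assumes "i < n" "j < n"
  shows "(\<Sum>a<n. \<Sum>b<n. if a = i \<and> b = j then f a b else 0) = f i j"
proof -
  have "(\<Sum>b<n. if a = i \<and> b = j then f a b else 0) = (if a = i then f i j else 0)" for a
    using assms by (cases "a = i") simp_all
  then show ?thesis using assms by simp
qed

text \<open>Off the diagonal the two entries of \<open>E\<close> give the two terms. On the diagonal
  \<open>E\<close> has a single entry, but the square of \<open>w i i\<close> carries the factor 2;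
  the doubled variance there makes the formula uniform.\<close>

lemma weighted_dG:
  assumes "i < n" "j < n" "k < n" "l < n"
  shows "of_real (w i j) * dG i j k l y =
    of_real (s i j / n) * (G y k i * G y j l + G y k j * G y i l)"
proof -
  let ?f = "\<lambda>a b. G y k a * of_real (w a b) * G y b l"
  have "G y k a * of_real (E i j a b) * G y b l = (if a = i \<and> b = j then ?f a b else 0) +
     (if a = j \<and> b = i then (if i \<noteq> j then ?f a b else 0) else 0)" if "a < n" "b < n" for a b
  proof -
    have split: "of_real (if A \<or> B then x else 0) = (if A then of_real x else (0::complex)) +
        (if B then (if c then of_real x else 0) else 0)"
      if "A \<Longrightarrow> B \<Longrightarrow> \<not> c" "B \<Longrightarrow> \<not> A \<Longrightarrow> c" for A B c and x :: real
      using that by (cases A; cases B; cases c) simp_all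
    have "complex_of_real (E i j a b) = (if a = i \<and> b = j then of_real (w a b) else 0) +
        (if a = j \<and> b = i then (if i \<noteq> j then of_real (w a b) else 0) else 0)"
      unfolding E_def edge[OF that assms(1,2)] by (rule split) blast+
    then show ?thesis by (simp only: distrib_left distrib_right if_distrib[of "\<lambda>x. G y k a * x * G y b l"]
      if_distrib[of "\<lambda>x. G y k a * x"] if_distrib[of "\<lambda>x. x * G y b l"] mult_zero_left mult_zero_right)
  qed
  then have "dG i j k l y = (\<Sum>a<n. \<Sum>b<n. (if a = i \<and> b = j then ?f a b else 0) +
     (if a = j \<and> b = i then (if i \<noteq> j then ?f a b else 0) else 0))"
    unfolding dG_def by (intro sum.cong refl) (simp only: lessThan_iff)
  also have "\<dots> = G y k i * of_real (w i j) * G y j l + (if i \<noteq> j then G y k j * of_real (w j i) * G y i l else 0)"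
    unfolding sum.distrib using assms by (simp only: sum_pair_delta)
  finally have "of_real (w i j) * dG i j k l y =
    of_real (w i j * w i j) * (G y k i * G y j l + (if i \<noteq> j then G y k j * G y i l else 0))"
    using w_sym[OF assms(1,2)] by (simp add: algebra_simps)
  then show ?thesis unfolding w_square[OF assms(1,2)] by (auto simp: algebra_simps)
qed

lemma sum_G_product_bound:
  assumes "j < n" "k < n"
  shows "(\<Sum>i<n. norm (G y i j) * norm (G y i k)) \<le> q\<^sup>2"
proof -
  have "2 * (\<Sum>i<n. norm (G y i j) * norm (G y i k)) \<le> (\<Sum>i<n. (norm (G y i j))\<^sup>2 + (norm (G y i k))\<^sup>2)"
    unfolding sum_distrib_left using sum_squares_bound by (intro sum_mono) (simp add: mult.assoc)
  also have "\<dots> \<le> q\<^sup>2 + q\<^sup>2" unfolding sum.distrib using assms by (intro add_mono G_column_bound)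
  finally show ?thesis by simp
qed

text \<open>Differentiation replaces a factor \<open>G k k\<close> by
  \<open>2 * G k i * G j k\<close> with weight \<open>s i j / n\<close>. Summed over
  \<open>j\<close>, the products of two columns are at most \<open>q\<close> squared rather than of
  order \<open>n\<close>, so the total is of order \<open>1 / n\<close>.\<close>

lemma weighted_dP_bound:
  assumes "i < n" "set L \<subseteq> {..<n}"
  shows "(\<Sum>j<n. norm (G y j i) * norm (of_real (w i j) * dP i j L y)) \<le>
    2 * length L * (S / n) * q ^ (length L + 2)"
  using assms(2)
proof (induction L)
  case (Cons k L)
  then have k: "k < n" and L: "set L \<subseteq> {..<n}" by auto
  have "norm (G y j i) * norm (of_real (w i j) * dP i j (k # L) y) \<le>
      2 * (S / n) * q ^ Suc (length L) * (norm (G y j i) * norm (G y j k)) +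
      q * (norm (G y j i) * norm (of_real (w i j) * dP i j L y))" if j: "j < n" for j
  proof -
    have "of_real (w i j) * dP i j (k # L) y =
        of_real (w i j) * dG i j k k y * P L y + G y k k * (of_real (w i j) * dP i j L y)"
      by (simp add: algebra_simps)
    also have "of_real (w i j) * dG i j k k y = of_real (s i j / n) * (2 * G y k i * G y j k)"
      unfolding weighted_dG[OF assms(1) j k k] using G_symmetric[OF assms(1) k] G_symmetric[OF j k] by simp
    finally have "norm (of_real (w i j) * dP i j (k # L) y) \<le>
        norm (of_real (s i j / n) * (2 * G y k i * G y j k) * P L y) +
        norm (G y k k * (of_real (w i j) * dP i j L y))"
      by (simp only: norm_triangle_ineq)
    also have "norm (of_real (s i j / n) * (2 * G y k i * G y j k) * P L y) \<le>
        (S / n) * (2 * q * norm (G y j k)) * q ^ length L"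
      unfolding norm_mult using q s_bound[OF assms(1) j] n S0
      by (intro mult_mono mult_nonneg_nonneg G_bound P_bound L k assms)
        (auto simp: norm_divide divide_right_mono)
    also have "norm (G y k k * (of_real (w i j) * dP i j L y)) \<le> q * norm (of_real (w i j) * dP i j L y)"
      unfolding norm_mult[of "G y k k"] by (intro mult_right_mono G_bound k) auto
    finally have "norm (of_real (w i j) * dP i j (k # L) y) \<le>
       (S / n) * (2 * q * norm (G y j k)) * q ^ length L + q * norm (of_real (w i j) * dP i j L y)" by simp
    from mult_left_mono[OF this norm_ge_zero[of "G y j i"]] show ?thesis
      by (simp add: algebra_simps)
  qed
  then have "(\<Sum>j<n. norm (G y j i) * norm (of_real (w i j) * dP i j (k # L) y)) \<le>
      (\<Sum>j<n. 2 * (S / n) * q ^ Suc (length L) * (norm (G y j i) * norm (G y j k)) +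
      q * (norm (G y j i) * norm (of_real (w i j) * dP i j L y)))"
    by (intro sum_mono) auto
  also have "\<dots> = 2 * (S / n) * q ^ Suc (length L) * (\<Sum>j<n. norm (G y j i) * norm (G y j k)) +
      q * (\<Sum>j<n. norm (G y j i) * norm (of_real (w i j) * dP i j L y))"
    by (simp only: sum.distrib sum_distrib_left)
  also have "\<dots> \<le> 2 * (S / n) * q ^ Suc (length L) * q\<^sup>2 + q * (2 * length L * (S / n) * q ^ (length L + 2))"
    using q S0 Cons.IH[OF L] by (intro add_mono mult_left_mono sum_G_product_bound assms k) auto
  also have "\<dots> = 2 * length (k # L) * (S / n) * q ^ (length (k # L) + 2)"
    by (simp add: algebra_simps power2_eq_square)
  finally show ?case .
qed simp

text \<open>Makes the error in the recursion of moments uniform in the length of the list; the decay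
  of \<open>q ^ k\<close> absorbs the linear number of derivative terms.\<close>

lemma q_power_bound: "(1 + 2 * real k) * q ^ (k + 2) \<le> 1"
proof -
  have 1: "1 + 2 * real k \<le> 2 ^ (k + 2)"
  proof (induction k)
    case (Suc k)
    have "1 + 2 * real (Suc k) \<le> 2 ^ (k + 2) + 2 ^ 1" using Suc by simp
    also have "\<dots> \<le> 2 ^ (k + 2) + 2 ^ (k + 2)" by (intro add_left_mono power_increasing) auto
    finally show ?case by simp
  qed simp
  have "q ^ (k + 2) \<le> (1 / 2) ^ (k + 2)" using q by (intro power_mono) auto
  then have "(1 + 2 * real k) * q ^ (k + 2) \<le> 2 ^ (k + 2) * (1 / 2) ^ (k + 2)"
    using q by (intro mult_mono 1) auto
  then show ?thesis by (simp flip: power_mult_distrib)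
qed

lemma integrable_P: "set L \<subseteq> {..<n} \<Longrightarrow> integrable \<Omega> (P L)"
  by (rule finite_measure.integrable_const_bound[OF prob_space.finite_measure[OF prob_space_\<Omega>]])
    (auto intro: P_bound P_measurable)

text \<open>Expand \<open>z * G y i i\<close> by the matrix equation of the resolvent and integrate
  by parts in each \<open>y (e i j)\<close>. The derivative of \<open>G y j i\<close> yields the
  main term \<open>G j j * G i i\<close> and the square of \<open>G j i\<close>; this square and the
  derivative of \<open>P L\<close> are the errors.\<close>

lemma U_recursion:
  assumes i: "i < n" and L: "set L \<subseteq> {..<n}"
  shows "norm (z * U (i # L) - U L - (\<Sum>j<n. of_real (s i j / n) * U (j # i # L))) \<le> S / n"
proof -
  interpret prob_space \<Omega> by (rule prob_space_\<Omega>)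
  define F where "F j y = G y j i * P L y" for j y
  define F' where "F' j y = dG i j j i y * P L y + G y j i * dP i j L y" for j y
  have ibp: "integrable \<Omega> (\<lambda>y. y (e i j) *\<^sub>R F j y)" "integrable \<Omega> (F' j)"
    "(LINT y|\<Omega>. y (e i j) *\<^sub>R F j y) = (LINT y|\<Omega>. F' j y)" if j: "j < n" for j
  proof -
    obtain B where B: "\<And>y. norm (dP i j L y) \<le> B" using dP_bounded[OF L] by blast
    let ?C = "\<Sum>a<n. \<Sum>b<n. q * \<bar>E i j a b\<bar> * q"
    have 1: "norm (F j y) \<le> q * q ^ length L" for y
      unfolding F_def norm_mult using q by (intro mult_mono G_bound P_bound i j L) auto
    have 2: "norm (F' j y) \<le> ?C * q ^ length L + q * B" for y
    proof -
      have "norm (dG i j j i y * P L y) \<le> ?C * q ^ length L"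
        unfolding norm_mult using q by (intro mult_mono dG_bound P_bound sum_nonneg i j L) auto
      moreover have "norm (G y j i * dP i j L y) \<le> q * B"
        unfolding norm_mult using q by (intro mult_mono G_bound B i j) auto
      ultimately show ?thesis unfolding F'_def by (intro norm_triangle_le add_mono)
    qed
    have m: "F j \<in> borel_measurable \<Omega>" "F' j \<in> borel_measurable \<Omega>"
      unfolding F_def F'_def
      by (intro borel_measurable_add borel_measurable_times G_measurable P_measurable
          dG_measurable dP_measurable i j L)+
    have d: "((\<lambda>h. F j (y(e i j := h))) has_vector_derivative F' j (y(e i j := h))) (at h)" for y h
      unfolding F_def F'_def
      using has_vector_derivative_mult[OF G_derivative[OF i j j i] P_derivative[OF i j L]]
      by (simp only: add.commute)
    have c: "isCont (\<lambda>h. F' j (y(e i j := h))) h" for y h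
      unfolding F'_def
      by (intro continuous_add continuous_mult G_continuous dG_continuous P_continuous dP_continuous i j L)
    show "integrable \<Omega> (\<lambda>y. y (e i j) *\<^sub>R F j y)"
      "(LINT y|\<Omega>. y (e i j) *\<^sub>R F j y) = (LINT y|\<Omega>. F' j y)"
      by (rule integral_PiM_std_normal_by_parts[OF finite_K e_in_K[OF i j] d c 1 2 m])+
    show "integrable \<Omega> (F' j)" by (rule integrable_const_bound[OF _ m(2)]) (auto intro: 2)
  qed
  let ?R = "\<lambda>j y. of_real (w i j) * F' j y - of_real (s i j / n) * P (j # i # L) y"
  have iL: "set (i # L) \<subseteq> {..<n}" using i L by simp
  have jiL: "set (j # i # L) \<subseteq> {..<n}" if "j < n" for j using i L that by simp
  have "z * P (i # L) y = P L y + (\<Sum>j<n. of_real (w i j) * (y (e i j) *\<^sub>R F j y))" for y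
  proof -
    have "z * P (i # L) y = (z * G y i i) * P L y" by (simp add: mult.assoc)
    also have "\<dots> = P L y + (\<Sum>j<n. of_real (X y i j) * G y j i) * P L y"
      unfolding G_dyson[OF i i] by (simp add: distrib_right)
    also have "(\<Sum>j<n. of_real (X y i j) * G y j i) * P L y =
        (\<Sum>j<n. of_real (w i j) * (y (e i j) *\<^sub>R F j y))"
      unfolding sum_distrib_right F_def X_def
      by (intro sum.cong refl) (simp add: scaleR_conv_of_real mult_ac)
    finally show ?thesis .
  qed
  then have "z * U (i # L) = (LINT y|\<Omega>. P L y + (\<Sum>j<n. of_real (w i j) * (y (e i j) *\<^sub>R F j y)))"
    unfolding U_def using integrable_P[OF iL] by (simp flip: integral_mult_right_zero)
  also have "\<dots> = U L + (LINT y|\<Omega>. (\<Sum>j<n. of_real (w i j) * (y (e i j) *\<^sub>R F j y)))"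
    unfolding U_def by (intro Bochner_Integration.integral_add integrable_P L
      Bochner_Integration.integrable_sum integrable_mult_right ibp(1)) simp
  also have "(LINT y|\<Omega>. (\<Sum>j<n. of_real (w i j) * (y (e i j) *\<^sub>R F j y))) =
      (\<Sum>j<n. LINT y|\<Omega>. of_real (w i j) * (y (e i j) *\<^sub>R F j y))"
    by (intro Bochner_Integration.integral_sum integrable_mult_right ibp(1)) simp
  also have "\<dots> = (\<Sum>j<n. of_real (w i j) * (LINT y|\<Omega>. y (e i j) *\<^sub>R F j y))"
    by (simp only: integral_mult_right_zero)
  also have "(\<Sum>j<n. of_real (w i j) * (LINT y|\<Omega>. y (e i j) *\<^sub>R F j y)) =
      (\<Sum>j<n. of_real (w i j) * (LINT y|\<Omega>. F' j y))"
    using ibp(3) by (intro sum.cong refl) simp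
  finally have "z * U (i # L) - U L - (\<Sum>j<n. of_real (s i j / n) * U (j # i # L)) =
      (\<Sum>j<n. of_real (w i j) * (LINT y|\<Omega>. F' j y)) - (\<Sum>j<n. of_real (s i j / n) * U (j # i # L))"
    by simp
  also have "\<dots> = (LINT y|\<Omega>. (\<Sum>j<n. ?R j y))"
    unfolding U_def sum_subtractf[symmetric]
    using integrable_P[OF jiL] ibp(2)
    by (subst Bochner_Integration.integral_sum) (auto simp del: P_simps)
  finally have eq: "z * U (i # L) - U L - (\<Sum>j<n. of_real (s i j / n) * U (j # i # L)) =
    (LINT y|\<Omega>. (\<Sum>j<n. ?R j y))" .
  have bound: "norm (\<Sum>j<n. ?R j y) \<le> S / n" for y
  proof -
    have summand: "norm (?R j y) \<le>
        (S / n) * q ^ length L * (norm (G y j i))\<^sup>2 +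
        norm (G y j i) * norm (of_real (w i j) * dP i j L y)" if j: "j < n" for j
    proof -
      have "?R j y =
          (of_real (w i j) * dG i j j i y) * P L y + G y j i * (of_real (w i j) * dP i j L y)
          - of_real (s i j / n) * P (j # i # L) y"
        by (simp add: F'_def algebra_simps)
      also have "\<dots> = of_real (s i j / n) * P L y * (G y j i)\<^sup>2 + G y j i * (of_real (w i j) * dP i j L y)"
        unfolding weighted_dG[OF i j j i] by (simp add: power2_eq_square algebra_simps)
      finally have "norm (?R j y) \<le>
          norm (of_real (s i j / n) * P L y * (G y j i)\<^sup>2) + norm (G y j i * (of_real (w i j) * dP i j L y))"
        by (simp only: norm_triangle_ineq)
      also have "norm (of_real (s i j / n) * P L y * (G y j i)\<^sup>2) \<le> (S / n) * q ^ length L * (norm (G y j i))\<^sup>2"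
        unfolding norm_mult norm_power using s_bound[OF i j] S0 q
        by (intro mult_right_mono mult_mono P_bound L) (auto simp: norm_divide divide_right_mono)
      finally show ?thesis by (simp only: norm_mult)
    qed
    have "norm (\<Sum>j<n. ?R j y) \<le>
        (\<Sum>j<n. (S / n) * q ^ length L * (norm (G y j i))\<^sup>2 +
        norm (G y j i) * norm (of_real (w i j) * dP i j L y))"
      using summand by (intro sum_norm_le) simp
    also have "\<dots> = (S / n) * q ^ length L * (\<Sum>j<n. (norm (G y j i))\<^sup>2) +
        (\<Sum>j<n. norm (G y j i) * norm (of_real (w i j) * dP i j L y))"
      by (simp only: sum.distrib sum_distrib_left)
    also have "\<dots> \<le> (S / n) * q ^ length L * q\<^sup>2 + 2 * length L * (S / n) * q ^ (length L + 2)"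
      using S0 q by (intro add_mono mult_left_mono G_column_bound weighted_dP_bound i L) auto
    also have "\<dots> = (S / n) * ((1 + 2 * real (length L)) * q ^ (length L + 2))"
      by (simp add: power_add power2_eq_square algebra_simps)
    also have "\<dots> \<le> (S / n) * 1" using S0 by (intro mult_left_mono q_power_bound) auto
    finally show ?thesis by simp
  qed
  have "norm (LINT y|\<Omega>. (\<Sum>j<n. ?R j y)) \<le>
      (LINT y|\<Omega>. norm (\<Sum>j<n. ?R j y))"
    by (rule integral_norm_bound)
  also have "\<dots> \<le> S / n"
    using integrable_P[OF jiL] ibp(2) bound
    by (intro integral_le_const integrable_norm Bochner_Integration.integrable_sum
        Bochner_Integration.integrable_diff integrable_mult_right AE_I2) (auto simp del: P_simps)
  finally show ?thesis unfolding eq .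
qed

text \<open>The recursion of the moments \<open>U L\<close> is contractive, and products of \<open>\<Psi>\<close> nearly satisfy it;
  this replaces a concentration estimate for the diagonal entries of the resolvent.\<close>

lemma expected_resolvent_approximation:
  assumes \<Psi>: "\<And>i. i < n \<Longrightarrow> norm (\<Psi> i) \<le> 1"
    and eq: "\<And>i. i < n \<Longrightarrow> norm (z * \<Psi> i - 1 - \<Psi> i * (\<Sum>j<n. of_real (s i j / n) * \<Psi> j)) \<le> \<delta>"
    and i: "i < n"
  shows "norm ((LINT y|\<Omega>. G y i i) - \<Psi> i) \<le> \<delta> + S / n"
proof -
  define V where "V L = (\<Prod>k\<leftarrow>L. \<Psi> k)" for L
  define A where "A = {L. set L \<subseteq> {..<n}}"
  have V1: "norm (V L) \<le> 1" if "L \<in> A" for L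
    using that unfolding A_def V_def
    by (induction L) (auto simp: norm_mult intro!: mult_le_one \<Psi>)
  have U1: "norm (U L) \<le> 1" if "L \<in> A" for L
  proof -
    interpret prob_space \<Omega> by (rule prob_space_\<Omega>)
    have L: "set L \<subseteq> {..<n}" using that by (simp add: A_def)
    have "norm (U L) \<le> (LINT y|\<Omega>. norm (P L y))" unfolding U_def by (rule integral_norm_bound)
    also have "\<dots> \<le> 1"
      using P_bound[OF L] power_le_one[of q "length L"] q
      by (intro integral_le_const integrable_norm integrable_P L AE_I2) (auto intro: order_trans)
    finally show ?thesis .
  qed
  \<comment> \<open>The recursion for a list involves lists longer by one, so no finite length
    closes up; the supremum over all lists does. It is finite since both kinds of moments have norm
    at most 1.\<close>
  define D where "D = (SUP L\<in>A. norm (U L - V L))"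
  have "bdd_above ((\<lambda>L. norm (U L - V L)) ` A)"
  proof (rule bdd_aboveI2)
    fix L assume "L \<in> A"
    then show "norm (U L - V L) \<le> 1 + 1" using U1 V1 by (intro norm_triangle_le_diff add_mono)
  qed
  then have D: "norm (U L - V L) \<le> D" if "L \<in> A" for L
    unfolding D_def using that by (intro cSUP_upper)
  have S: "0 \<le> S" by (rule S0)
  have "D \<ge> 0" by (rule order_trans[OF norm_ge_zero D[of "[]"]]) (simp add: A_def)
  have \<delta>: "0 \<le> \<delta>" using order_trans[OF norm_ge_zero eq[OF i]] .
  \<comment> \<open>For a nonempty list, subtracting the two recursions bounds \<open>norm z\<close>
    times the discrepancy by \<open>(1 + S) * D\<close> plus errors, and
    \<open>norm z \<ge> 2 * (1 + S)\<close>. The empty list has no discrepancy.\<close>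
  have step: "norm (U L - V L) \<le> D / 2 + (\<delta> + S / n) / 2" if "L \<in> A" for L
  proof (cases L)
    case Nil
    interpret prob_space \<Omega> by (rule prob_space_\<Omega>)
    have "U [] = 1" "V [] = 1" by (auto simp: U_def V_def prob_space)
    then show ?thesis using Nil \<open>D \<ge> 0\<close> \<delta> S by simp
  next
    case (Cons i L')
    then have i: "i < n" and L': "set L' \<subseteq> {..<n}" using that by (auto simp: A_def)
    let ?\<Delta> = "\<Sum>j<n. of_real (s i j / n) * (U (j # i # L') - V (j # i # L'))"
    let ?\<epsilon>1 = "z * U (i # L') - U L' - (\<Sum>j<n. of_real (s i j / n) * U (j # i # L'))"
    let ?\<epsilon>2 = "V L' * (z * \<Psi> i - 1 - \<Psi> i * (\<Sum>j<n. of_real (s i j / n) * \<Psi> j))"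
    have V2: "?\<epsilon>2 = z * V (i # L') - V L' - (\<Sum>j<n. of_real (s i j / n) * V (j # i # L'))"
    proof -
      have Vc: "V (k # L) = \<Psi> k * V L" for k L by (simp add: V_def)
      have "(\<Sum>j<n. of_real (s i j / n) * V (j # i # L')) =
          V L' * (\<Psi> i * (\<Sum>j<n. of_real (s i j / n) * \<Psi> j))"
        unfolding Vc sum_distrib_left by (intro sum.cong refl) (simp add: mult_ac)
      then show ?thesis by (simp add: Vc right_diff_distrib mult_ac)
    qed
    have "z * (U (i # L') - V (i # L')) = (U L' - V L') +
        ?\<Delta> + ?\<epsilon>1 - ?\<epsilon>2"
      by (subst V2) (simp add: right_diff_distrib sum_subtractf)
    then have "norm z * norm (U (i # L') - V (i # L')) = norm ((U L' - V L') +
        ?\<Delta> + ?\<epsilon>1 - ?\<epsilon>2)"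
      by (metis norm_mult)
    also have "\<dots> \<le> norm (U L' - V L') +
        norm ?\<Delta> + norm ?\<epsilon>1 + norm ?\<epsilon>2"
    proof -
      have "norm (a + b + c - d) \<le> norm a + norm b + norm c + norm d" for a b c d :: complex
        using norm_triangle_ineq4[of "a + b + c" d] norm_triangle_ineq[of "a + b" c]
          norm_triangle_ineq[of a b] by linarith
      then show ?thesis .
    qed
    also have "\<dots> \<le> D + S * D + S / n + \<delta>"
    proof (intro add_mono)
      show "norm (U L' - V L') \<le> D" using L' by (intro D) (simp add: A_def)
      show "norm ?\<epsilon>1 \<le> S / n" by (rule U_recursion[OF i L'])
      have "norm ?\<epsilon>2 \<le> 1 * \<delta>"
        unfolding norm_mult[of "V L'"] using L' by (intro mult_mono V1 eq i) (auto simp: A_def)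
      then show "norm ?\<epsilon>2 \<le> \<delta>" by simp
      have "norm ?\<Delta> \<le> (\<Sum>j<n. (S / n) * D)"
      proof (rule sum_norm_le)
        fix j assume "j \<in> {..<n}"
        then show "norm (of_real (s i j / n) * (U (j # i # L') - V (j # i # L'))) \<le> (S / n) * D"
          unfolding norm_mult using s_bound[OF i, of j] i L'
          by (intro mult_mono D) (auto simp: A_def norm_divide divide_right_mono S)
      qed
      also have "\<dots> = S * D" using n by simp
      finally show "norm ?\<Delta> \<le> S * D" .
    qed
    finally have 1: "norm z * norm (U L - V L) \<le> (1 + S) * D + (\<delta> + S / n)"
      using Cons by (simp add: algebra_simps)
    have "2 * (1 + S) * norm (U L - V L) \<le> norm z * norm (U L - V L)"
      using z by (intro mult_right_mono) auto
    with 1 have "2 * (1 + S) * norm (U L - V L) \<le> (1 + S) * D + (\<delta> + S / n)" by linarith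
    also have "\<dots> \<le> (1 + S) * D + (1 + S) * (\<delta> + S / n)"
    proof -
      have "1 * (\<delta> + S / n) \<le> (1 + S) * (\<delta> + S / n)"
        using S \<delta> by (intro mult_right_mono) auto
      then show ?thesis by simp
    qed
    finally have "(1 + S) * (2 * norm (U L - V L)) \<le> (1 + S) * (D + (\<delta> + S / n))"
      by (simp add: algebra_simps)
    then have "2 * norm (U L - V L) \<le> D + (\<delta> + S / n)" using S by (simp add: mult_le_cancel_left)
    then have "norm (U L - V L) \<le> (D + (\<delta> + S / n)) / 2" by (simp add: field_simps)
    then show ?thesis by (simp only: add_divide_distrib)
  qed
  have "D \<le> D / 2 + (\<delta> + S / n) / 2"
    unfolding D_def[symmetric] by (subst (1) D_def) (intro cSUP_least step; auto simp: A_def intro: exI[of _ "[]"])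
  moreover have "D \<le> c" if "D \<le> D / 2 + c / 2" for c using that by simp
  ultimately have "D \<le> \<delta> + S / n" by blast
  moreover have "norm (U [i] - V [i]) \<le> D" using i by (intro D) (simp add: A_def)
  ultimately show ?thesis by (simp add: U_def V_def)
qed

end

section \<open>The Stieltjes transform off the support\<close>

text \<open>The deviation is at most \<open>e / 2\<close> outside an event of vanishing probability
  and at most \<open>2 * B\<close> on it. This passes from the given mode of convergence to
  expectations, which integration by parts can reach.\<close>

lemma (in prob_space) expectation_tendsto_of_convergence_in_probability:
  fixes g :: "nat \<Rightarrow> 'a \<Rightarrow> real"
  assumes meas: "\<And>N. N \<ge> 1 \<Longrightarrow> random_variable borel (g N)"
    and bound: "\<And>N \<omega>. N \<ge> 1 \<Longrightarrow> \<omega> \<in> space M \<Longrightarrow> \<bar>g N \<omega>\<bar> \<le> B" and c: "\<bar>c\<bar> \<le> B"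
    and conv: "\<And>\<epsilon>. \<epsilon> > 0 \<Longrightarrow> (\<lambda>N. prob {\<omega> \<in> space M. \<bar>g N \<omega> - c\<bar> > \<epsilon>}) \<longlonglongrightarrow> 0"
  shows "(\<lambda>N. expectation (g N)) \<longlonglongrightarrow> c"
proof (rule LIMSEQ_I)
  fix e :: real assume "e > 0"
  have B: "B \<ge> 0" using c by linarith
  have "(\<lambda>N. 2 * B * prob {\<omega> \<in> space M. \<bar>g N \<omega> - c\<bar> > e / 2}) \<longlonglongrightarrow> 2 * B * 0"
    using \<open>e > 0\<close> by (intro tendsto_mult tendsto_const conv) auto
  from LIMSEQ_D[OF this, of "e / 2"] obtain N0 where
    N0: "\<And>N. N \<ge> N0 \<Longrightarrow> \<bar>2 * B * prob {\<omega> \<in> space M. \<bar>g N \<omega> - c\<bar> > e / 2}\<bar> < e / 2"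
    using \<open>e > 0\<close> by auto
  have "norm (expectation (g N) - c) < e" if N: "N \<ge> max 1 N0" for N
  proof -
    let ?A = "{\<omega> \<in> space M. \<bar>g N \<omega> - c\<bar> > e / 2}"
    have [measurable]: "random_variable borel (g N)" using meas N by simp
    have A: "?A \<in> events" by measurable
    have int: "integrable M (g N)"
      using bound[of N] N by (intro integrable_const_bound[of _ B]) (auto intro!: AE_I2)
    have ind: "integrable M (\<lambda>\<omega>. e / 2 + 2 * B * indicator ?A \<omega>)"
      using A by (intro Bochner_Integration.integrable_add integrable_mult_right integrable_const)
        (auto simp: integrable_indicator_iff less_top[symmetric])
    have "norm (expectation (g N) - c) = norm (expectation (\<lambda>\<omega>. g N \<omega> - c))"
      using int by (simp add: prob_space)
    also have "\<dots> \<le> expectation (\<lambda>\<omega>. norm (g N \<omega> - c))" by (rule integral_norm_bound)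
    also have "\<dots> \<le> expectation (\<lambda>\<omega>. e / 2 + 2 * B * indicator ?A \<omega>)"
    proof (rule integral_mono)
      show "integrable M (\<lambda>\<omega>. norm (g N \<omega> - c))" using int by auto
      fix \<omega> assume \<omega>: "\<omega> \<in> space M"
      show "norm (g N \<omega> - c) \<le> e / 2 + 2 * B * indicator ?A \<omega>"
      proof (cases "\<omega> \<in> ?A")
        case True
        have "\<bar>g N \<omega> - c\<bar> \<le> \<bar>g N \<omega>\<bar> + \<bar>c\<bar>" by linarith
        also have "\<dots> \<le> B + B" using bound[of N \<omega>] N \<omega> c by (intro add_mono) auto
        finally show ?thesis using True \<open>e > 0\<close> by simp
      qed (use \<omega> in auto)
    qed (rule ind)
    also have "\<dots> = e / 2 + 2 * B * prob ?A"
      using A by (subst Bochner_Integration.integral_add)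
        (auto simp: prob_space integrable_indicator_iff less_top[symmetric])
    also have "\<dots> < e / 2 + e / 2" using N0[of N] N by (intro add_strict_left_mono) auto
    finally show ?thesis by simp
  qed
  then show "\<exists>no. \<forall>n\<ge>no. norm (expectation (g n) - c) < e" by blast
qed

text \<open>Nonreal points are separated by their imaginary part, real points outside the support by
  a neighbourhood of measure 0. In the second case the bound holds only almost everywhere.\<close>

lemma support_separation:
  assumes "real_distribution \<mu>" "z \<notin> complex_of_real ` measure_support \<mu>"
  shows "\<exists>\<delta>>0. AE x in \<mu>. \<delta> \<le> norm (z - complex_of_real x)"
proof (cases "Im z = 0")
  case False
  have "\<bar>Im z\<bar> \<le> norm (z - complex_of_real x)" for x
    using abs_Im_le_cmod[of "z - complex_of_real x"] by simp
  then show ?thesis using False by (intro exI[of _ "\<bar>Im z\<bar>"]) auto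
next
  case True
  interpret real_distribution \<mu> by fact
  have zr: "z = complex_of_real (Re z)" using True by (simp add: complex_eq_iff)
  then have "Re z \<notin> measure_support \<mu>" using assms(2) by auto
  then obtain U where U: "open U" "Re z \<in> U" "emeasure \<mu> U = 0"
    by (auto simp: measure_support_def)
  then obtain \<delta> where \<delta>: "\<delta> > 0" "ball (Re z) \<delta> \<subseteq> U" by (metis open_contains_ball)
  have "AE x in \<mu>. x \<notin> U" using U by (intro AE_I[of _ _ U]) auto
  then have "AE x in \<mu>. \<delta> \<le> norm (z - complex_of_real x)"
  proof (rule AE_mp, intro AE_I2 impI)
    fix x assume "x \<notin> U"
    then have "\<delta> \<le> \<bar>Re z - x\<bar>" using \<delta>(2) by (auto simp: subset_iff dist_real_def not_less)
    also have "\<dots> \<le> norm (z - complex_of_real x)" using abs_Re_le_cmod[of "z - complex_of_real x"] by simp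
    finally show "\<delta> \<le> norm (z - complex_of_real x)" .
  qed
  then show ?thesis using \<delta> by blast
qed

lemma stieltjes_has_field_derivative:
  assumes "real_distribution \<mu>" "z \<notin> complex_of_real ` measure_support \<mu>"
  shows "(stieltjes \<mu> has_field_derivative - (LINT x|\<mu>. 1 / (z - complex_of_real x)\<^sup>2)) (at z)"
proof -
  interpret real_distribution \<mu> by fact
  obtain \<delta> where \<delta>: "\<delta> > 0" "AE x in \<mu>. \<delta> \<le> norm (z - complex_of_real x)"
    using support_separation[OF assms] by blast
  \<comment> \<open>A shift of \<open>z\<close> by less than \<open>\<delta> / 2\<close> preserves
    half the distance, so all integrands below are bounded.\<close>
  have half: "AE x in \<mu>. \<delta> / 2 \<le> norm (z + h - complex_of_real x)" if "norm h < \<delta> / 2" for h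
    using \<delta>(2)
  proof (rule AE_mp, intro AE_I2 impI)
    fix x assume "\<delta> \<le> norm (z - complex_of_real x)"
    moreover have "norm (z - complex_of_real x) \<le> norm (z + h - complex_of_real x) + norm h"
      using norm_triangle_ineq4[of "z + h - complex_of_real x" h] by simp
    ultimately show "\<delta> / 2 \<le> norm (z + h - complex_of_real x)" using that by linarith
  qed
  have int: "integrable \<mu> (\<lambda>x. 1 / (w - complex_of_real x) ^ k)"
    if "AE x in \<mu>. \<delta> / 2 \<le> norm (w - complex_of_real x)" for w and k :: nat
  proof (rule integrable_const_bound[of _ "1 / (\<delta> / 2) ^ k"])
    show "AE x in \<mu>. norm (1 / (w - complex_of_real x) ^ k) \<le> 1 / (\<delta> / 2) ^ k"
      using that
    proof (rule AE_mp, intro AE_I2 impI)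
      fix x assume "\<delta> / 2 \<le> norm (w - complex_of_real x)"
      then show "norm (1 / (w - complex_of_real x) ^ k) \<le> 1 / (\<delta> / 2) ^ k"
        using \<delta>(1) unfolding norm_divide norm_power norm_one
        by (intro divide_left_mono power_mono mult_pos_pos zero_less_power) auto
    qed
  qed simp
  have bound: "norm ((stieltjes \<mu> (z + h) - stieltjes \<mu> z) / h - - (LINT x|\<mu>. 1 / (z - complex_of_real x)\<^sup>2)) \<le>
      norm h * (4 / \<delta> ^ 3)" if h: "h \<noteq> 0" "norm h < \<delta> / 2" for h
  proof -
    have z0: "AE x in \<mu>. \<delta> / 2 \<le> norm (z - complex_of_real x)" using half[of 0] \<delta>(1) by simp
    let ?f = "\<lambda>x. (1 / (z + h - complex_of_real x) ^ 1 - 1 / (z - complex_of_real x) ^ 1) / h +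
      1 / (z - complex_of_real x)\<^sup>2"
    have fint: "integrable \<mu> ?f" using int[OF half[OF h(2)], of 1] int[OF z0, of 1] int[OF z0, of 2] by simp
    have eq: "(stieltjes \<mu> (z + h) - stieltjes \<mu> z) / h - - (LINT x|\<mu>. 1 / (z - complex_of_real x)\<^sup>2) = (LINT x|\<mu>. ?f x)"
      using int[OF half[OF h(2)], of 1] int[OF z0, of 1] int[OF z0, of 2] by (simp add: stieltjes_def)
    have "norm (LINT x|\<mu>. ?f x) \<le> (LINT x|\<mu>. norm (?f x))" by (rule integral_norm_bound)
    also have "\<dots> \<le> norm h * (4 / \<delta> ^ 3)"
    proof (rule integral_le_const)
      show "integrable \<mu> (\<lambda>x. norm (?f x))" using fint by (rule integrable_norm)
      show "AE x in \<mu>. norm (?f x) \<le> norm h * (4 / \<delta> ^ 3)"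
        using \<delta>(2) half[OF h(2)]
      proof eventually_elim
        case (elim x)
        let ?a = "z - complex_of_real x" and ?b = "z + h - complex_of_real x"
        have nz: "?a \<noteq> 0" "?b \<noteq> 0" using elim \<delta>(1) by auto
        \<comment> \<open>The exact remainder of the difference quotient; it is of first order in
          \<open>b - a\<close>, which allows differentiation under the integral with an explicit
          error.\<close>
        have "(1 / b - 1 / a) / (b - a) + 1 / a\<^sup>2 = (b - a) / (b * a\<^sup>2)"
          if "a \<noteq> 0" "b \<noteq> 0" "b \<noteq> a" for a b :: complex
        proof -
          have "(1 / b - 1 / a) / (b - a) = - 1 / (a * b)" using that by (simp add: field_simps)
          then show ?thesis using that by (simp add: field_simps power2_eq_square)
        qed
        from this[OF nz] have "?f x = h / (?b * ?a\<^sup>2)" using h by simp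
        then have "norm (?f x) = norm h / (norm ?b * (norm ?a)\<^sup>2)"
          by (simp add: norm_divide norm_mult norm_power)
        also have "\<dots> \<le> norm h / ((\<delta> / 2) * (\<delta>\<^sup>2))"
          using elim \<delta>(1) by (intro divide_left_mono mult_mono power_mono mult_pos_pos) auto
        also have "\<dots> = norm h * (2 / \<delta> ^ 3)" by (simp add: power2_eq_square power3_eq_cube)
        also have "\<dots> \<le> norm h * (4 / \<delta> ^ 3)" using \<delta>(1) by (intro mult_left_mono divide_right_mono) auto
        finally show ?case .
      qed
    qed
    finally show ?thesis unfolding eq .
  qed
  show ?thesis unfolding DERIV_def
  proof (rule LIM_zero_cancel, rule Lim_null_comparison)
    show "eventually (\<lambda>h. norm ((stieltjes \<mu> (z + h) - stieltjes \<mu> z) / h - - (LINT x|\<mu>. 1 / (z - complex_of_real x)\<^sup>2)) \<le>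
      norm h * (4 / \<delta> ^ 3)) (at 0)"
      unfolding eventually_at using bound \<delta>(1) by (intro exI[of _ "\<delta> / 2"]) auto
    show "((\<lambda>h::complex. norm h * (4 / \<delta> ^ 3)) \<longlongrightarrow> 0) (at 0)"
      by (intro tendsto_mult_left_zero tendsto_norm_zero tendsto_ident_at)
  qed
qed

lemma eval_XY_altdef: "eval_XY F z y = (\<Sum>k\<le>degree F. poly (coeff F k) z * y ^ k)"
proof -
  have "poly F [:y:] = (\<Sum>k\<le>degree F. coeff F k * [:y:] ^ k)" by (rule poly_altdef)
  then show ?thesis by (simp add: eval_XY_def poly_sum)
qed

lemma eval_XY_stieltjes_field_differentiable:
  assumes "real_distribution \<mu>" "z \<notin> complex_of_real ` measure_support \<mu>"
  shows "(\<lambda>z. eval_XY F z (stieltjes \<mu> z)) field_differentiable (at z)"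
proof -
  have "stieltjes \<mu> field_differentiable (at z)"
    using stieltjes_has_field_derivative[OF assms] field_differentiable_def by blast
  then show ?thesis unfolding eval_XY_altdef
    by (intro field_differentiable_sum field_differentiable_mult field_differentiable_power)
      (auto intro: field_differentiable_at_within poly_DERIV simp: field_differentiable_def)
qed

text \<open>Each open half-plane is connected and misses the support, so the identity theorem
  applies in it. Real points outside the support are reached by continuity from above, which avoids
  the topology of the complement of the support.\<close>

lemma algebraic_off_support:
  assumes \<mu>: "real_distribution \<mu>"
    and F: "\<And>z. \<bar>Im z\<bar> \<ge> R \<Longrightarrow> eval_XY F z (stieltjes \<mu> z) = 0"
    and z: "z \<notin> complex_of_real ` measure_support \<mu>"
  shows "eval_XY F z (stieltjes \<mu> z) = 0"
proof -
  let ?f = "\<lambda>z. eval_XY F z (stieltjes \<mu> z)"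
  have hol: "?f holomorphic_on A" if "\<And>w. w \<in> A \<Longrightarrow> Im w \<noteq> 0" for A
    unfolding holomorphic_on_def
  proof
    fix w assume "w \<in> A"
    then have "w \<notin> complex_of_real ` measure_support \<mu>" using that by fastforce
    then show "?f field_differentiable (at w within A)"
      by (rule field_differentiable_at_within[OF eval_XY_stieltjes_field_differentiable[OF \<mu>]])
  qed
  have nonreal: "?f w = 0" if "Im w \<noteq> 0" for w
  proof -
    define H where "H = {u. Im w * Im u > 0}"
    define V where "V = {u. Im w * Im u > 0 \<and> \<bar>Im u\<bar> > \<bar>R\<bar>}"
    have Heq: "H = (if Im w > 0 then {u. Im u > 0} else {u. Im u < 0})"
      using that by (auto simp: H_def zero_less_mult_iff)
    have H: "open H" "connected H"
      unfolding Heq by (auto simp: open_halfspace_Im_gt open_halfspace_Im_lt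
        intro!: convex_connected convex_halfspace_Im_gt convex_halfspace_Im_lt)
    have V: "open V" unfolding V_def
      by (intro open_Collect_conj open_Collect_less continuous_intros)
    have "\<i> * of_real (sgn (Im w) * (\<bar>R\<bar> + 1)) \<in> V"
      using that by (auto simp: V_def abs_mult sgn_if intro!: mult_neg_neg)
    then have V': "V \<noteq> {}" by blast
    have VH: "V \<subseteq> H" by (auto simp: V_def H_def)
    have holH: "?f holomorphic_on H" by (rule hol) (auto simp: H_def)
    have zero: "?f u = 0" if "u \<in> V" for u using that by (intro F) (auto simp: V_def)
    have w: "w \<in> H" using that by (auto simp: H_def zero_less_mult_iff)
    show ?thesis
      by (rule analytic_continuation_open[OF V H(1) V' H(2) VH holH holomorphic_on_const zero w])
  qed
  show ?thesis
  proof (cases "Im z = 0")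
    case False
    then show ?thesis by (rule nonreal)
  next
    case True
    have "isCont ?f z"
      using eval_XY_stieltjes_field_differentiable[OF \<mu> z] field_differentiable_imp_continuous_at by blast
    moreover have lim: "(\<lambda>n. z + \<i> * of_real (inverse (real (Suc n)))) \<longlonglongrightarrow> z + \<i> * of_real 0"
      by (intro tendsto_intros LIMSEQ_inverse_real_of_nat)
    ultimately have "(\<lambda>n. ?f (z + \<i> * of_real (inverse (real (Suc n))))) \<longlonglongrightarrow> ?f z"
      by (intro isCont_tendsto_compose[where g = ?f]) auto
    moreover have "?f (z + \<i> * of_real (inverse (real (Suc n)))) = 0" for n
      using True by (intro nonreal) (simp add: field_simps del: of_nat_Suc)
    ultimately show ?thesis by (simp add: LIMSEQ_const_iff)
  qed
qed

section \<open>Averages over the color grid\<close>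

lemma resolvent_cong:
  assumes "\<And>i j. i < n \<Longrightarrow> j < n \<Longrightarrow> a i j = b i j"
  shows "resolvent z n a = resolvent z n b"
proof -
  have "resolvent_denom z n a = resolvent_denom z n b"
    unfolding resolvent_denom_def using assms by (intro eq_matI) auto
  then show ?thesis by (intro ext) (simp only: resolvent_def)
qed

definition grid_count :: "nat \<Rightarrow> real set \<Rightarrow> nat" where
  "grid_count N I = card {k. k < N \<and> real k / real N \<in> I}"

text \<open>Grid points of \<open>I\<close> lie between its endpoints, and those strictly between
  them lie in \<open>I\<close>. Whether the endpoints belong to \<open>I\<close> does not matter,
  since either count differs from \<open>N\<close> times the length by at most 1.\<close>

lemma grid_count_bounds:
  assumes I: "is_interval I" "I \<noteq> {}" "I \<subseteq> {0..1}" and N: "N \<ge> 1"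
  shows "\<bar>real (grid_count N I) / N - (Sup I - Inf I)\<bar> \<le> 1 / N"
proof -
  define a b where "a = Inf I" and "b = Sup I"
  have bdd: "bdd_below I" "bdd_above I" using I(3) by (auto intro!: bdd_belowI[of _ 0] bdd_aboveI[of _ 1])
  have ab: "a \<le> x" "x \<le> b" if "x \<in> I" for x
    using that bdd by (auto simp: a_def b_def intro: cInf_lower cSup_upper)
  have "0 \<le> a" "b \<le> 1" unfolding a_def b_def using I by (auto intro!: cInf_greatest cSup_least)
  have "a \<le> b" using ab I(2) by (meson ex_in_conv order_trans)
  let ?A = "{k. k < N \<and> real k / real N \<in> I}"
  have upper: "real (card ?A) \<le> N * (b - a) + 1"
  proof -
    have "?A \<subseteq> {nat \<lceil>N * a\<rceil>..nat \<lfloor>N * b\<rfloor>}"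
    proof
      fix k assume "k \<in> ?A"
      then have "N * a \<le> k" "k \<le> N * b" using ab[of "k / N"] N by (auto simp: field_simps)
      then show "k \<in> {nat \<lceil>N * a\<rceil>..nat \<lfloor>N * b\<rfloor>}" by (simp, linarith)
    qed
    then have "card ?A \<le> nat \<lfloor>N * b\<rfloor> + 1 - nat \<lceil>N * a\<rceil>"
      using card_mono[of "{nat \<lceil>N * a\<rceil>..nat \<lfloor>N * b\<rfloor>}" ?A] by simp
    moreover have "0 \<le> N * a" "0 \<le> N * b" "N * a \<le> N * b"
      using \<open>0 \<le> a\<close> \<open>a \<le> b\<close> by (auto intro: mult_left_mono)
    ultimately show ?thesis unfolding right_diff_distrib by linarith
  qed
  have lower: "N * (b - a) - 1 \<le> real (card ?A)"
  proof -
    have "{nat \<lfloor>N * a\<rfloor> + 1..<nat \<lceil>N * b\<rceil>} \<subseteq> ?A"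
    proof
      fix k assume "k \<in> {nat \<lfloor>N * a\<rfloor> + 1..<nat \<lceil>N * b\<rceil>}"
      then have "N * a < k" "k < N * b" by (simp_all, linarith+)
      then have k: "a < k / N" "k / N < b" using N by (simp_all add: field_simps)
      obtain y where y: "y \<in> I" "y < k / N" using k(1) cInf_lessD[OF I(2)] unfolding a_def by blast
      obtain y' where y': "y' \<in> I" "k / N < y'" using k(2) less_cSupD[OF I(2)] unfolding b_def by blast
      have "k / N \<in> I" using I(1) y y' unfolding is_interval_1 by (meson less_imp_le)
      moreover have "k < N"
      proof -
        have "k / N < 1" using k(2) \<open>b \<le> 1\<close> by linarith
        then show ?thesis using N by simp
      qed
      ultimately show "k \<in> ?A" by simp
    qed
    then have "nat \<lceil>N * b\<rceil> - (nat \<lfloor>N * a\<rfloor> + 1) \<le> card ?A"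
      using card_mono[of ?A "{nat \<lfloor>N * a\<rfloor> + 1..<nat \<lceil>N * b\<rceil>}"] by simp
    moreover have "0 \<le> N * a" "0 \<le> N * b" using \<open>0 \<le> a\<close> \<open>a \<le> b\<close> by auto
    ultimately show ?thesis unfolding right_diff_distrib by linarith
  qed
  have "\<bar>real (card ?A) - N * (b - a)\<bar> \<le> 1" using upper lower by (simp only: abs_le_iff) linarith
  moreover have "real (card ?A) / N - (b - a) = (real (card ?A) - N * (b - a)) / N"
    using N by (simp add: field_simps)
  ultimately show ?thesis
    using N by (simp only: grid_count_def a_def[symmetric] b_def[symmetric] abs_divide) (simp add: divide_right_mono)
qed

lemma grid_count_tendsto:
  assumes "is_interval I" "I \<noteq> {}" "I \<subseteq> {0..1}"
  shows "(\<lambda>N. real (grid_count N I) / N) \<longlonglongrightarrow> Sup I - Inf I"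
proof (rule LIM_zero_cancel, rule Lim_null_comparison)
  show "eventually (\<lambda>N. norm (real (grid_count N I) / N - (Sup I - Inf I)) \<le> 1 / real N) sequentially"
    using grid_count_bounds[OF assms] by (intro eventually_sequentiallyI[of 1]) simp
  show "(\<lambda>N. 1 / real N) \<longlonglongrightarrow> 0" by (rule lim_1_over_n)
qed

section \<open>Grouping the grid points by intervals\<close>

definition part_of :: "real set set \<Rightarrow> real \<Rightarrow> real set" where
  "part_of \<I> x = (THE I. I \<in> \<I> \<and> x \<in> I)"

lemma part_of_eq:
  assumes "partition_on {0..1} \<I>" "I \<in> \<I>" "x \<in> I"
  shows "part_of \<I> x = I"
  unfolding part_of_def
proof (rule the_equality)
  fix I' assume "I' \<in> \<I> \<and> x \<in> I'"
  then show "I' = I" using assms partition_onD2[OF assms(1)] by (auto simp: disjoint_def)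
qed (use assms in simp)

lemma part_of_mem:
  assumes "partition_on {0..1} \<I>" "x \<in> {0..1}"
  shows "part_of \<I> x \<in> \<I>" "x \<in> part_of \<I> x"
proof -
  obtain I where I: "I \<in> \<I>" "x \<in> I" using partition_onD1[OF assms(1)] assms(2) by auto
  show "part_of \<I> x \<in> \<I>" "x \<in> part_of \<I> x" using part_of_eq[OF assms(1) I] I by auto
qed

lemma color_grid_eq:
  assumes "N \<ge> 1"
  shows "color_grid N = (\<lambda>(k, \<xi>). (real k / real N, \<xi>)) ` ({..<N} \<times> {\<xi>. \<xi> ^ N = 1})"
proof (rule subset_antisym; rule subsetI)
  fix c assume "c \<in> color_grid N"
  then obtain x \<xi> k where c: "c = (x, \<xi>)" "0 \<le> x" "x < 1" "x = of_int k / real N" "\<xi> ^ N = 1"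
    by (auto simp: color_grid_def)
  then have "0 \<le> k" "k < int N" using assms by (auto simp: field_simps)
  then have "nat k < N" "x = real (nat k) / real N" using c by auto
  then have "(nat k, \<xi>) \<in> {..<N} \<times> {\<xi>. \<xi> ^ N = 1}" "c = (\<lambda>(k, \<xi>). (real k / real N, \<xi>)) (nat k, \<xi>)"
    using c(1,5) by simp_all
  then show "c \<in> (\<lambda>(k, \<xi>). (real k / real N, \<xi>)) ` ({..<N} \<times> {\<xi>. \<xi> ^ N = 1})"
    by (rule rev_image_eqI)
next
  fix c :: color assume "c \<in> (\<lambda>(k, \<xi>). (real k / real N, \<xi>)) ` ({..<N} \<times> {\<xi>. \<xi> ^ N = 1})"
  then obtain k \<xi> where c: "c = (real k / real N, \<xi>)" "k < N" "\<xi> ^ N = 1" by auto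
  have "real k / real N = of_int (int k) / real N" by simp
  then show "c \<in> color_grid N" using c assms
    unfolding color_grid_def by (auto intro!: exI[of _ "int k"])
qed

lemma norm_root_of_unity:
  fixes \<xi> :: complex
  assumes "\<xi> ^ N = 1" "N \<ge> 1"
  shows "norm \<xi> = 1"
proof -
  have "norm \<xi> ^ N = 1 ^ N" using assms(1) by (simp flip: norm_power)
  then show ?thesis by (rule power_eq_imp_eq_base) (use assms(2) in auto)
qed

lemma color_grid_subset:
  assumes "N \<ge> 1"
  shows "color_grid N \<subseteq> color_space"
proof
  fix c assume "c \<in> color_grid N"
  then have "0 \<le> fst c" "fst c < 1" "snd c ^ N = 1" by (auto simp: color_grid_def)
  then have "fst c \<in> {0..1}" "snd c \<in> sphere 0 1" using norm_root_of_unity[OF _ assms] by simp_all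
  then show "c \<in> color_space" unfolding color_space_def by (simp add: mem_Times_iff)
qed

lemma sum_color_grid:
  fixes g :: "real set \<Rightarrow> complex \<Rightarrow> complex"
  assumes "N \<ge> 1" "partition_on {0..1} \<I>" "finite \<I>"
  shows "(\<Sum>c\<in>color_grid N. g (part_of \<I> (fst c)) (snd c)) =
    (\<Sum>I\<in>\<I>. of_nat (grid_count N I) * (\<Sum>\<xi> | \<xi> ^ N = 1. g I \<xi>))"
proof -
  let ?R = "{\<xi>::complex. \<xi> ^ N = 1}"
  have "inj_on (\<lambda>(k, \<xi>). (real k / real N, \<xi>)) ({..<N} \<times> ?R)" using assms by (auto simp: inj_on_def)
  then have "(\<Sum>c\<in>color_grid N. g (part_of \<I> (fst c)) (snd c)) =
      (\<Sum>(k, \<xi>)\<in>{..<N} \<times> ?R. g (part_of \<I> (real k / real N)) \<xi>)"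
    unfolding color_grid_eq[OF assms(1)] by (subst sum.reindex) (auto intro!: sum.cong)
  also have "\<dots> = (\<Sum>k<N. \<Sum>\<xi>\<in>?R. g (part_of \<I> (real k / real N)) \<xi>)"
    by (simp only: sum.cartesian_product)
  also have "\<dots> = (\<Sum>I\<in>\<I>. \<Sum>k\<in>{k \<in> {..<N}. part_of \<I> (real k / real N) = I}.
      \<Sum>\<xi>\<in>?R. g (part_of \<I> (real k / real N)) \<xi>)"
    using assms by (intro sum.group[symmetric]) (auto intro!: part_of_mem)
  also have "\<dots> = (\<Sum>I\<in>\<I>. of_nat (grid_count N I) * (\<Sum>\<xi>\<in>?R. g I \<xi>))"
  proof (intro sum.cong refl)
    fix I assume I: "I \<in> \<I>"
    have "part_of \<I> (real k / real N) = I \<longleftrightarrow> real k / real N \<in> I" if "k < N" for k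
    proof -
      have "real k / real N \<in> {0..1}" using that by simp
      then show ?thesis using part_of_eq[OF assms(2) I] part_of_mem(2)[OF assms(2)] by blast
    qed
    then have "{k \<in> {..<N}. part_of \<I> (real k / real N) = I} = {k. k < N \<and> real k / real N \<in> I}"
      by auto
    moreover have "(\<Sum>k\<in>{k \<in> {..<N}. part_of \<I> (real k / real N) = I}.
      \<Sum>\<xi>\<in>?R. g (part_of \<I> (real k / real N)) \<xi>) =
      (\<Sum>k\<in>{k \<in> {..<N}. part_of \<I> (real k / real N) = I}. \<Sum>\<xi>\<in>?R. g I \<xi>)"
      by (intro sum.cong refl) auto
    ultimately show "(\<Sum>k\<in>{k \<in> {..<N}. part_of \<I> (real k / real N) = I}.
      \<Sum>\<xi>\<in>?R. g (part_of \<I> (real k / real N)) \<xi>) = of_nat (grid_count N I) * (\<Sum>\<xi>\<in>?R. g I \<xi>)"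
      by (simp add: grid_count_def)
  qed
  finally show ?thesis .
qed

section \<open>The Dyson equation on the grid\<close>

context laurent_system
begin

definition ker :: "'j \<Rightarrow> complex \<Rightarrow> 'j \<Rightarrow> complex \<Rightarrow> complex" where
  "ker I \<xi> I' \<eta> = (\<Sum>k\<in>D. \<Sum>j\<in>D. a k I j I' * \<xi> powi k * \<eta> powi j)"

lemma ker_bound:
  assumes "norm \<xi> = 1" "norm \<eta> = 1" "I \<in> J" "I' \<in> J"
  shows "norm (ker I \<xi> I' \<eta>) \<le> C"
proof -
  have "norm (ker I \<xi> I' \<eta>) \<le> (\<Sum>k\<in>D. \<Sum>j\<in>D. norm (a k I j I'))"
    unfolding ker_def using assms by (intro sum_norm_le) (simp add: norm_mult norm_power_int)
  also have "\<dots> \<le> C" unfolding C_def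
  proof (rule sum_mono)
    fix k
    have "(\<Sum>j\<in>D. norm (a k I j I')) \<le> (\<Sum>I'\<in>J. \<Sum>j\<in>D. norm (a k I j I'))"
      using assms finite_J by (intro member_le_sum[of I' J]) (auto intro!: sum_nonneg)
    also have "\<dots> \<le> (\<Sum>I\<in>J. \<Sum>I'\<in>J. \<Sum>j\<in>D. norm (a k I j I'))"
      using assms finite_J by (intro member_le_sum[of I J]) (auto intro!: sum_nonneg)
    finally show "(\<Sum>j\<in>D. norm (a k I j I')) \<le> (\<Sum>I\<in>J. \<Sum>I'\<in>J. \<Sum>j\<in>D. norm (a k I j I'))" .
  qed
  finally show ?thesis .
qed

end

context laurent_solution
begin

text \<open>The weights \<open>r\<close> are left free: they will be the proportions of grid points
  in the intervals, whereas the choice \<open>r = p\<close> gives the coefficients of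
  \<open>A\<close>.\<close>

lemma ker_average:
  assumes "N > (K + 2) * m"
  shows "(\<Sum>I'\<in>J. of_real (r I') * ((\<Sum>\<eta> | \<eta> ^ N = 1. ker I \<xi> I' \<eta> * Psi K I' \<eta>) / of_nat N)) =
    (\<Sum>k\<in>D. (\<Sum>I'\<in>J. \<Sum>j\<in>D. a k I j I' * of_real (r I') * x (2, I', nat (int d - j), d)) * \<xi> powi k)"
proof -
  have N: "N \<noteq> 0" using assms by auto
  have "(\<Sum>\<eta> | \<eta> ^ N = 1. ker I \<xi> I' \<eta> * Psi K I' \<eta>) / of_nat N =
      (\<Sum>k\<in>D. \<Sum>j\<in>D. a k I j I' * \<xi> powi k * x (2, I', nat (int d - j), d))" for I'
  proof -
    have "(\<Sum>\<eta> | \<eta> ^ N = 1. ker I \<xi> I' \<eta> * Psi K I' \<eta>) =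
      (\<Sum>\<eta> | \<eta> ^ N = 1. \<Sum>k\<in>D. \<Sum>j\<in>D. a k I j I' * \<xi> powi k * (\<eta> powi j * Psi K I' \<eta>))"
      unfolding ker_def sum_distrib_right by (simp only: mult.assoc)
    also have "\<dots> = (\<Sum>k\<in>D. \<Sum>j\<in>D. \<Sum>\<eta> | \<eta> ^ N = 1. a k I j I' * \<xi> powi k * (\<eta> powi j * Psi K I' \<eta>))"
      by (subst sum.swap, intro sum.cong refl, subst sum.swap, rule refl)
    also have "\<dots> = (\<Sum>k\<in>D. \<Sum>j\<in>D. a k I j I' * \<xi> powi k * (of_nat N * x (2, I', nat (int d - j), d)))"
      unfolding sum_distrib_left[symmetric] using sum_roots_Psi[OF _ assms] by (intro sum.cong refl) simp
    also have "\<dots> = of_nat N * (\<Sum>k\<in>D. \<Sum>j\<in>D. a k I j I' * \<xi> powi k * x (2, I', nat (int d - j), d))"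
      unfolding sum_distrib_left by (simp only: mult.left_commute)
    finally show ?thesis using N by simp
  qed
  then have "(\<Sum>I'\<in>J. of_real (r I') * ((\<Sum>\<eta> | \<eta> ^ N = 1. ker I \<xi> I' \<eta> * Psi K I' \<eta>) / of_nat N)) =
     (\<Sum>I'\<in>J. \<Sum>k\<in>D. \<Sum>j\<in>D. a k I j I' * of_real (r I') * x (2, I', nat (int d - j), d) * \<xi> powi k)"
    by (simp only: sum_distrib_left mult_ac)
  also have "\<dots> = (\<Sum>k\<in>D. \<Sum>I'\<in>J. \<Sum>j\<in>D. a k I j I' * of_real (r I') * x (2, I', nat (int d - j), d) * \<xi> powi k)"
    by (rule sum.swap)
  finally show ?thesis by (simp only: sum_distrib_right)
qed

text \<open>The two errors come from truncation after \<open>K\<close> blocks and from grid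
  proportions \<open>r\<close> in place of lengths \<open>p\<close>. The averages over roots of
  unity contribute none.\<close>

lemma Psi_approximate_equation:
  assumes "N > (K + 2) * m" "norm \<xi> = 1" "I \<in> J"
  shows "norm (z * Psi K I \<xi> - 1 - Psi K I \<xi> *
      (\<Sum>I'\<in>J. of_real (r I') * ((\<Sum>\<eta> | \<eta> ^ N = 1. ker I \<xi> I' \<eta> * Psi K I' \<eta>) / of_nat N)))
    \<le> 4 * (m * C) * (1 / 2) ^ K + C * (\<Sum>I'\<in>J. \<bar>r I' - p I'\<bar>)"
proof -
  let ?S = "\<Sum>I'\<in>J. of_real (r I') * ((\<Sum>\<eta> | \<eta> ^ N = 1. ker I \<xi> I' \<eta> * Psi K I' \<eta>) / of_nat N)"
  let ?t = "\<Sum>I'\<in>J. \<bar>r I' - p I'\<bar>"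
  have A: "A x I \<xi> = (\<Sum>k\<in>D. (\<Sum>I'\<in>J. \<Sum>j\<in>D. a k I j I' * of_real (p I') * x (2, I', nat (int d - j), d)) * \<xi> powi k)"
    unfolding A_def coef_def by (intro sum.cong refl) (simp only: if_True)
  have "?S - A x I \<xi> = (\<Sum>k\<in>D. \<Sum>I'\<in>J. \<Sum>j\<in>D. a k I j I' * of_real (r I' - p I') * x (2, I', nat (int d - j), d) * \<xi> powi k)"
    unfolding ker_average[OF assms(1)] A sum_subtractf[symmetric] sum_distrib_right
    by (simp only: of_real_diff left_diff_distrib right_diff_distrib)
  also have "norm \<dots> \<le> (\<Sum>k\<in>D. \<Sum>I'\<in>J. \<Sum>j\<in>D. norm (a k I j I') * ?t)"
  proof (intro sum_norm_le)
    fix k I' j assume *: "I' \<in> J" "j \<in> D"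
    have "\<bar>r I' - p I'\<bar> \<le> ?t" using * finite_J by (intro member_le_sum) auto
    then have "norm (a k I j I') * \<bar>r I' - p I'\<bar> * norm (x (2, I', nat (int d - j), d)) \<le> norm (a k I j I') * ?t * 1"
      using x_bound[of 2 I' "nat (int d - j)" d] * shift_less_m[of j] d_less_m
      by (intro mult_mono mult_nonneg_nonneg sum_nonneg) auto
    then show "norm (a k I j I' * of_real (r I' - p I') * x (2, I', nat (int d - j), d) * \<xi> powi k) \<le> norm (a k I j I') * ?t"
      using assms(2) by (simp add: norm_mult norm_power_int del: of_real_diff)
  qed
  also have "\<dots> = (\<Sum>k\<in>D. \<Sum>I'\<in>J. \<Sum>j\<in>D. norm (a k I j I')) * ?t"
    by (simp only: sum_distrib_right)
  also have "\<dots> \<le> C * ?t"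
  proof (rule mult_right_mono)
    have "(\<Sum>I'\<in>J. \<Sum>j\<in>D. norm (a k I j I')) \<le> (\<Sum>I\<in>J. \<Sum>I'\<in>J. \<Sum>j\<in>D. norm (a k I j I'))" for k
      using assms finite_J by (intro member_le_sum[of I J]) (auto intro!: sum_nonneg)
    then show "(\<Sum>k\<in>D. \<Sum>I'\<in>J. \<Sum>j\<in>D. norm (a k I j I')) \<le> C"
      unfolding C_def by (rule sum_mono)
    show "0 \<le> ?t" by (rule sum_nonneg) simp
  qed
  finally have 1: "norm (?S - A x I \<xi>) \<le> C * ?t" .
  have "\<xi> \<noteq> 0" using assms(2) by auto
  have eq: "z * Psi K I \<xi> - 1 - Psi K I \<xi> * ?S = boundary K I \<xi> - Psi K I \<xi> * (?S - A x I \<xi>)"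
  proof -
    have "w - 1 - P * s = b - P * (s - A)" if "w - A * P = 1 + b" for w P s b A :: complex
    proof -
      have w: "w = 1 + b + A * P" using that by (simp add: algebra_simps)
      show ?thesis unfolding w by (simp add: algebra_simps)
    qed
    then show ?thesis using Psi_equation[OF \<open>\<xi> \<noteq> 0\<close> assms(3), of K] by blast
  qed
  have "norm (Psi K I \<xi> * (?S - A x I \<xi>)) \<le> 1 * (C * ?t)"
    unfolding norm_mult using 1 Psi_bound[OF assms(2,3)] by (intro mult_mono) auto
  then have "norm (boundary K I \<xi> - Psi K I \<xi> * (?S - A x I \<xi>)) \<le> 4 * (m * C) * (1 / 2) ^ K + 1 * (C * ?t)"
    using boundary_bound[OF assms(2,3)] by (intro order_trans[OF norm_triangle_ineq4] add_mono)
  then show ?thesis unfolding eq by simp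
qed

lemma Psi_average:
  assumes "N > (K + 2) * m"
  shows "norm ((\<Sum>I\<in>J. of_real (r I) * ((\<Sum>\<xi> | \<xi> ^ N = 1. Psi K I \<xi>) / of_nat N)) - l x) \<le> (\<Sum>I\<in>J. \<bar>r I - p I\<bar>)"
proof -
  have N: "N \<noteq> 0" using assms by auto
  have "(\<Sum>\<xi> | \<xi> ^ N = 1. Psi K I \<xi>) / of_nat N = x (2, I, d, d)" for I
    using sum_roots_Psi[OF _ assms, of 0 I] N by simp
  then have "(\<Sum>I\<in>J. of_real (r I) * ((\<Sum>\<xi> | \<xi> ^ N = 1. Psi K I \<xi>) / of_nat N)) - l x =
      (\<Sum>I\<in>J. of_real (r I - p I) * x (2, I, d, d))"
    by (simp add: l_def sum_subtractf left_diff_distrib)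
  also have "norm \<dots> \<le> (\<Sum>I\<in>J. \<bar>r I - p I\<bar>)"
  proof (rule sum_norm_le)
    fix I assume "I \<in> J"
    then have "\<bar>r I - p I\<bar> * norm (x (2, I, d, d)) \<le> \<bar>r I - p I\<bar> * 1"
      using x_bound[of 2 I d d] d_less_m by (intro mult_left_mono) auto
    then show "norm (of_real (r I - p I) * x (2, I, d, d)) \<le> \<bar>r I - p I\<bar>"
      by (simp add: norm_mult del: of_real_diff)
  qed
  finally show ?thesis .
qed

end

section \<open>The random matrix ensemble\<close>

text \<open>Weak convergence is tested on real functions, so the Cauchy kernel has to enter through
  its real and imaginary parts.\<close>

lemma integral_cauchy_kernel_component:
  assumes L: "prob_space L" "sets L = sets borel" and z: "Im z \<noteq> 0"
  shows "(LINT x|L. Re (1 / (z - complex_of_real x))) = Re (LINT x|L. 1 / (z - complex_of_real x))"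
    "(LINT x|L. Im (1 / (z - complex_of_real x))) = Im (LINT x|L. 1 / (z - complex_of_real x))"
proof -
  interpret L: prob_space L by fact
  have b: "norm (1 / (z - complex_of_real x)) \<le> 1 / \<bar>Im z\<bar>" for x
  proof -
    have "\<bar>Im z\<bar> \<le> norm (z - complex_of_real x)" using abs_Im_le_cmod[of "z - complex_of_real x"] by simp
    then show ?thesis using z unfolding norm_divide by (simp add: frac_le)
  qed
  have "(\<lambda>x. 1 / (z - complex_of_real x)) \<in> borel_measurable L"
    unfolding measurable_cong_sets[OF L(2) refl] by measurable
  then have "integrable L (\<lambda>x. 1 / (z - complex_of_real x))"
    by (intro L.integrable_const_bound[of _ "1 / \<bar>Im z\<bar>"]) (auto intro: b)
  then show "(LINT x|L. Re (1 / (z - complex_of_real x))) = Re (LINT x|L. 1 / (z - complex_of_real x))"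
    "(LINT x|L. Im (1 / (z - complex_of_real x))) = Im (LINT x|L. 1 / (z - complex_of_real x))"
    by (simp_all only: integral_bounded_linear[OF bounded_linear_Re] integral_bounded_linear[OF bounded_linear_Im])
qed

abbreviation color_edges :: "color set set" where
  "color_edges \<equiv> {e. e \<subseteq> color_grid_union \<and> card e \<in> {1, 2}}"

locale color_ensemble =
  fixes s :: "color \<Rightarrow> color \<Rightarrow> real" and M :: "'w measure" and Y :: "color set \<Rightarrow> 'w \<Rightarrow> real"
    and c :: "nat \<Rightarrow> nat \<Rightarrow> color"
  assumes s_symmetric: "\<And>u v. u \<in> color_space \<Longrightarrow> v \<in> color_space \<Longrightarrow> s u v = s v u"
    and s_nonneg: "\<And>u v. u \<in> color_space \<Longrightarrow> v \<in> color_space \<Longrightarrow> 0 \<le> s u v"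
    and iid: "iid_std_normal_family M Y"
    and enum: "grid_enumeration c"
begin

sublocale prob_space M using iid by (simp add: iid_std_normal_family_def Let_def)

lemma indep_Y: "indep_vars (\<lambda>_. borel) Y color_edges"
  using iid by (simp add: iid_std_normal_family_def Let_def)

lemma distributed_Y: "e \<in> color_edges \<Longrightarrow> distributed M lborel (Y e) std_normal_density"
  using iid by (simp add: iid_std_normal_family_def Let_def)

lemma Y_measurable: "e \<in> color_edges \<Longrightarrow> Y e \<in> borel_measurable M"
  using distributed_measurable[OF distributed_Y] by simp

lemma distr_Y:
  assumes "e \<in> color_edges"
  shows "distr M borel (Y e) = std_normal"
proof -
  have "distr M borel (Y e) = distr M lborel (Y e)" by (rule distr_cong) simp_all
  also have "\<dots> = std_normal" by (rule distributed_distr_eq_density[OF distributed_Y[OF assms]])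
  finally show ?thesis .
qed

lemma c_bij: "N \<ge> 1 \<Longrightarrow> bij_betw (c N) {..<N\<^sup>2} (color_grid N)"
  using enum by (simp add: grid_enumeration_def)

lemma c_mem: "N \<ge> 1 \<Longrightarrow> i < N\<^sup>2 \<Longrightarrow> c N i \<in> color_grid N"
  using bij_betwE[OF c_bij] by simp

lemma c_space: "N \<ge> 1 \<Longrightarrow> i < N\<^sup>2 \<Longrightarrow> c N i \<in> color_space"
  using c_mem[of N i] color_grid_subset[of N] by (rule subsetD[rotated])

lemma c_inj: "N \<ge> 1 \<Longrightarrow> i < N\<^sup>2 \<Longrightarrow> j < N\<^sup>2 \<Longrightarrow> c N i = c N j \<longleftrightarrow> i = j"
  using inj_on_eq_iff[OF bij_betw_imp_inj_on[OF c_bij]] by simp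

lemma edge_mem:
  assumes "N \<ge> 1" "i < N\<^sup>2" "j < N\<^sup>2"
  shows "{c N i, c N j} \<in> color_edges"
proof -
  have "c N i \<in> color_grid_union" "c N j \<in> color_grid_union"
    using c_mem assms by (auto simp: color_grid_union_def)
  moreover have "card {c N i, c N j} \<in> {1, 2}" by (cases "c N i = c N j") auto
  ultimately show ?thesis by simp
qed

definition entry :: "nat \<Rightarrow> 'w \<Rightarrow> nat \<Rightarrow> nat \<Rightarrow> real" where
  "entry N \<omega> i j = (1 / real N) *
    (2 powr (of_bool (i = j) / 2) * sqrt (s (c N i) (c N j)) * Y {c N i, c N j} \<omega>)"

definition mean_resolvent :: "nat \<Rightarrow> complex \<Rightarrow> 'w \<Rightarrow> complex" where
  "mean_resolvent N z \<omega> = (\<Sum>i<N\<^sup>2. resolvent z (N\<^sup>2) (entry N \<omega>) i i) / of_nat (N\<^sup>2)"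

lemma entry_symmetric: "N \<ge> 1 \<Longrightarrow> symmetric_on (N\<^sup>2) (entry N \<omega>)"
  unfolding symmetric_on_def entry_def
  using s_symmetric[OF c_space c_space] by (auto simp: insert_commute)

lemma entry_measurable:
  assumes "N \<ge> 1" "i < N\<^sup>2" "j < N\<^sup>2"
  shows "(\<lambda>\<omega>. entry N \<omega> i j) \<in> borel_measurable M"
  unfolding entry_def using Y_measurable[OF edge_mem[OF assms]] by measurable

lemma mean_resolvent_measurable: "N \<ge> 1 \<Longrightarrow> mean_resolvent N z \<in> borel_measurable M"
  unfolding mean_resolvent_def
  by (intro borel_measurable_divide borel_measurable_sum borel_measurable_const
      measurable_resolvent entry_measurable) auto

lemma mean_resolvent_bound:
  assumes "N \<ge> 1" "Im z \<noteq> 0"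
  shows "norm (mean_resolvent N z \<omega>) \<le> 1 / \<bar>Im z\<bar>"
proof -
  have "norm (\<Sum>i<N\<^sup>2. resolvent z (N\<^sup>2) (entry N \<omega>) i i) \<le> (\<Sum>i<N\<^sup>2. 1 / \<bar>Im z\<bar>)"
    using resolvent_bound[OF entry_symmetric assms(2)] assms(1) by (intro sum_norm_le) auto
  then have "norm (\<Sum>i<N\<^sup>2. resolvent z (N\<^sup>2) (entry N \<omega>) i i) \<le> of_nat (N\<^sup>2) * (1 / \<bar>Im z\<bar>)" by simp
  then show ?thesis
    using assms unfolding mean_resolvent_def norm_divide norm_of_nat by (simp add: field_simps)
qed

lemma color_matrix_eq:
  "(1 / real N) \<cdot>\<^sub>m color_matrix s c Y N \<omega> = mat (N\<^sup>2) (N\<^sup>2) (\<lambda>(i, j). entry N \<omega> i j)"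
  unfolding color_matrix_def entry_def by (intro eq_matI) auto

lemma stieltjes_color_matrix:
  assumes "N \<ge> 1" "Im z \<noteq> 0"
  shows "(LINT x|empirical_eigenvalue_distribution ((1 / real N) \<cdot>\<^sub>m color_matrix s c Y N \<omega>).
    1 / (z - complex_of_real x)) = mean_resolvent N z \<omega>"
  unfolding color_matrix_eq mean_resolvent_def using assms
  by (intro stieltjes_empirical_eigenvalue_distribution entry_symmetric) auto

lemma integrable_mean_resolvent: "N \<ge> 1 \<Longrightarrow> Im z \<noteq> 0 \<Longrightarrow> integrable M (mean_resolvent N z)"
  by (rule integrable_const_bound[of _ "1 / \<bar>Im z\<bar>"])
    (auto intro!: AE_I2 mean_resolvent_bound mean_resolvent_measurable)

lemma expectation_mean_resolvent_tendsto:
  assumes \<mu>: "is_kernel_measure M Y c s \<mu>" and z: "Im z \<noteq> 0"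
  shows "(\<lambda>N. expectation (mean_resolvent N z)) \<longlonglongrightarrow> stieltjes \<mu> z"
proof -
  interpret \<mu>: real_distribution \<mu> using \<mu> by (simp add: is_kernel_measure_def)
  let ?L = "\<lambda>N \<omega>. empirical_eigenvalue_distribution ((1 / real N) \<cdot>\<^sub>m color_matrix s c Y N \<omega>)"
  have L: "prob_space (?L N \<omega>)" "sets (?L N \<omega>) = sets borel" for N \<omega>
    unfolding empirical_eigenvalue_distribution_def
    by (auto intro!: prob_space.prob_space_distr prob_space_measure_pmf)
  have nz: "z - complex_of_real x \<noteq> 0" for x using z by (auto simp: complex_eq_iff)
  have b: "norm (1 / (z - complex_of_real x)) \<le> 1 / \<bar>Im z\<bar>" for x
  proof -
    have "\<bar>Im z\<bar> \<le> norm (z - complex_of_real x)" using abs_Im_le_cmod[of "z - complex_of_real x"] by simp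
    then show ?thesis using z unfolding norm_divide by (simp add: frac_le)
  qed
  \<comment> \<open>Treats \<open>Re\<close> and \<open>Im\<close> at once; \<open>\<phi>\<close> is
    instantiated with each of them below.\<close>
  have *: "(\<lambda>N. expectation (\<lambda>\<omega>. \<phi> (mean_resolvent N z \<omega>))) \<longlonglongrightarrow> \<phi> (stieltjes \<mu> z)"
    if \<phi>: "bounded_linear \<phi>" "\<And>w. \<bar>\<phi> w\<bar> \<le> norm w"
      and comp: "\<And>L. prob_space L \<Longrightarrow> sets L = sets borel \<Longrightarrow>
        (LINT x|L. \<phi> (1 / (z - complex_of_real x))) = \<phi> (LINT x|L. 1 / (z - complex_of_real x))"
    for \<phi> :: "complex \<Rightarrow> real"
  proof (rule expectation_tendsto_of_convergence_in_probability[where B = "1 / \<bar>Im z\<bar>"])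
    fix N :: nat assume N: "N \<ge> 1"
    show "(\<lambda>\<omega>. \<phi> (mean_resolvent N z \<omega>)) \<in> borel_measurable M"
      using mean_resolvent_measurable[OF N] borel_measurable_continuous_onI[OF linear_continuous_on[OF \<phi>(1)]]
      by (rule measurable_compose)
    show "\<bar>\<phi> (mean_resolvent N z \<omega>)\<bar> \<le> 1 / \<bar>Im z\<bar>" for \<omega>
      using \<phi>(2) mean_resolvent_bound[OF N z] by (rule order_trans)
  next
    have st: "stieltjes \<mu> z = (LINT x|\<mu>. 1 / (z - complex_of_real x))" by (simp add: stieltjes_def)
    have "norm (stieltjes \<mu> z) \<le> (LINT x|\<mu>. norm (1 / (z - complex_of_real x)))"
      unfolding st by (rule integral_norm_bound)
    also have "\<dots> \<le> 1 / \<bar>Im z\<bar>"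
      by (intro \<mu>.integral_le_const integrable_norm \<mu>.integrable_const_bound[of _ "1 / \<bar>Im z\<bar>"] AE_I2 b) simp
    finally show "\<bar>\<phi> (stieltjes \<mu> z)\<bar> \<le> 1 / \<bar>Im z\<bar>" using \<phi>(2) order_trans by blast
    fix \<epsilon> :: real assume "\<epsilon> > 0"
    let ?f = "\<lambda>x. \<phi> (1 / (z - complex_of_real x))"
    have "continuous_on UNIV ?f"
      using nz by (intro bounded_linear.continuous_on[OF \<phi>(1)] continuous_intros) auto
    moreover have "bounded (range ?f)"
      using order_trans[OF \<phi>(2) b] by (intro boundedI[of _ "1 / \<bar>Im z\<bar>"]) auto
    ultimately have "(\<lambda>N. prob {\<omega> \<in> space M. \<bar>(LINT x|?L N \<omega>. ?f x) - (LINT x|\<mu>. ?f x)\<bar> > \<epsilon>}) \<longlonglongrightarrow> 0"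
      using \<mu> \<open>\<epsilon> > 0\<close> unfolding is_kernel_measure_def tendsto_weakly_in_probability_def by blast
    moreover have "eventually (\<lambda>N. prob {\<omega> \<in> space M. \<bar>(LINT x|?L N \<omega>. ?f x) - (LINT x|\<mu>. ?f x)\<bar> > \<epsilon>} =
      prob {\<omega> \<in> space M. \<bar>\<phi> (mean_resolvent N z \<omega>) - \<phi> (stieltjes \<mu> z)\<bar> > \<epsilon>}) sequentially"
    proof (rule eventually_sequentiallyI[of 1])
      fix N :: nat assume N: "1 \<le> N"
      have "(LINT x|?L N \<omega>. ?f x) = \<phi> (mean_resolvent N z \<omega>)" for \<omega>
        unfolding comp[OF L] stieltjes_color_matrix[OF N z] ..
      moreover have "(LINT x|\<mu>. ?f x) = \<phi> (stieltjes \<mu> z)"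
        unfolding st by (rule comp[OF \<mu>.prob_space_axioms]) simp
      ultimately show "prob {\<omega> \<in> space M. \<bar>(LINT x|?L N \<omega>. ?f x) - (LINT x|\<mu>. ?f x)\<bar> > \<epsilon>} =
        prob {\<omega> \<in> space M. \<bar>\<phi> (mean_resolvent N z \<omega>) - \<phi> (stieltjes \<mu> z)\<bar> > \<epsilon>}" by (simp only:)
    qed
    ultimately show "(\<lambda>N. prob {\<omega> \<in> space M. \<bar>\<phi> (mean_resolvent N z \<omega>) - \<phi> (stieltjes \<mu> z)\<bar> > \<epsilon>}) \<longlonglongrightarrow> 0"
      by (rule Lim_transform_eventually)
  qed
  have re: "(\<lambda>N. expectation (\<lambda>\<omega>. Re (mean_resolvent N z \<omega>))) \<longlonglongrightarrow> Re (stieltjes \<mu> z)"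
    by (rule *[OF bounded_linear_Re abs_Re_le_cmod integral_cauchy_kernel_component(1)[OF _ _ z]])
  have im: "(\<lambda>N. expectation (\<lambda>\<omega>. Im (mean_resolvent N z \<omega>))) \<longlonglongrightarrow> Im (stieltjes \<mu> z)"
    by (rule *[OF bounded_linear_Im abs_Im_le_cmod integral_cauchy_kernel_component(2)[OF _ _ z]])
  have ev: "eventually (\<lambda>N. expectation (\<lambda>\<omega>. Re (mean_resolvent N z \<omega>)) = Re (expectation (mean_resolvent N z))) sequentially"
    "eventually (\<lambda>N. expectation (\<lambda>\<omega>. Im (mean_resolvent N z \<omega>)) = Im (expectation (mean_resolvent N z))) sequentially"
    using integral_bounded_linear[OF bounded_linear_Re integrable_mean_resolvent[OF _ z]]
      integral_bounded_linear[OF bounded_linear_Im integrable_mean_resolvent[OF _ z]]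
    by (auto intro!: eventually_sequentiallyI[of 1])
  show ?thesis
    unfolding tendsto_complex_iff using Lim_transform_eventually[OF re ev(1)] Lim_transform_eventually[OF im ev(2)]
    by blast
qed

lemma expectation_eq_integral_PiM:
  fixes f :: "(color set \<Rightarrow> real) \<Rightarrow> complex"
  assumes K: "K \<subseteq> color_edges" "K \<noteq> {}" "finite K" and f: "f \<in> borel_measurable (PiM K (\<lambda>_. std_normal))"
  shows "expectation (\<lambda>\<omega>. f (\<lambda>e\<in>K. Y e \<omega>)) = (LINT y|PiM K (\<lambda>_. std_normal). f y)"
proof -
  have rv: "Y e \<in> borel_measurable M" if "e \<in> K" for e using that K Y_measurable by blast
  \<comment> \<open>The characterization of independence by a product law wants a random variable at
    every index, so the family is set to 0 outside \<open>K\<close>.\<close>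
  let ?Y = "\<lambda>e. if e \<in> K then Y e else (\<lambda>_. 0)"
  have "indep_vars (\<lambda>_. borel) Y K" using indep_vars_subset[OF indep_Y K(1)] .
  then have "indep_vars (\<lambda>_. borel) ?Y K"
    by (subst indep_vars_cong[of K K ?Y Y "\<lambda>_. borel" "\<lambda>_. borel"]) auto
  then have "distr M (PiM K (\<lambda>_. borel)) (\<lambda>\<omega>. \<lambda>e\<in>K. ?Y e \<omega>) = PiM K (\<lambda>e. distr M borel (?Y e))"
    using rv K(2) by (subst (asm) indep_vars_iff_distr_eq_PiM) auto
  also have "\<dots> = PiM K (\<lambda>_. std_normal)"
    using K(1) by (intro PiM_cong refl) (auto intro!: distr_Y[simplified])
  also have "(\<lambda>\<omega>. \<lambda>e\<in>K. ?Y e \<omega>) = (\<lambda>\<omega>. \<lambda>e\<in>K. Y e \<omega>)" by (auto simp: fun_eq_iff)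
  finally have eq: "distr M (PiM K (\<lambda>_. borel)) (\<lambda>\<omega>. \<lambda>e\<in>K. Y e \<omega>) = PiM K (\<lambda>_. std_normal)" .
  have "(LINT y|distr M (PiM K (\<lambda>_. borel)) (\<lambda>\<omega>. \<lambda>e\<in>K. Y e \<omega>). f y) = expectation (\<lambda>\<omega>. f (\<lambda>e\<in>K. Y e \<omega>))"
  proof (rule integral_distr)
    show "(\<lambda>\<omega>. \<lambda>e\<in>K. Y e \<omega>) \<in> M \<rightarrow>\<^sub>M PiM K (\<lambda>_. borel)" using rv by (intro measurable_restrict) auto
    have "sets (PiM K (\<lambda>_. borel)) = sets (PiM K (\<lambda>_. std_normal))" by (intro sets_PiM_cong) auto
    then show "f \<in> borel_measurable (PiM K (\<lambda>_. borel))" using f measurable_cong_sets by blast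
  qed
  then show ?thesis unfolding eq by simp
qed

text \<open>Carries the estimate for an abstract variance profile over to the color matrix, with
  \<open>n\<close> the square of \<open>N\<close> and unordered pairs of colors as names of the
  Gaussian variables.\<close>

lemma expectation_mean_resolvent_approximation:
  assumes N: "N \<ge> 1" and z: "\<bar>Im z\<bar> \<ge> 2" "norm z \<ge> 2 * (1 + S)"
    and S: "\<And>u v. u \<in> color_space \<Longrightarrow> v \<in> color_space \<Longrightarrow> s u v \<le> S"
    and \<Psi>: "\<And>i. i < N\<^sup>2 \<Longrightarrow> norm (\<Psi> i) \<le> 1"
    and eq: "\<And>i. i < N\<^sup>2 \<Longrightarrow> norm (z * \<Psi> i - 1 - \<Psi> i *
      (\<Sum>j<N\<^sup>2. of_real (s (c N i) (c N j) / real (N\<^sup>2)) * \<Psi> j)) \<le> \<delta>"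
  shows "norm (expectation (mean_resolvent N z) - (\<Sum>i<N\<^sup>2. \<Psi> i) / of_nat (N\<^sup>2)) \<le> \<delta> + S / real (N\<^sup>2)"
proof -
  define n where "n = N\<^sup>2"
  have n: "n > 0" using N by (simp add: n_def)
  interpret g: gaussian_profile n "\<lambda>i j. {c N i, c N j}" "\<lambda>i j. s (c N i) (c N j)" S z
  proof
    show "n > 0" by (rule n)
    show "{c N i, c N j} = {c N k, c N l} \<longleftrightarrow> i = k \<and> j = l \<or> i = l \<and> j = k"
      if "i < n" "j < n" "k < n" "l < n" for i j k l
      using that unfolding n_def doubleton_eq_iff by (simp only: c_inj[OF N])
    show "s (c N i) (c N j) = s (c N j) (c N i)" if "i < n" "j < n" for i j
      using that s_symmetric c_space[OF N] unfolding n_def by blast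
    show "0 \<le> s (c N i) (c N j) \<and> s (c N i) (c N j) \<le> S" if "i < n" "j < n" for i j
      using that s_nonneg S c_space[OF N] unfolding n_def by blast
  qed (rule z)+
  have K: "g.K \<subseteq> color_edges" "g.K \<noteq> {}" "finite g.K"
  proof -
    have edges: "{c N i, c N j} \<in> color_edges" if "i < n" "j < n" for i j
      using that unfolding n_def by (rule edge_mem[OF N])
    show "g.K \<subseteq> color_edges" unfolding g.K_def
    proof (rule image_subsetI)
      fix q assume "q \<in> {..<n} \<times> {..<n}"
      then obtain i j where q: "q = (i, j)" "i < n" "j < n" by (cases q) simp
      show "(case q of (i, j) \<Rightarrow> {c N i, c N j}) \<in> color_edges"
        unfolding q(1) prod.case by (rule edges[OF q(2,3)])
    qed
    show "g.K \<noteq> {}" using g.e_in_K[OF n n] by blast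
  qed (rule g.finite_K)
  have entry: "entry N \<omega> i j = g.X (\<lambda>e\<in>g.K. Y e \<omega>) i j" if "i < n" "j < n" for i j \<omega>
  proof -
    have "g.w i j = (1 / real N) * (2 powr (of_bool (i = j) / 2) * sqrt (s (c N i) (c N j)))"
    proof -
      \<comment> \<open>Matches the two normalizations: the diagonal factor is a square root of 2 in
        both, and \<open>sqrt n\<close> is the scaling factor \<open>N\<close>.\<close>
      have 1: "(2::real) powr (of_bool b / 2) = sqrt (1 + of_bool b)" for b
        by (cases b) (simp_all add: powr_half_sqrt)
      have 2: "sqrt (real n) = real N" unfolding n_def by simp
      show ?thesis unfolding g.w_def 1 real_sqrt_divide real_sqrt_mult 2 by simp
    qed
    then show ?thesis using g.e_in_K[OF that] unfolding entry_def g.X_def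
      by (simp only: restrict_apply' mult.assoc)
  qed
  have res: "expectation (\<lambda>\<omega>. resolvent z n (entry N \<omega>) i i) = (LINT y|g.\<Omega>. g.G y i i)" if "i < n" for i
  proof -
    have "resolvent z n (entry N \<omega>) = g.G (\<lambda>e\<in>g.K. Y e \<omega>)" for \<omega>
      unfolding g.G_def by (rule resolvent_cong) (rule entry)
    then show ?thesis
      using expectation_eq_integral_PiM[OF K g.G_measurable[OF that that]] by (simp only:)
  qed
  have int: "integrable M (\<lambda>\<omega>. resolvent z n (entry N \<omega>) i i)" if "i < n" for i
  proof (rule integrable_const_bound)
    show "AE \<omega> in M. norm (resolvent z n (entry N \<omega>) i i) \<le> 1 / \<bar>Im z\<bar>"
      using resolvent_bound[OF entry_symmetric[OF N] g.Imz, folded n_def, OF that that] by simp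
    show "(\<lambda>\<omega>. resolvent z n (entry N \<omega>) i i) \<in> borel_measurable M"
      by (rule measurable_resolvent[OF _ that that]) (unfold n_def, rule entry_measurable[OF N])
  qed
  note approx = g.expected_resolvent_approximation[of \<Psi> \<delta>, unfolded n_def, OF \<Psi> eq, folded n_def]
  have "expectation (mean_resolvent N z) = expectation (\<lambda>\<omega>. \<Sum>i<n. resolvent z n (entry N \<omega>) i i) / of_nat n"
    unfolding mean_resolvent_def n_def[symmetric] by (rule integral_divide_zero)
  also have "expectation (\<lambda>\<omega>. \<Sum>i<n. resolvent z n (entry N \<omega>) i i) =
      (\<Sum>i<n. expectation (\<lambda>\<omega>. resolvent z n (entry N \<omega>) i i))"
    by (rule Bochner_Integration.integral_sum) (rule int, simp)
  also have "\<dots> = (\<Sum>i<n. LINT y|g.\<Omega>. g.G y i i)"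
    by (intro sum.cong refl res) simp
  finally have "expectation (mean_resolvent N z) - (\<Sum>i<N\<^sup>2. \<Psi> i) / of_nat (N\<^sup>2) =
      (\<Sum>i<n. (LINT y|g.\<Omega>. g.G y i i) - \<Psi> i) / of_nat n"
    unfolding n_def[symmetric] by (simp only: sum_subtractf diff_divide_distrib)
  also have "norm \<dots> \<le> (\<Sum>i<n. \<delta> + S / n) / n"
    unfolding norm_divide norm_of_nat
    by (intro divide_right_mono sum_norm_le approx) simp_all
  also have "\<dots> = \<delta> + S / n" using n by simp
  finally show ?thesis unfolding n_def .
qed

end

section \<open>From the kernel to the polynomial system\<close>

lemma kernel_laurent_data:
  assumes "kernel_assumption s"
  obtains \<I> d a where "finite \<I>" "partition_on {0..1} \<I>" "\<And>I. I \<in> \<I> \<Longrightarrow> is_interval I"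
    "\<And>x y \<xi> \<eta>. (x, \<xi>) \<in> color_space \<Longrightarrow> (y, \<eta>) \<in> color_space \<Longrightarrow> complex_of_real (s (x, \<xi>) (y, \<eta>)) =
      (\<Sum>k\<in>{- int d..int d}. \<Sum>j\<in>{- int d..int d}.
        a k (part_of \<I> x) j (part_of \<I> y) * \<xi> powi k * \<eta> powi j)"
proof -
  obtain \<sigma> \<I> where fin: "finite (fourier_support \<sigma>)"
    and exp': "\<forall>x y \<xi> \<eta>. (x, \<xi>) \<in> color_space \<longrightarrow> (y, \<eta>) \<in> color_space \<longrightarrow>
        complex_of_real (s (x, \<xi>) (y, \<eta>)) = (\<Sum>(i, j)\<in>fourier_support \<sigma>. \<sigma> i j x y * \<xi> powi i * \<eta> powi j)"
    and \<I>: "interval_partition \<I>"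
    and const': "\<forall>i j. \<forall>I\<in>\<I>. \<forall>J\<in>\<I>. (\<lambda>(x, y). \<sigma> i j x y) constant_on I \<times> J"
    using assms unfolding kernel_assumption_def by (elim conjE exE) (rule that; assumption)
  note exp = exp'[rule_format] and const = const'[rule_format]
  have part: "partition_on {0..1} \<I>" using \<I> by (simp add: interval_partition_def)
  define F where "F = fourier_support \<sigma>"
  \<comment> \<open>A generous bound for all degrees in the finite Fourier support.\<close>
  define d where "d = (\<Sum>(i, j)\<in>F. nat \<bar>i\<bar> + nat \<bar>j\<bar>)"
  let ?D = "{- int d..int d}"
  have FD: "F \<subseteq> ?D \<times> ?D"
  proof
    fix q assume "q \<in> F"
    moreover obtain i j where q: "q = (i, j)" by (cases q)
    ultimately have "(case (i, j) of (i, j) \<Rightarrow> nat \<bar>i\<bar> + nat \<bar>j\<bar>) \<le> d"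
      unfolding d_def using fin by (intro member_le_sum) (auto simp: F_def)
    then show "q \<in> ?D \<times> ?D" unfolding q by auto
  qed
  \<comment> \<open>Coefficients are constant on products of intervals, so their values at one
    chosen point of each interval determine them.\<close>
  define rep where "rep I = (SOME x. x \<in> I)" for I :: "real set"
  define a where "a k I j I' = (if (k, j) \<in> F then \<sigma> k j (rep I) (rep I') else 0)" for k I j I'
  have \<sigma>_rep: "\<sigma> k j (rep (part_of \<I> x)) (rep (part_of \<I> y)) = \<sigma> k j x y"
    if "x \<in> {0..1}" "y \<in> {0..1}" for k j x y
  proof -
    note x = part_of_mem[OF part that(1)] and y = part_of_mem[OF part that(2)]
    have r: "rep (part_of \<I> x) \<in> part_of \<I> x" "rep (part_of \<I> y) \<in> part_of \<I> y"
      unfolding rep_def using x(2) y(2) by (auto intro: someI)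
    obtain w where "\<And>u. u \<in> part_of \<I> x \<times> part_of \<I> y \<Longrightarrow> (\<lambda>(x, y). \<sigma> k j x y) u = w"
      using const[OF x(1) y(1), of k j] unfolding constant_on_def by blast
    from this[of "(rep (part_of \<I> x), rep (part_of \<I> y))"] this[of "(x, y)"] show ?thesis
      using r x(2) y(2) by simp
  qed
  have main: "complex_of_real (s (x, \<xi>) (y, \<eta>)) = (\<Sum>k\<in>?D. \<Sum>j\<in>?D.
      a k (part_of \<I> x) j (part_of \<I> y) * \<xi> powi k * \<eta> powi j)"
    if "(x, \<xi>) \<in> color_space" "(y, \<eta>) \<in> color_space" for x y \<xi> \<eta>
  proof -
    have xy: "x \<in> {0..1}" "y \<in> {0..1}" using that by (auto simp: color_space_def)
    have "(\<Sum>k\<in>?D. \<Sum>j\<in>?D. a k (part_of \<I> x) j (part_of \<I> y) * \<xi> powi k * \<eta> powi j) =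
        (\<Sum>(k, j)\<in>?D \<times> ?D. a k (part_of \<I> x) j (part_of \<I> y) * \<xi> powi k * \<eta> powi j)"
      by (rule sum.cartesian_product)
    also have "\<dots> = (\<Sum>(k, j)\<in>F. a k (part_of \<I> x) j (part_of \<I> y) * \<xi> powi k * \<eta> powi j)"
    proof (rule sum.mono_neutral_right[OF _ FD])
      show "\<forall>q\<in>?D \<times> ?D - F. (case q of (k, j) \<Rightarrow>
          a k (part_of \<I> x) j (part_of \<I> y) * \<xi> powi k * \<eta> powi j) = 0"
      proof
        fix q assume "q \<in> ?D \<times> ?D - F"
        then show "(case q of (k, j) \<Rightarrow> a k (part_of \<I> x) j (part_of \<I> y) * \<xi> powi k * \<eta> powi j) = 0"
          by (cases q) (simp only: a_def Diff_iff if_False prod.case mult_zero_left)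
      qed
    qed simp
    also have "\<dots> = (\<Sum>(k, j)\<in>F. \<sigma> k j x y * \<xi> powi k * \<eta> powi j)"
    proof (rule sum.cong[OF refl])
      fix q assume "q \<in> F"
      then show "(case q of (k, j) \<Rightarrow> a k (part_of \<I> x) j (part_of \<I> y) * \<xi> powi k * \<eta> powi j) =
          (case q of (k, j) \<Rightarrow> \<sigma> k j x y * \<xi> powi k * \<eta> powi j)"
        by (cases q) (simp only: a_def if_True prod.case \<sigma>_rep[OF xy])
    qed
    finally show ?thesis using exp[OF that] by (simp add: F_def)
  qed
  show thesis
  proof (rule that[of \<I> a d])
    show "finite \<I>" "\<And>I. I \<in> \<I> \<Longrightarrow> is_interval I" using \<I> by (simp_all add: interval_partition_def)
  qed (fact part main)+
qed

lemma stieltjes_eq_laurent_solution: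
  assumes "color_ensemble s M Y c" and \<mu>: "is_kernel_measure M Y c s \<mu>"
    and part: "finite \<I>" "partition_on {0..1} \<I>" "\<And>I. I \<in> \<I> \<Longrightarrow> is_interval I"
    and kernel: "\<And>x y \<xi> \<eta>. (x, \<xi>) \<in> color_space \<Longrightarrow> (y, \<eta>) \<in> color_space \<Longrightarrow>
      complex_of_real (s (x, \<xi>) (y, \<eta>)) = (\<Sum>k\<in>{- int d..int d}. \<Sum>j\<in>{- int d..int d}.
        a k (part_of \<I> x) j (part_of \<I> y) * \<xi> powi k * \<eta> powi j)"
    and sol: "laurent_solution \<I> d (\<lambda>I. Sup I - Inf I) a x z"
    and Im_z: "\<bar>Im z\<bar> \<ge> 2" and norm_z: "norm z \<ge> 2 * (1 + laurent_system.C \<I> d a)"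
  shows "stieltjes \<mu> z = laurent_system.l \<I> d (\<lambda>I. Sup I - Inf I) x"
proof -
  interpret color_ensemble s M Y c by fact
  interpret laurent_solution \<I> d "\<lambda>I. Sup I - Inf I" a x z by fact
  have zC: "norm z \<ge> 2 * (1 + C)" by (rule norm_z)
  define t where "t N = (\<Sum>I\<in>\<I>. \<bar>real (grid_count N I) / real N - (Sup I - Inf I)\<bar>)" for N
  have "t \<longlonglongrightarrow> (\<Sum>I\<in>\<I>. \<bar>(Sup I - Inf I) - (Sup I - Inf I)\<bar>)"
    unfolding t_def
  proof (intro tendsto_sum tendsto_rabs tendsto_diff tendsto_const grid_count_tendsto)
    fix I assume I: "I \<in> \<I>"
    show "is_interval I" by (rule part(3)[OF I])
    show "I \<noteq> {}" using partition_onD3[OF part(2)] I by blast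
    show "I \<subseteq> {0..1}" using partition_onD1[OF part(2)] I by blast
  qed
  then have t: "t \<longlonglongrightarrow> 0" by simp
  have ker: "complex_of_real (s u v) = ker (part_of \<I> (fst u)) (snd u) (part_of \<I> (fst v)) (snd v)"
    if "u \<in> color_space" "v \<in> color_space" for u v
    using kernel[of "fst u" "snd u" "fst v" "snd v"] that unfolding ker_def prod.collapse by blast
  have mem: "part_of \<I> (fst u) \<in> \<I>" "norm (snd u) = 1" if "u \<in> color_space" for u
    using that part_of_mem[OF part(2)] unfolding color_space_def by (simp_all add: mem_Times_iff)
  have S: "s u v \<le> C" if "u \<in> color_space" "v \<in> color_space" for u v
  proof -
    have "s u v \<le> norm (complex_of_real (s u v))" by simp
    also have "\<dots> \<le> C" unfolding ker[OF that] using mem that by (intro ker_bound)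
    finally show ?thesis .
  qed
  have bound: "norm (stieltjes \<mu> z - l x) \<le> 4 * (m * C) * (1 / 2) ^ K" for K
  proof -
    have ev: "norm (expectation (mean_resolvent N z) - l x) \<le>
        (4 * (m * C) * (1 / 2) ^ K + C * t N) + C / real (N\<^sup>2) + t N" if N: "N > (K + 2) * m" for N
    proof -
      have N1: "N \<ge> 1" using N by simp
      define r where "r I = real (grid_count N I) / real N" for I
      define \<Psi> where "\<Psi> i = Psi K (part_of \<I> (fst (c N i))) (snd (c N i))" for i
      have avg: "(\<Sum>i<N\<^sup>2. h (part_of \<I> (fst (c N i))) (snd (c N i))) / of_nat (N\<^sup>2) =
          (\<Sum>I\<in>\<I>. of_real (r I) * ((\<Sum>\<xi> | \<xi> ^ N = 1. h I \<xi>) / of_nat N))" for h :: "real set \<Rightarrow> complex \<Rightarrow> complex"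
      proof -
        have "(\<Sum>i<N\<^sup>2. h (part_of \<I> (fst (c N i))) (snd (c N i))) =
            (\<Sum>u\<in>color_grid N. h (part_of \<I> (fst u)) (snd u))"
          by (rule sum.reindex_bij_betw[OF c_bij[OF N1]])
        also have "\<dots> = (\<Sum>I\<in>\<I>. of_nat (grid_count N I) * (\<Sum>\<xi> | \<xi> ^ N = 1. h I \<xi>))"
          by (rule sum_color_grid[OF N1 part(2,1)])
        finally have grid: "(\<Sum>i<N\<^sup>2. h (part_of \<I> (fst (c N i))) (snd (c N i))) = \<dots>" .
        have "(\<Sum>I\<in>\<I>. of_nat (grid_count N I) * f I) / of_nat (N\<^sup>2) =
            (\<Sum>I\<in>\<I>. of_real (r I) * (f I / of_nat N))" for f :: "real set \<Rightarrow> complex"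
          unfolding r_def by (simp add: sum_divide_distrib power2_eq_square)
        then show ?thesis unfolding grid .
      qed
      have cs: "c N i \<in> color_space" if "i < N\<^sup>2" for i using c_space[OF N1 that] .
      have eq: "norm (z * \<Psi> i - 1 - \<Psi> i * (\<Sum>j<N\<^sup>2. of_real (s (c N i) (c N j) / real (N\<^sup>2)) * \<Psi> j))
          \<le> 4 * (m * C) * (1 / 2) ^ K + C * t N" if i: "i < N\<^sup>2" for i
      proof -
        let ?h = "\<lambda>I' \<eta>. ker (part_of \<I> (fst (c N i))) (snd (c N i)) I' \<eta> * Psi K I' \<eta>"
        have "(\<Sum>j<N\<^sup>2. of_real (s (c N i) (c N j) / real (N\<^sup>2)) * \<Psi> j) =
            (\<Sum>j<N\<^sup>2. ?h (part_of \<I> (fst (c N j))) (snd (c N j))) / of_nat (N\<^sup>2)"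
          unfolding sum_divide_distrib
        proof (intro sum.cong refl)
          fix j assume "j \<in> {..<N\<^sup>2}"
          then have "of_real (s (c N i) (c N j)) * \<Psi> j = ?h (part_of \<I> (fst (c N j))) (snd (c N j))"
            unfolding \<Psi>_def using ker[OF cs[OF i] cs[of j]] by simp
          then show "of_real (s (c N i) (c N j) / real (N\<^sup>2)) * \<Psi> j =
              ?h (part_of \<I> (fst (c N j))) (snd (c N j)) / of_nat (N\<^sup>2)"
            by simp
        qed
        also have "\<dots> = (\<Sum>I'\<in>\<I>. of_real (r I') * ((\<Sum>\<eta> | \<eta> ^ N = 1. ?h I' \<eta>) / of_nat N))"
          by (rule avg)
        finally have sum_eq: "(\<Sum>j<N\<^sup>2. of_real (s (c N i) (c N j) / real (N\<^sup>2)) * \<Psi> j) =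
            (\<Sum>I'\<in>\<I>. of_real (r I') * ((\<Sum>\<eta> | \<eta> ^ N = 1. ?h I' \<eta>) / of_nat N))" .
        show ?thesis
          unfolding sum_eq unfolding \<Psi>_def t_def r_def[symmetric]
          by (rule Psi_approximate_equation[OF N mem(2)[OF cs[OF i]] mem(1)[OF cs[OF i]]])
      qed
      have \<Psi>1: "norm (\<Psi> i) \<le> 1" if "i < N\<^sup>2" for i
        unfolding \<Psi>_def using mem[OF cs[OF that]] by (intro Psi_bound)
      have 1: "norm (expectation (mean_resolvent N z) - (\<Sum>i<N\<^sup>2. \<Psi> i) / of_nat (N\<^sup>2)) \<le>
          (4 * (m * C) * (1 / 2) ^ K + C * t N) + C / real (N\<^sup>2)"
        by (rule expectation_mean_resolvent_approximation[OF N1 Im_z zC S \<Psi>1 eq])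
      have 2: "norm ((\<Sum>i<N\<^sup>2. \<Psi> i) / of_nat (N\<^sup>2) - l x) \<le> t N"
        unfolding \<Psi>_def avg[of "Psi K"] t_def r_def[symmetric] by (rule Psi_average[OF N])
      have "expectation (mean_resolvent N z) - l x =
          (expectation (mean_resolvent N z) - (\<Sum>i<N\<^sup>2. \<Psi> i) / of_nat (N\<^sup>2)) +
          ((\<Sum>i<N\<^sup>2. \<Psi> i) / of_nat (N\<^sup>2) - l x)" by simp
      then show ?thesis using norm_triangle_mono[OF 1 2] by simp
    qed
    have "Im z \<noteq> 0" using Im_z by auto
    then have 1: "(\<lambda>N. norm (expectation (mean_resolvent N z) - l x)) \<longlonglongrightarrow> norm (stieltjes \<mu> z - l x)"
      by (intro tendsto_intros expectation_mean_resolvent_tendsto \<mu>)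
    have "(\<lambda>N. C * (1 / real N * (1 / real N))) \<longlonglongrightarrow> C * (0 * 0)"
      by (intro tendsto_mult tendsto_const lim_1_over_n)
    then have "(\<lambda>N. C / real (N\<^sup>2)) \<longlonglongrightarrow> 0" by (simp add: power2_eq_square)
    then have 2: "(\<lambda>N. (4 * (m * C) * (1 / 2) ^ K + C * t N) + C / real (N\<^sup>2) + t N) \<longlonglongrightarrow>
        (4 * (m * C) * (1 / 2) ^ K + C * 0) + 0 + 0"
      by (intro tendsto_add tendsto_mult tendsto_const t)
    have "norm (stieltjes \<mu> z - l x) \<le> (4 * (m * C) * (1 / 2) ^ K + C * 0) + 0 + 0"
      by (rule LIMSEQ_le[OF 1 2]) (use ev in \<open>auto intro!: exI[of _ "Suc ((K + 2) * m)"]\<close>)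
    then show ?thesis by simp
  qed
  have "(\<lambda>K. 4 * (m * C) * (1 / 2) ^ K) \<longlonglongrightarrow> 4 * (m * C) * 0"
    by (intro tendsto_mult tendsto_const LIMSEQ_power_zero) simp
  then have "norm (stieltjes \<mu> z - l x) \<le> 4 * (m * C) * 0"
    by (rule LIMSEQ_le_const) (use bound in blast)
  then show ?thesis by simp
qed

theorem theorem2p6:
  fixes s :: "color \<Rightarrow> color \<Rightarrow> real"
    and M :: "'w measure"
    and Y :: "color set \<Rightarrow> 'w \<Rightarrow> real"
    and c :: "nat \<Rightarrow> nat \<Rightarrow> color"
    and \<mu> :: "real measure"
  assumes "kernel_assumption s"
    and "iid_std_normal_family M Y"
    and "grid_enumeration c"
    and "is_kernel_measure M Y c s \<mu>"
  shows "\<exists>F :: complex poly poly. F \<noteq> 0 \<and>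
    (\<forall>z :: complex. z \<notin> complex_of_real ` measure_support \<mu> \<longrightarrow> eval_XY F z (stieltjes \<mu> z) = 0)"
proof (rule kernel_laurent_data[OF assms(1)])
  fix \<I> d a
  assume part: "finite \<I>" "partition_on {0..1} \<I>" "\<And>I. I \<in> \<I> \<Longrightarrow> is_interval I"
    and kernel: "\<And>x y \<xi> \<eta>. (x, \<xi>) \<in> color_space \<Longrightarrow> (y, \<eta>) \<in> color_space \<Longrightarrow>
      complex_of_real (s (x, \<xi>) (y, \<eta>)) = (\<Sum>k\<in>{- int d..int d}. \<Sum>j\<in>{- int d..int d}.
        a k (part_of \<I> x) j (part_of \<I> y) * \<xi> powi k * \<eta> powi j)"
  have ens: "color_ensemble s M Y c"
    using assms by (intro color_ensemble.intro) (auto simp: kernel_assumption_def)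
  interpret laurent_system \<I> d "\<lambda>I. Sup I - Inf I" a
  proof
    show "finite \<I>" by (rule part(1))
    fix I assume I: "I \<in> \<I>"
    have ne: "I \<noteq> {}" using partition_onD3[OF part(2)] I by blast
    have sub: "I \<subseteq> {0..1}" using partition_onD1[OF part(2)] I by blast
    then have bdd: "bdd_below I" "bdd_above I" by (auto intro!: bdd_belowI[of _ 0] bdd_aboveI[of _ 1])
    have "Inf I \<le> Sup I" using cInf_le_cSup[OF ne bdd(2,1)] .
    moreover have "0 \<le> Inf I" "Sup I \<le> 1"
      using sub ne by (auto intro!: cInf_greatest cSup_least)
    ultimately show "0 \<le> Sup I - Inf I \<and> Sup I - Inf I \<le> 1" by simp
  qed
  \<comment> \<open>The polynomial is fixed here, before any \<open>z\<close>; the solution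
    \<open>x\<close> is chosen for each \<open>z\<close> separately afterwards.\<close>
  from large_solution_algebraic[OF finite_unknowns poly_fun_Q poly_fun_l]
  obtain F where F: "F \<noteq> 0 \<and> (\<exists>R. \<forall>z. norm z \<ge> R \<longrightarrow>
      (\<exists>x. (\<forall>i\<in>unknowns. norm (x i) \<le> 1 \<and> z * x i = Q i x) \<and> eval_XY F z (l x) = 0))" ..
  from conjunct2[OF F] obtain R where R: "\<forall>z. norm z \<ge> R \<longrightarrow>
      (\<exists>x. (\<forall>i\<in>unknowns. norm (x i) \<le> 1 \<and> z * x i = Q i x) \<and> eval_XY F z (l x) = 0)" ..
  \<comment> \<open>In this order: existence of an algebraic solution, decay of its blocks, and the
    two lower bounds for the moment hierarchy, where \<open>C\<close> serves as bound of the
    kernel.\<close>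
  define R' where "R' = Max {R, 3 * m * B, 2 * (1 + C), 2}"
  have R': "R \<le> R'" "3 * m * B \<le> R'" "2 * (1 + C) \<le> R'" "2 \<le> R'" by (simp_all add: R'_def)
  have zero: "eval_XY F z (stieltjes \<mu> z) = 0" if z: "\<bar>Im z\<bar> \<ge> R'" for z
  proof -
    have nz: "norm z \<ge> R'" using z abs_Im_le_cmod[of z] by linarith
    from R[rule_format, OF order_trans[OF R'(1) nz]]
    obtain x where x: "(\<forall>i\<in>unknowns. norm (x i) \<le> 1 \<and> z * x i = Q i x) \<and> eval_XY F z (l x) = 0" ..
    have sol: "laurent_solution \<I> d (\<lambda>I. Sup I - Inf I) a x z"
    proof unfold_locales
      show "norm (x i) \<le> 1 \<and> z * x i = Q i x" if "i \<in> unknowns" for i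
        using conjunct1[OF x] that by (rule bspec)
      show "3 * m * B \<le> norm z" using R'(2) nz by (rule order_trans)
    qed
    have "stieltjes \<mu> z = l x"
    proof (rule stieltjes_eq_laurent_solution[OF ens assms(4) part kernel sol])
      show "2 \<le> \<bar>Im z\<bar>" using R'(4) z by (rule order_trans)
      show "2 * (1 + C) \<le> norm z" using R'(3) nz by (rule order_trans)
    qed
    then show ?thesis using conjunct2[OF x] by simp
  qed
  have "real_distribution \<mu>" using assms(4) by (simp add: is_kernel_measure_def)
  from algebraic_off_support[OF this zero] show ?thesis
    using conjunct1[OF F] by (intro exI[of _ F] conjI allI impI)
qed

end
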